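(* For $\delta\geq 0$ consider the damped wave equation on $[0,\pi]$ $$\epsilon^2\,\mathrm{d}u_t+(u_t-\Delta u)\,\mathrm{d}t=f(u)\,\mathrm{d}t+\delta\phi\,\mathrm{d}W,\qquad u(t,0)=u(t,\pi)=0,$$ with $f:L^2(0,\pi)\to L^2(0,\pi)$ globally Lipschitz and $\phi\in H_0^1(0,\pi)$. With the parameters $\epsilon,N$ as in the context, let $M_\delta(\omega)$ ($\delta>0$) be the stochastic inertial manifold of this equation, and let $M_0$ be the inertial manifold of the equation with $\delta=0$, of the same dimension as $M_\delta(\omega)$, both constructed by the Lyapunov–Perron method as in the context. For $R>0$ let $$M_\delta^R(\omega):=\{\xi+\tilde h_\delta(\xi,\omega)\mid\xi\in PE,\ \|\xi\|_E\le R\},$$ where $\tilde h_\delta(\cdot,\omega):PE\to QE$ is the map whose graph is $M_\delta(\omega)$. Then for every $R>0$, $$\lim_{\delta\to0}\ \sup_{U\in M_\delta^R(\omega)}\ \inf_{V\in M_0}\|U-V\|_E=0$$ almost surely.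
   Context: **Noise.** $W$ is the standard two-sided real Wiener process, realized on $C_0(\mathbb R,\mathbb R)$ with Wiener measure and shifts $\theta_t\omega(\cdot)=\omega(t+\cdot)-\omega(t)$; $z(\theta_t\omega)$, with $z(\omega)=-\epsilon^{-4}\int_{-\infty}^0e^{\tau/\epsilon^2}\omega(\tau)\,\mathrm{d}\tau$, is the stationary solution of $\epsilon^2\mathrm{d}z+z\,\mathrm{d}t=\mathrm{d}W$. On a shift-invariant set $\Omega$ of full measure, $t\mapsto z(\theta_t\omega)$ is continuous and $z(\theta_t\omega)/t\to0$ as $t\to\pm\infty$. **First-order form.** $E=H_0^1(0,\pi)\times L^2(0,\pi)$, $\tilde A=-\Delta$ with Dirichlet conditions. With $U=(u,u_t-\delta\phi z)$ the equation becomes $$\dot U=AU+F_\delta(\theta_t\omega,U),\quad A=\begin{pmatrix}0&\mathrm{id}\\-\epsilon^{-2}\tilde A&-\epsilon^{-2}\mathrm{id}\end{pmatrix},\quad F_\delta(\omega,(u,v))=\begin{pmatrix}\delta\phi z(\omega)\\ \epsilon^{-2}f(u)\end{pmatrix}.$$ $A$ generates a $C^0$-semigroup on $E$ and has eigenvalues $\lambda_k^\pm=\frac{-1\pm\sqrt{1-4\epsilon^2k^2}}{2\epsilon^2}$ with eigenvectors $e_k^\pm=(\sin kx,\lambda_k^\pm\sin kx)$, $k\ge1$. **Splitting and norm.** Let $N\ge1$ and $\epsilon>0$ satisfy $\frac1{2\epsilon}>N+1$. Put $E_1=\mathrm{Span}\{e_k^+\mid1\le k\le N\}$, $E_{-1}=\mathrm{Span}\{e_k^-\mid1\le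 k\le N\}$, $E_{11}=E_1\oplus E_{-1}$, $E_{22}$ = closed span of $\{e_k^\pm\mid k\ge N+1\}$ (the pairs in $E$ whose first $N$ sine coefficients vanish in both components), $E_2=E_{-1}\oplus E_{22}$. With $\langle\cdot,\cdot\rangle$ and $\|\cdot\|$ the $L^2(0,\pi)$ inner product and norm, and $U_i=(u_i,v_i)$, define on $E_{11}$ and $E_{22}$ respectively $$\langle U_1,U_2\rangle_{E_{11}}=\tfrac1{4\epsilon^2}\langle u_1,u_2\rangle-\langle\tilde A^{1/2}u_1,\tilde A^{1/2}u_2\rangle+\langle\tfrac1{2\epsilon}u_1+\epsilon v_1,\tfrac1{2\epsilon}u_2+\epsilon v_2\rangle,$$ $$\langle U_1,U_2\rangle_{E_{22}}=\langle\tilde A^{1/2}u_1,\tilde A^{1/2}u_2\rangle+\big(\tfrac1{4\epsilon^2}-2(N+1)^2\big)\langle u_1,u_2\rangle+\langle\tfrac1{2\epsilon}u_1+\epsilon v_1,\tfrac1{2\epsilon}u_2+\epsilon v_2\rangle,$$ and $\langle U,V\rangle_E=\langle U_{11},V_{11}\rangle_{E_{11}}+\langle U_{22},V_{22}\rangle_{E_{22}}$ for $U=U_{11}+U_{22}$, $V=V_{11}+V_{22}$. This inner product, with norm $\|\cdot\|_E$, is equivalent to the usual one on $E$, and $E=E_1\oplus E_2$ is orthogonal for it. $P$ and $Q=I-P$ are the corresponding projections onto $E_1=PE$ and $E_2=QE$. One has $\|e^{At}|_{E_1}\|=e^{\lambda_N^+t}$ for $t\le0$ and $\|e^{At}|_{E_2}\|=e^{\lambda_{N+1}^+t}$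 for $t\ge0$. **The manifolds.** Put $\alpha=\lambda_N^+$, $\beta=\lambda_{N+1}^+$, $\eta=\frac{\alpha+\beta}2$, and let $\mathrm{Lip}F$ be the Lipschitz constant of $F_\delta(\omega,\cdot)$ on $(E,\|\cdot\|_E)$ (it does not depend on $\delta,\omega$). $N$ is large enough and $\epsilon$ small enough that the following spectral gap condition holds for every $\delta\ge0$: $$\mathrm{Lip}F\Big(\frac1{\alpha-\eta}+\frac1{\eta-\beta}\Big)+\mathrm{Lip}h_\delta\cdot\mathrm{Lip}F\,\frac1{\alpha-\eta}<1,$$ where $\mathrm{Lip}h_\delta$ is the Lipschitz constant in $\xi$ (uniform in $\omega$) of the map $h_\delta$ defined as follows: for $\xi\in PE$, $U(\cdot;\xi,\omega)$ is the unique continuous function $(-\infty,0]\to E$ with $\sup_{t\le0}e^{-\eta t}\|U(t)\|_E<\infty$ and $$U(t)=e^{At}\xi+\int_0^te^{A(t-s)}PF_\delta(\theta_s\omega,U(s))\,\mathrm{d}s+\int_{-\infty}^te^{A(t-s)}QF_\delta(\theta_s\omega,U(s))\,\mathrm{d}s,\quad t\le0,$$ and $h_\delta(\xi,\omega)=\int_{-\infty}^0e^{-As}QF_\delta(\theta_s\omega,U(s;\xi,\omega))\,\mathrm{d}s\in QE$. (Existence and uniqueness of $U$ already follow from $\mathrm{Lip}F(\frac1{\alpha-\eta}+\frac1{\eta-\beta})<1$.) The stochastic inertial manifold of the wave equation, in the variables $(u,u_t)$, is $$M_\delta(\omega)=\{\xi+h_\delta(\xi,\omega)+(0,\delta\phi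 z(\omega))\mid\xi\in PE\},$$ which is the graph over $PE$ of $\tilde h_\delta(\xi,\omega)=h_\delta\big(\xi-P(0,\delta\phi z(\omega)),\omega\big)+Q(0,\delta\phi z(\omega))$. For $\delta=0$ it is the deterministic set $M_0=\{\xi+h_0(\xi)\mid\xi\in PE\}$. *)

theory Defs
  imports "HOL-Probability.Probability" "HOL-Real_Asymp.Real_Asymp"
begin

section \<open>The Hilbert space \<open>L\<^sup>2(0, \<pi>)\<close>\<close>

abbreviation ivl :: "real measure" where
  "ivl \<equiv> lebesgue_on {0<..<pi}"

definition square_integrable :: "(real \<Rightarrow> real) \<Rightarrow> bool" where
  "square_integrable f \<longleftrightarrow> f \<in> borel_measurable ivl \<and> integrable ivl (\<lambda>x. (f x)\<^sup>2)"

definition l2_rel :: "(real \<Rightarrow> real) \<Rightarrow> (real \<Rightarrow> real) \<Rightarrow> bool" where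
  "l2_rel f g \<longleftrightarrow> square_integrable f \<and> square_integrable g \<and> (AE x in ivl. f x = g x)"

lemma square_integrable_zero [simp]: "square_integrable (\<lambda>_. 0)"
  by (simp add: square_integrable_def)

lemma part_equivp_l2_rel: "part_equivp l2_rel"
proof (rule part_equivpI)
  show "\<exists>f. l2_rel f f"
    by (rule exI[of _ "\<lambda>_. 0"]) (simp add: l2_rel_def)
  show "symp l2_rel"
    by (auto simp: symp_def l2_rel_def)
  show "transp l2_rel"
  proof (rule transpI)
    fix f g h assume "l2_rel f g" "l2_rel g h"
    then show "l2_rel f h" by (auto simp: l2_rel_def)
  qed
qed

quotient_type l2 = "real \<Rightarrow> real" / partial: l2_rel
  by (rule part_equivp_l2_rel)

abbreviation l2_of :: "(real \<Rightarrow> real) \<Rightarrow> l2" where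
  "l2_of \<equiv> abs_l2"

lemma l2_rel_refl [simp]: "l2_rel f f \<longleftrightarrow> square_integrable f"
  by (simp add: l2_rel_def)

lemma square_integrable_mult:
  assumes "square_integrable f" "square_integrable g"
  shows "integrable ivl (\<lambda>x. f x * g x)"
proof (rule Bochner_Integration.integrable_bound)
  show "integrable ivl (\<lambda>x. (f x)\<^sup>2 + (g x)\<^sup>2)"
    using assms by (auto simp: square_integrable_def)
  show "(\<lambda>x. f x * g x) \<in> borel_measurable ivl"
    using assms by (auto simp: square_integrable_def)
  have "\<bar>a * b\<bar> \<le> a\<^sup>2 + b\<^sup>2" for a b :: real
  proof -
    have "0 \<le> (\<bar>a\<bar> - \<bar>b\<bar>)\<^sup>2" by simp
    then have "2 * (\<bar>a\<bar> * \<bar>b\<bar>) \<le> a\<^sup>2 + b\<^sup>2" by (simp add: power2_diff)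
    moreover have "0 \<le> \<bar>a\<bar> * \<bar>b\<bar>" by simp
    ultimately show ?thesis unfolding abs_mult by linarith
  qed
  then show "AE x in ivl. norm (f x * g x) \<le> norm ((f x)\<^sup>2 + (g x)\<^sup>2)"
    by (auto intro!: AE_I2)
qed

lemma square_integrable_add:
  assumes "square_integrable f" "square_integrable g"
  shows "square_integrable (\<lambda>x. f x + g x)"
proof -
  have "integrable ivl (\<lambda>x. (f x)\<^sup>2 + (g x)\<^sup>2 + 2 * (f x * g x))"
    using assms square_integrable_mult[OF assms]
    by (auto simp: square_integrable_def simp del: integrable_mult_left_iff)
  moreover have "(f x + g x)\<^sup>2 = (f x)\<^sup>2 + (g x)\<^sup>2 + 2 * (f x * g x)" for x
    by (simp add: power2_sum)
  moreover have "(\<lambda>x. f x + g x) \<in> borel_measurable ivl"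
    using assms by (auto simp: square_integrable_def intro: borel_measurable_add)
  ultimately show ?thesis
    by (simp add: square_integrable_def)
qed

lemma square_integrable_scale:
  "square_integrable f \<Longrightarrow> square_integrable (\<lambda>x. c * f x)"
  by (auto simp: square_integrable_def power_mult_distrib)

instantiation l2 :: real_inner
begin

lift_definition zero_l2 :: l2 is "\<lambda>_. 0" by simp

lift_definition plus_l2 :: "l2 \<Rightarrow> l2 \<Rightarrow> l2" is "\<lambda>f g x. f x + g x"
  by (auto simp: l2_rel_def square_integrable_add)

lift_definition scaleR_l2 :: "real \<Rightarrow> l2 \<Rightarrow> l2" is "\<lambda>c f x. c * f x"
  by (auto simp: l2_rel_def square_integrable_scale)

lift_definition uminus_l2 :: "l2 \<Rightarrow> l2" is "\<lambda>f x. - f x"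
  by (auto simp: l2_rel_def square_integrable_def)

definition minus_l2 :: "l2 \<Rightarrow> l2 \<Rightarrow> l2" where
  "minus_l2 u v = u + - v"

lift_definition inner_l2 :: "l2 \<Rightarrow> l2 \<Rightarrow> real" is "\<lambda>f g. integral\<^sup>L ivl (\<lambda>x. f x * g x)"
  by (rule integral_cong_AE) (auto simp: l2_rel_def square_integrable_def)

definition norm_l2 :: "l2 \<Rightarrow> real" where
  "norm_l2 u = sqrt (inner u u)"

definition sgn_l2 :: "l2 \<Rightarrow> l2" where
  "sgn_l2 u = inverse (norm u) *\<^sub>R u"

definition dist_l2 :: "l2 \<Rightarrow> l2 \<Rightarrow> real" where
  "dist_l2 u v = norm (u - v)"

definition uniformity_l2 :: "(l2 \<times> l2) filter" where
  "uniformity_l2 = (INF e\<in>{0<..}. principal {(u, v). dist u v < e})"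

definition open_l2 :: "l2 set \<Rightarrow> bool" where
  "open_l2 U \<longleftrightarrow> (\<forall>u\<in>U. eventually (\<lambda>(u', v). u' = u \<longrightarrow> v \<in> U) uniformity)"

instance
proof
  fix u v w :: l2 and a b :: real
  show "u + v + w = u + (v + w)"
    by transfer (simp add: l2_rel_def square_integrable_add add.assoc)
  show "u + v = v + u"
    by transfer (simp add: l2_rel_def square_integrable_add add.commute)
  show "0 + u = u"
    by transfer (simp add: l2_rel_def square_integrable_add)
  show "- u + u = 0"
    by transfer (simp add: l2_rel_def)
  show "u - v = u + - v"
    by (rule minus_l2_def)
  show "a *\<^sub>R (u + v) = a *\<^sub>R u + a *\<^sub>R v"
    by transfer (simp add: l2_rel_def square_integrable_add square_integrable_scale distrib_left)
  show "(a + b) *\<^sub>R u = a *\<^sub>R u + b *\<^sub>R u"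
    by transfer (simp add: l2_rel_def square_integrable_add square_integrable_scale distrib_right)
  show "a *\<^sub>R b *\<^sub>R u = (a * b) *\<^sub>R u"
    by transfer (simp add: l2_rel_def square_integrable_scale mult.assoc)
  show "1 *\<^sub>R u = u"
    by transfer simp
  show "dist u v = norm (u - v)"
    by (rule dist_l2_def)
  show "sgn u = inverse (norm u) *\<^sub>R u"
    by (rule sgn_l2_def)
  show "(uniformity :: (l2 \<times> l2) filter) = (INF e\<in>{0<..}. principal {(u, v). dist u v < e})"
    by (rule uniformity_l2_def)
  show "open U \<longleftrightarrow> (\<forall>u\<in>U. eventually (\<lambda>(u', v). u' = u \<longrightarrow> v \<in> U) uniformity)" for U :: "l2 set"
    by (rule open_l2_def)
  show "inner u v = inner v u"
    by transfer (simp add: mult.commute)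
  show "inner (u + v) w = inner u w + inner v w"
    by transfer (simp add: distrib_right square_integrable_mult)
  show "inner (a *\<^sub>R u) v = a * inner u v"
    by transfer (simp add: mult.assoc)
  show "0 \<le> inner u u"
    by transfer (simp add: integral_nonneg_AE)
  show "inner u u = 0 \<longleftrightarrow> u = 0"
  proof transfer
    fix f assume "l2_rel f f"
    then have f: "square_integrable f" by simp
    then have "(integral\<^sup>L ivl (\<lambda>x. f x * f x) = 0) \<longleftrightarrow> (AE x in ivl. f x * f x = 0)"
      by (intro integral_nonneg_eq_0_iff_AE square_integrable_mult) auto
    also have "\<dots> \<longleftrightarrow> l2_rel f (\<lambda>_. 0)"
      using f by (simp add: l2_rel_def)
    finally show "(integral\<^sup>L ivl (\<lambda>x. f x * f x) = 0) \<longleftrightarrow> l2_rel f (\<lambda>_. 0)" .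
  qed
  show "norm u = sqrt (inner u u)"
    by (rule norm_l2_def)
qed

end


section \<open>The Sobolev space \<open>H\<^sub>0\<^sup>1(0, \<pi>)\<close>\<close>

definition C1c :: "(real \<Rightarrow> real) set" where
  "C1c = {\<psi>. \<psi> C1_differentiable_on UNIV \<and>
             (\<exists>a b. 0 < a \<and> b < pi \<and> (\<forall>x. x \<notin> {a..b} \<longrightarrow> \<psi> x = 0))}"

definition has_weak_deriv :: "l2 \<Rightarrow> l2 \<Rightarrow> bool" where
  "has_weak_deriv u g \<longleftrightarrow> (\<forall>\<psi>\<in>C1c. inner u (l2_of (deriv \<psi>)) = - inner g (l2_of \<psi>))"

lemma C1cD:
  assumes "\<psi> \<in> C1c"
  shows "(\<psi> has_real_derivative deriv \<psi> x) (at x)" "continuous_on UNIV (deriv \<psi>)" "continuous_on UNIV \<psi>"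
proof -
  obtain D where D: "\<And>x. (\<psi> has_vector_derivative D x) (at x)" "continuous_on UNIV D"
    using assms by (auto simp: C1c_def C1_differentiable_on_def)
  then have *: "(\<psi> has_real_derivative D x) (at x)" for x
    by (simp add: has_real_derivative_iff_has_vector_derivative)
  then have "deriv \<psi> = D" by (intro ext DERIV_imp_deriv)
  with * D show "(\<psi> has_real_derivative deriv \<psi> x) (at x)" "continuous_on UNIV (deriv \<psi>)" by auto
  show "continuous_on UNIV \<psi>"
    using * by (intro continuous_at_imp_continuous_on ballI DERIV_isCont) auto
qed

lemma C1cI:
  assumes "\<And>x. (\<psi> has_real_derivative D x) (at x)" "continuous_on UNIV D"
    "0 < a" "b < pi" "\<And>x. x \<notin> {a..b} \<Longrightarrow> \<psi> x = 0"
  shows "\<psi> \<in> C1c"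
  using assms by (force simp: C1c_def C1_differentiable_on_def has_real_derivative_iff_has_vector_derivative)

lemma square_integrable_continuous:
  assumes "continuous_on UNIV f"
  shows "square_integrable f"
proof -
  have c: "continuous_on {0..pi} (\<lambda>x. (f x)\<^sup>2)"
    using assms by (intro continuous_intros) (auto intro: continuous_on_subset)
  have "set_integrable lebesgue {0..pi} (\<lambda>x. (f x)\<^sup>2)"
    using absolutely_integrable_continuous[of 0 pi "\<lambda>x. (f x)\<^sup>2"] c by simp
  then have "set_integrable lebesgue {0<..<pi} (\<lambda>x. (f x)\<^sup>2)"
    by (rule set_integrable_subset) auto
  moreover have "f \<in> borel_measurable lborel"
    using assms by (auto intro: borel_measurable_continuous_onI)
  then have "f \<in> borel_measurable ivl"
    by (intro measurable_restrict_space1 measurable_completion)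
  ultimately show ?thesis
    by (auto simp: square_integrable_def set_integrable_def integrable_restrict_space)
qed

lemma l2_of_add:
  assumes "square_integrable f" "square_integrable g"
  shows "l2_of (\<lambda>x. f x + g x) = l2_of f + l2_of g"
  using assms by (simp add: plus_l2.abs_eq)

lemma l2_of_scale:
  assumes "square_integrable f"
  shows "l2_of (\<lambda>x. c * f x) = c *\<^sub>R l2_of f"
  using assms by (simp add: scaleR_l2.abs_eq)

lemma inner_l2_of:
  assumes "square_integrable f" "square_integrable g"
  shows "inner (l2_of f) (l2_of g) = integral\<^sup>L ivl (\<lambda>x. f x * g x)"
  using assms by (simp add: inner_l2.abs_eq)

text \<open>The bump \<open>max 0 ((x - a) * (b - x))\<close>, squared, is \<open>C\<^sup>1\<close> and positive exactly on \<open>(a, b)\<close>.\<close>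

definition bump :: "real \<Rightarrow> real \<Rightarrow> nat \<Rightarrow> real \<Rightarrow> real" where
  "bump a b n x = real n * (max 0 ((x - a) * (b - x)))\<^sup>2 / (1 + real n * (max 0 ((x - a) * (b - x)))\<^sup>2)"

lemma DERIV_max_sq: "((\<lambda>y::real. (max 0 y)\<^sup>2) has_real_derivative 2 * max 0 y) (at y)"
proof -
  consider "y > 0" | "y < 0" | "y = 0" by linarith
  then show ?thesis
  proof cases
    case 1
    have "((\<lambda>y::real. y\<^sup>2) has_real_derivative 2 * max 0 y) (at y)"
      using 1 by (auto intro!: derivative_eq_intros)
    then show ?thesis
      by (rule has_field_derivative_transform_within_open[where S = "{0<..}"]) (use 1 in auto)
  next
    case 2
    have "((\<lambda>y::real. 0) has_real_derivative 2 * max 0 y) (at y)"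
      using 2 by simp
    then show ?thesis
      by (rule has_field_derivative_transform_within_open[where S = "{..<0}"]) (use 2 in auto)
  next
    case 3
    have "((\<lambda>h::real. (max 0 h)\<^sup>2 / h) \<longlongrightarrow> 0) (at 0)"
    proof (rule Lim_null_comparison[of _ "\<lambda>h. \<bar>h\<bar>"])
      have "norm ((max 0 h)\<^sup>2 / h) \<le> \<bar>h\<bar>" for h :: real
        by (cases "h > 0") (auto simp: power2_eq_square max_def)
      then show "\<forall>\<^sub>F h::real in at 0. norm ((max 0 h)\<^sup>2 / h) \<le> \<bar>h\<bar>" by simp
      show "((\<lambda>h::real. \<bar>h\<bar>) \<longlongrightarrow> 0) (at 0)"
        by (rule tendsto_rabs_zero) simp
    qed
    then show ?thesis using 3 by (simp add: DERIV_def)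
  qed
qed

lemma bump_C1c:
  assumes "0 < a" "a < b" "b < pi"
  shows "bump a b n \<in> C1c"
proof -
  define p where "p x = (max 0 ((x - a) * (b - x)))\<^sup>2" for x
  define q where "q x = 2 * max 0 ((x - a) * (b - x)) * ((b - x) - (x - a))" for x
  have p: "(p has_real_derivative q x) (at x)" for x
  proof -
    have "((\<lambda>x. (x - a) * (b - x)) has_real_derivative ((b - x) - (x - a))) (at x)"
      by (auto intro!: derivative_eq_intros)
    from DERIV_chain2[OF DERIV_max_sq this] show ?thesis
      unfolding p_def q_def .
  qed
  have nz: "1 + real n * p x \<noteq> 0" for x
  proof -
    have "0 \<le> real n * p x" by (simp add: p_def)
    then show ?thesis by linarith
  qed
  have b: "bump a b n = (\<lambda>x. real n * p x / (1 + real n * p x))"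
    by (auto simp: bump_def p_def)
  have pc: "continuous_on UNIV p" "continuous_on UNIV q"
    unfolding p_def q_def by (intro continuous_intros)+
  show ?thesis
  proof (rule C1cI[where a = a and b = b])
    show "(bump a b n has_real_derivative
        (real n * q x * (1 + real n * p x) - real n * p x * (real n * q x)) /
          ((1 + real n * p x) * (1 + real n * p x))) (at x)" for x
      unfolding b using nz[of x] by (auto intro!: derivative_eq_intros p)
    show "continuous_on UNIV (\<lambda>x. (real n * q x * (1 + real n * p x) - real n * p x * (real n * q x)) /
          ((1 + real n * p x) * (1 + real n * p x)))"
      using nz by (intro continuous_intros pc) auto
    show "bump a b n x = 0" if "x \<notin> {a..b}" for x
    proof -
      have "(x - a) * (b - x) \<le> 0"
        using that assms by (cases "x < a") (auto simp: mult_le_0_iff)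
      then show ?thesis by (simp add: bump_def)
    qed
  qed (use assms in auto)
qed

lemma ivl_zero_if:
  assumes "square_integrable f" "\<And>\<psi>. \<psi> \<in> C1c \<Longrightarrow> integral\<^sup>L ivl (\<lambda>x. f x * \<psi> x) = 0"
  shows "AE x in ivl. f x = 0"
proof -
  have f1: "integrable ivl f"
    using square_integrable_mult[OF assms(1) square_integrable_continuous[of "\<lambda>_. 1"]] by simp
  have I0: "integral\<^sup>L ivl (\<lambda>x. f x * indicator {a<..<b} x) = 0" if "0 < a" "a < b" "b < pi" for a b
  proof -
    have "(\<lambda>n. integral\<^sup>L ivl (\<lambda>x. f x * bump a b n x)) \<longlonglongrightarrow> integral\<^sup>L ivl (\<lambda>x. f x * indicator {a<..<b} x)"
    proof (rule integral_dominated_convergence[where w = "\<lambda>x. norm (f x)"])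
      have [measurable]: "f \<in> borel_measurable ivl" using f1 by auto
      show "(\<lambda>x. f x * indicator {a<..<b} x) \<in> borel_measurable ivl"
        by (intro borel_measurable_times borel_measurable_indicator)
          (use that in \<open>auto simp: sets_restrict_space intro!: image_eqI[of _ _ "{a<..<b}"]\<close>)
      show "(\<lambda>x. f x * bump a b n x) \<in> borel_measurable ivl" for n
        using square_integrable_mult[OF assms(1) square_integrable_continuous[OF C1cD(3)[OF bump_C1c]]] that
        by (auto dest: borel_measurable_integrable)
      show "integrable ivl (\<lambda>x. norm (f x))" using f1 by simp
      show "AE x in ivl. norm (f x * bump a b n x) \<le> norm (f x)" for n
      proof (rule AE_I2)
        fix x
        have "\<bar>bump a b n x\<bar> \<le> 1"
        proof -
          have *: "0 \<le> real n * (max 0 ((x - a) * (b - x)))\<^sup>2" by simp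
          then have "0 < 1 + real n * (max 0 ((x - a) * (b - x)))\<^sup>2" by linarith
          with * show ?thesis unfolding bump_def by (simp add: abs_divide divide_le_eq)
        qed
        then show "norm (f x * bump a b n x) \<le> norm (f x)"
          by (simp add: abs_mult mult_left_le)
      qed
      show "AE x in ivl. (\<lambda>n. f x * bump a b n x) \<longlonglongrightarrow> f x * indicator {a<..<b} x"
      proof (rule AE_I2)
        fix x
        define c where "c = (max 0 ((x - a) * (b - x)))\<^sup>2"
        have "(\<lambda>n. bump a b n x) \<longlonglongrightarrow> indicator {a<..<b} x"
        proof (cases "x \<in> {a<..<b}")
          case True
          then have "c > 0" by (simp add: c_def)
          have "(\<lambda>n. real n * c / (1 + real n * c)) \<longlonglongrightarrow> 1"
            using \<open>c > 0\<close> by real_asymp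
          then show ?thesis using True by (simp add: bump_def c_def)
        next
          case False
          then have "(x - a) * (b - x) \<le> 0"
            using that by (cases "x \<le> a") (auto simp: mult_le_0_iff)
          then show ?thesis using False by (simp add: bump_def)
        qed
        then show "(\<lambda>n. f x * bump a b n x) \<longlonglongrightarrow> f x * indicator {a<..<b} x"
          by (intro tendsto_mult tendsto_const)
      qed
    qed
    moreover have "integral\<^sup>L ivl (\<lambda>x. f x * bump a b n x) = 0" for n
      using that by (intro assms(2) bump_C1c)
    ultimately show ?thesis
      by (simp add: LIMSEQ_const_iff)
  qed
  define F where "F x = indicator {0<..<pi} x * f x" for x
  have F1: "integrable lebesgue F"
    using f1 unfolding F_def[abs_def] by (simp add: integrable_restrict_space)
  have FI: "integral {a..b} F = 0" if "0 < a" "a < b" "b < pi" for a b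
  proof -
    have "integral\<^sup>L lebesgue (\<lambda>x. indicator {a<..<b} x *\<^sub>R F x) =
      integral\<^sup>L ivl (\<lambda>x. f x * indicator {a<..<b} x)"
      by (subst integral_restrict_space) (auto simp: F_def mult_ac)
    also have "\<dots> = 0" using that by (rule I0)
    finally have 0: "integral\<^sup>L lebesgue (\<lambda>x. indicator {a<..<b} x *\<^sub>R F x) = 0" .
    have "set_integrable lebesgue {a<..<b} F"
      unfolding set_integrable_def by (rule integrable_mult_indicator[OF _ F1]) simp
    from set_lebesgue_integral_eq_integral(2)[OF this] 0 have "integral {a<..<b} F = 0"
      by (simp add: set_lebesgue_integral_def)
    then show ?thesis
      using integral_open_interval_real[of a b F] by simp
  qed
  have "F integrable_on cbox a b" for a b
  proof -
    have "set_integrable lebesgue (cbox a b) F"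
      unfolding set_integrable_def by (rule integrable_mult_indicator[OF _ F1]) simp
    then show ?thesis by (rule set_lebesgue_integral_eq_integral(1))
  qed
  then obtain N where N: "negligible N"
    "\<And>x e. \<lbrakk>x \<notin> N; 0 < e\<rbrakk> \<Longrightarrow>
       \<exists>d>0. \<forall>h. 0 < h \<and> h < d \<longrightarrow> norm (integral (cbox x (x + h *\<^sub>R One)) F /\<^sub>R h ^ DIM(real) - F x) < e"
    using integrable_ccontinuous_explicit[of F] by blast
  have "f x = 0" if x: "x \<notin> N" "x \<in> {0<..<pi}" for x
  proof (rule ccontr)
    assume "f x \<noteq> 0"
    then have "0 < norm (F x)" using x by (simp add: F_def)
    from N(2)[OF x(1) this] obtain d where d: "d > 0"
      "\<And>h. 0 < h \<Longrightarrow> h < d \<Longrightarrow> norm (integral (cbox x (x + h *\<^sub>R One)) F /\<^sub>R h ^ DIM(real) - F x) < norm (F x)"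
      by blast
    define h where "h = min (d/2) ((pi - x)/2)"
    have h: "0 < h" "h < d" "x + h < pi"
      using d(1) x by (auto simp: h_def min_def field_simps)
    have "integral (cbox x (x + h *\<^sub>R One)) F = 0"
      using FI[of x "x + h"] h x by simp
    with d(2)[OF h(1,2)] show False by simp
  qed
  then have "AE x in lebesgue. x \<in> {0<..<pi} \<longrightarrow> f x = 0"
    using N(1) by (auto intro!: AE_I'[of N] simp: negligible_iff_null_sets)
  then show ?thesis by (simp add: AE_restrict_space_iff)
qed

lemma weak_deriv_unique:
  assumes "has_weak_deriv u g" "has_weak_deriv u h"
  shows "g = h"
proof -
  have *: "inner (g - h) (l2_of \<psi>) = 0" if "\<psi> \<in> C1c" for \<psi>
    using assms that by (auto simp: has_weak_deriv_def inner_diff_left)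
  have "w = 0" if "\<And>\<psi>. \<psi> \<in> C1c \<Longrightarrow> inner w (l2_of \<psi>) = 0" for w
  proof -
    have "\<exists>f. square_integrable f \<and> w = l2_of f"
      by (induct w rule: l2.abs_induct) auto
    then obtain f where f: "square_integrable f" "w = l2_of f" by blast
    have "AE x in ivl. f x = 0"
      using that f by (intro ivl_zero_if)
        (auto simp: inner_l2_of square_integrable_continuous C1cD)
    then show "w = 0"
      using f by (simp add: zero_l2_def Quotient3_rel_abs[OF Quotient3_l2] l2_rel_def)
  qed
  from this[OF *] show ?thesis by simp
qed

lemma has_weak_deriv_zero: "has_weak_deriv 0 0"
  by (simp add: has_weak_deriv_def)

lemma has_weak_deriv_add:
  "has_weak_deriv u g \<Longrightarrow> has_weak_deriv v h \<Longrightarrow> has_weak_deriv (u + v) (g + h)"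
  by (simp add: has_weak_deriv_def inner_add_left)

lemma has_weak_deriv_scaleR:
  "has_weak_deriv u g \<Longrightarrow> has_weak_deriv (c *\<^sub>R u) (c *\<^sub>R g)"
  by (simp add: has_weak_deriv_def)

text \<open>\<open>H\<^sub>0\<^sup>1\<close> is the closure of \<open>C\<^sub>c\<^sup>1\<close> in the norm of \<open>H\<^sup>1\<close>.\<close>

definition H01 :: "l2 set" where
  "H01 = {u. \<exists>g. has_weak_deriv u g \<and>
            (\<forall>e>0. \<exists>\<psi>\<in>C1c. norm (u - l2_of \<psi>) < e \<and> norm (g - l2_of (deriv \<psi>)) < e)}"

definition weak_deriv :: "l2 \<Rightarrow> l2" where
  "weak_deriv u = (THE g. has_weak_deriv u g)"

lemma weak_deriv_eq: "has_weak_deriv u g \<Longrightarrow> weak_deriv u = g"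
  unfolding weak_deriv_def by (rule the_equality) (auto intro: weak_deriv_unique)

lemma C1c_zero: "(\<lambda>_. 0) \<in> C1c"
  by (rule C1cI[of _ "\<lambda>_. 0" 1 2]) (use pi_gt3 in auto)

lemma C1c_add:
  assumes "\<psi> \<in> C1c" "\<rho> \<in> C1c"
  shows "(\<lambda>x. \<psi> x + \<rho> x) \<in> C1c"
proof -
  obtain a b where ab: "0 < a" "b < pi" "\<And>x. x \<notin> {a..b} \<Longrightarrow> \<psi> x = 0"
    using assms(1) by (auto simp: C1c_def)
  obtain c d where cd: "0 < c" "d < pi" "\<And>x. x \<notin> {c..d} \<Longrightarrow> \<rho> x = 0"
    using assms(2) by (auto simp: C1c_def)
  show ?thesis
  proof (rule C1cI[of _ "\<lambda>x. deriv \<psi> x + deriv \<rho> x" "min a c" "max b d"])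
    show "((\<lambda>x. \<psi> x + \<rho> x) has_real_derivative deriv \<psi> x + deriv \<rho> x) (at x)" for x
      using assms by (intro DERIV_add C1cD)
    show "continuous_on UNIV (\<lambda>x. deriv \<psi> x + deriv \<rho> x)"
      using assms by (intro continuous_intros C1cD)
    show "\<psi> x + \<rho> x = 0" if "x \<notin> {min a c..max b d}" for x
      proof -
      have "x \<notin> {a..b}" "x \<notin> {c..d}" using that by auto
      then show ?thesis using ab(3) cd(3) by simp
    qed
  qed (use ab cd in auto)
qed

lemma C1c_scale:
  assumes "\<psi> \<in> C1c"
  shows "(\<lambda>x. c * \<psi> x) \<in> C1c"
proof -
  obtain a b where ab: "0 < a" "b < pi" "\<And>x. x \<notin> {a..b} \<Longrightarrow> \<psi> x = 0"
    using assms by (auto simp: C1c_def)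
  show ?thesis
  proof (rule C1cI[of _ "\<lambda>x. c * deriv \<psi> x" a b])
    show "((\<lambda>x. c * \<psi> x) has_real_derivative c * deriv \<psi> x) (at x)" for x
      using assms by (intro DERIV_cmult C1cD)
    show "continuous_on UNIV (\<lambda>x. c * deriv \<psi> x)"
      using assms by (intro continuous_intros C1cD)
  qed (use ab in auto)
qed

lemma H01_zero: "0 \<in> H01"
proof -
  have 0: "l2_of (\<lambda>_. 0) = 0" by (simp add: zero_l2_def)
  have "deriv (\<lambda>_::real. 0::real) = (\<lambda>_. 0)" by (intro ext) simp
  then show ?thesis
    unfolding H01_def
    by (auto intro!: exI[of _ "0::l2"] has_weak_deriv_zero bexI[OF _ C1c_zero] simp: 0)
qed

lemma H01_add:
  assumes "u \<in> H01" "v \<in> H01"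
  shows "u + v \<in> H01"
proof -
  obtain g where g: "has_weak_deriv u g"
    "\<And>e. e > 0 \<Longrightarrow> \<exists>\<psi>\<in>C1c. norm (u - l2_of \<psi>) < e \<and> norm (g - l2_of (deriv \<psi>)) < e"
    using assms(1) by (auto simp: H01_def)
  obtain h where h: "has_weak_deriv v h"
    "\<And>e. e > 0 \<Longrightarrow> \<exists>\<psi>\<in>C1c. norm (v - l2_of \<psi>) < e \<and> norm (h - l2_of (deriv \<psi>)) < e"
    using assms(2) by (auto simp: H01_def)
  have "\<exists>\<psi>\<in>C1c. norm (u + v - l2_of \<psi>) < e \<and> norm (g + h - l2_of (deriv \<psi>)) < e"
    if "e > 0" for e
  proof -
    obtain \<psi> where \<psi>: "\<psi> \<in> C1c" "norm (u - l2_of \<psi>) < e/2" "norm (g - l2_of (deriv \<psi>)) < e/2"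
      using g(2)[OF half_gt_zero[OF \<open>e > 0\<close>]] by blast
    obtain \<rho> where \<rho>: "\<rho> \<in> C1c" "norm (v - l2_of \<rho>) < e/2" "norm (h - l2_of (deriv \<rho>)) < e/2"
      using h(2)[OF half_gt_zero[OF \<open>e > 0\<close>]] by blast
    have 1: "l2_of (\<lambda>x. \<psi> x + \<rho> x) = l2_of \<psi> + l2_of \<rho>"
      using \<psi>(1) \<rho>(1) by (intro l2_of_add square_integrable_continuous C1cD)
    have "deriv (\<lambda>x. \<psi> x + \<rho> x) = (\<lambda>x. deriv \<psi> x + deriv \<rho> x)"
      using \<psi>(1) \<rho>(1) by (intro ext DERIV_imp_deriv DERIV_add C1cD)
    then have 2: "l2_of (deriv (\<lambda>x. \<psi> x + \<rho> x)) = l2_of (deriv \<psi>) + l2_of (deriv \<rho>)"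
      using \<psi>(1) \<rho>(1) by (simp add: l2_of_add square_integrable_continuous C1cD)
    show ?thesis
      using \<psi> \<rho> norm_diff_triangle_ineq[of u v "l2_of \<psi>" "l2_of \<rho>"]
        norm_diff_triangle_ineq[of g h "l2_of (deriv \<psi>)" "l2_of (deriv \<rho>)"]
      by (intro bexI[OF _ C1c_add[OF \<psi>(1) \<rho>(1)]]) (simp add: 1 2)
  qed
  then show ?thesis
    using has_weak_deriv_add[OF g(1) h(1)] by (auto simp: H01_def)
qed

lemma H01_scaleR:
  assumes "u \<in> H01"
  shows "c *\<^sub>R u \<in> H01"
proof (cases "c = 0")
  case True
  then show ?thesis by (simp add: H01_zero)
next
  case False
  obtain g where g: "has_weak_deriv u g"
    "\<And>e. e > 0 \<Longrightarrow> \<exists>\<psi>\<in>C1c. norm (u - l2_of \<psi>) < e \<and> norm (g - l2_of (deriv \<psi>)) < e"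
    using assms by (auto simp: H01_def)
  have "\<exists>\<psi>\<in>C1c. norm (c *\<^sub>R u - l2_of \<psi>) < e \<and> norm (c *\<^sub>R g - l2_of (deriv \<psi>)) < e"
    if "e > 0" for e
  proof -
    have c: "0 < e / \<bar>c\<bar>" using that False by simp
    obtain \<psi> where \<psi>: "\<psi> \<in> C1c" "norm (u - l2_of \<psi>) < e / \<bar>c\<bar>" "norm (g - l2_of (deriv \<psi>)) < e / \<bar>c\<bar>"
      using g(2)[OF c] by blast
    have 1: "l2_of (\<lambda>x. c * \<psi> x) = c *\<^sub>R l2_of \<psi>"
      using \<psi>(1) by (intro l2_of_scale square_integrable_continuous C1cD)
    have "deriv (\<lambda>x. c * \<psi> x) = (\<lambda>x. c * deriv \<psi> x)"
      using \<psi>(1) by (intro ext DERIV_imp_deriv DERIV_cmult C1cD)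
    then have 2: "l2_of (deriv (\<lambda>x. c * \<psi> x)) = c *\<^sub>R l2_of (deriv \<psi>)"
      using \<psi>(1) by (simp add: l2_of_scale square_integrable_continuous C1cD)
    have "\<bar>c\<bar> * norm (u - l2_of \<psi>) < e" "\<bar>c\<bar> * norm (g - l2_of (deriv \<psi>)) < e"
      using \<psi>(2,3) False by (simp_all add: pos_less_divide_eq mult.commute)
    then show ?thesis
      by (intro bexI[OF _ C1c_scale[OF \<psi>(1), of c]])
        (simp add: 1 2 flip: scaleR_right_diff_distrib)
  qed
  then show ?thesis
    using has_weak_deriv_scaleR[OF g(1)] by (auto simp: H01_def)
qed

lemma H01_uminus: "u \<in> H01 \<Longrightarrow> - u \<in> H01"
  using H01_scaleR[of u "-1"] by simp

lemma H01_diff: "u \<in> H01 \<Longrightarrow> v \<in> H01 \<Longrightarrow> u - v \<in> H01"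
  using H01_add[OF _ H01_uminus] by simp

lemma H01_has_weak_deriv: "u \<in> H01 \<Longrightarrow> has_weak_deriv u (weak_deriv u)"
  by (auto simp: H01_def weak_deriv_eq)

lemma weak_deriv_add: "u \<in> H01 \<Longrightarrow> v \<in> H01 \<Longrightarrow> weak_deriv (u + v) = weak_deriv u + weak_deriv v"
  by (intro weak_deriv_eq has_weak_deriv_add H01_has_weak_deriv)

lemma weak_deriv_scaleR: "u \<in> H01 \<Longrightarrow> weak_deriv (c *\<^sub>R u) = c *\<^sub>R weak_deriv u"
  by (intro weak_deriv_eq has_weak_deriv_scaleR H01_has_weak_deriv)

typedef h01 = H01
  morphisms emb Abs_h01
  using H01_zero by blast

setup_lifting type_definition_h01

instantiation h01 :: real_inner
begin

lift_definition zero_h01 :: h01 is 0 by (rule H01_zero)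
lift_definition plus_h01 :: "h01 \<Rightarrow> h01 \<Rightarrow> h01" is "(+)" by (rule H01_add)
lift_definition scaleR_h01 :: "real \<Rightarrow> h01 \<Rightarrow> h01" is "scaleR" by (rule H01_scaleR)
lift_definition uminus_h01 :: "h01 \<Rightarrow> h01" is uminus by (rule H01_uminus)
lift_definition minus_h01 :: "h01 \<Rightarrow> h01 \<Rightarrow> h01" is "(-)" by (rule H01_diff)

lift_definition inner_h01 :: "h01 \<Rightarrow> h01 \<Rightarrow> real" is
  "\<lambda>u v. inner u v + inner (weak_deriv u) (weak_deriv v)" .

definition norm_h01 :: "h01 \<Rightarrow> real" where
  "norm_h01 u = sqrt (inner u u)"

definition sgn_h01 :: "h01 \<Rightarrow> h01" where
  "sgn_h01 u = inverse (norm u) *\<^sub>R u"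

definition dist_h01 :: "h01 \<Rightarrow> h01 \<Rightarrow> real" where
  "dist_h01 u v = norm (u - v)"

definition uniformity_h01 :: "(h01 \<times> h01) filter" where
  "uniformity_h01 = (INF e\<in>{0<..}. principal {(u, v). dist u v < e})"

definition open_h01 :: "h01 set \<Rightarrow> bool" where
  "open_h01 U \<longleftrightarrow> (\<forall>u\<in>U. eventually (\<lambda>(u', v). u' = u \<longrightarrow> v \<in> U) uniformity)"

instance
proof
  fix u v w :: h01 and a b :: real
  show "u + v + w = u + (v + w)" by transfer (rule add.assoc)
  show "u + v = v + u" by transfer (rule add.commute)
  show "0 + u = u" by transfer simp
  show "- u + u = 0" by transfer simp
  show "u - v = u + - v" by transfer simp
  show "a *\<^sub>R (u + v) = a *\<^sub>R u + a *\<^sub>R v" by transfer (rule scaleR_right_distrib)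
  show "(a + b) *\<^sub>R u = a *\<^sub>R u + b *\<^sub>R u" by transfer (rule scaleR_left_distrib)
  show "a *\<^sub>R b *\<^sub>R u = (a * b) *\<^sub>R u" by transfer simp
  show "1 *\<^sub>R u = u" by transfer simp
  show "dist u v = norm (u - v)"
    by (rule dist_h01_def)
  show "sgn u = inverse (norm u) *\<^sub>R u"
    by (rule sgn_h01_def)
  show "(uniformity :: (h01 \<times> h01) filter) = (INF e\<in>{0<..}. principal {(u, v). dist u v < e})"
    by (rule uniformity_h01_def)
  show "open U \<longleftrightarrow> (\<forall>u\<in>U. eventually (\<lambda>(u', v). u' = u \<longrightarrow> v \<in> U) uniformity)" for U :: "h01 set"
    by (rule open_h01_def)
  show "inner u v = inner v u"
    by transfer (simp add: inner_commute)
  show "inner (u + v) w = inner u w + inner v w"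
    by transfer (simp add: weak_deriv_add inner_add_left)
  show "inner (a *\<^sub>R u) v = a * inner u v"
    by transfer (simp add: weak_deriv_scaleR distrib_left)
  show "0 \<le> inner u u"
    by transfer simp
  show "inner u u = 0 \<longleftrightarrow> u = 0"
    by transfer (auto simp: add_nonneg_eq_0_iff weak_deriv_eq[OF has_weak_deriv_zero])
  show "norm u = sqrt (inner u u)"
    by (rule norm_h01_def)
qed

end


section \<open>First-order form of the wave equation\<close>

text \<open>\<open>E = H\<^sub>0\<^sup>1 \<times> L\<^sup>2\<close> with its usual norm, which provides topology, continuity and integrals.\<close>

type_synonym E = "h01 \<times> l2"

definition sinL :: "nat \<Rightarrow> l2" where
  "sinL k = l2_of (\<lambda>x. sin (real k * x))"

definition sinH :: "nat \<Rightarrow> h01" where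
  "sinH k = Abs_h01 (sinL k)"

text \<open>The operator \<open>-\<Delta>\<close> with Dirichlet conditions, domain \<open>H\<^sup>2 \<inter> H\<^sub>0\<^sup>1\<close>, as a graph.\<close>

definition neg_laplacian :: "(h01 \<times> l2) set" where
  "neg_laplacian = {(u, w). has_weak_deriv (weak_deriv (emb u)) (- w)}"

text \<open>Its square root, with domain \<open>H\<^sub>0\<^sup>1\<close>, by the spectral theorem: \<open>k\<^sup>2\<close> are the eigenvalues of the
  Laplacian, and \<open>2/\<pi> \<langle>u, sin k\<cdot>\<rangle>\<close> are the sine coefficients of \<open>u\<close>.\<close>

definition sqrt_laplacian :: "h01 \<Rightarrow> l2" where
  "sqrt_laplacian u =
     (\<Sum>n. (real (Suc n) * (2 / pi * inner (emb u) (sinL (Suc n)))) *\<^sub>R sinL (Suc n))"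

text \<open>Graph of \<open>A(u, v) = (v, -\<epsilon>\<^sup>-\<^sup>2 (-\<Delta>) u - \<epsilon>\<^sup>-\<^sup>2 v)\<close>; its domain consists of the \<open>(u, v)\<close> with
  \<open>u \<in> H\<^sup>2 \<inter> H\<^sub>0\<^sup>1\<close> and \<open>v \<in> H\<^sub>0\<^sup>1\<close>.\<close>

definition wave_op :: "real \<Rightarrow> (E \<times> E) set" where
  "wave_op \<epsilon> = {((u, emb v), (v, - (1 / \<epsilon>\<^sup>2) *\<^sub>R w - (1 / \<epsilon>\<^sup>2) *\<^sub>R emb v)) | u v w.
                  (u, w) \<in> neg_laplacian}"

definition C0_semigroup :: "(real \<Rightarrow> 'a::real_normed_vector \<Rightarrow> 'a) \<Rightarrow> bool" where
  "C0_semigroup S \<longleftrightarrow>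
     (\<forall>t\<ge>0. bounded_linear (S t)) \<and> S 0 = id \<and>
     (\<forall>s\<ge>0. \<forall>t\<ge>0. S (s + t) = S s \<circ> S t) \<and>
     (\<forall>x. ((\<lambda>t. S t x) \<longlongrightarrow> x) (at_right 0))"

definition generator :: "(real \<Rightarrow> 'a::real_normed_vector \<Rightarrow> 'a) \<Rightarrow> ('a \<times> 'a) set" where
  "generator S = {(x, y). ((\<lambda>t. (1 / t) *\<^sub>R (S t x - x)) \<longlongrightarrow> y) (at_right 0)}"


section \<open>Splitting and equivalent norm\<close>

text \<open>Only used for \<open>k \<le> N + 1 < 1/(2\<epsilon>)\<close>, where the radicand is positive.\<close>

definition lam_plus :: "real \<Rightarrow> nat \<Rightarrow> real" where
  "lam_plus \<epsilon> k = (- 1 + sqrt (1 - 4 * \<epsilon>\<^sup>2 * (real k)\<^sup>2)) / (2 * \<epsilon>\<^sup>2)"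

definition lam_minus :: "real \<Rightarrow> nat \<Rightarrow> real" where
  "lam_minus \<epsilon> k = (- 1 - sqrt (1 - 4 * \<epsilon>\<^sup>2 * (real k)\<^sup>2)) / (2 * \<epsilon>\<^sup>2)"

definition e_plus :: "real \<Rightarrow> nat \<Rightarrow> E" where
  "e_plus \<epsilon> k = (sinH k, lam_plus \<epsilon> k *\<^sub>R sinL k)"

definition e_minus :: "real \<Rightarrow> nat \<Rightarrow> E" where
  "e_minus \<epsilon> k = (sinH k, lam_minus \<epsilon> k *\<^sub>R sinL k)"

definition E1 :: "real \<Rightarrow> nat \<Rightarrow> E set" where
  "E1 \<epsilon> N = span (e_plus \<epsilon> ` {1..N})"

definition Em1 :: "real \<Rightarrow> nat \<Rightarrow> E set" where
  "Em1 \<epsilon> N = span (e_minus \<epsilon> ` {1..N})"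

definition E11 :: "real \<Rightarrow> nat \<Rightarrow> E set" where
  "E11 \<epsilon> N = {x + y | x y. x \<in> E1 \<epsilon> N \<and> y \<in> Em1 \<epsilon> N}"

text \<open>The description by vanishing coefficients is used because \<open>\<lambda>\<^sub>k\<close> becomes non-real for large \<open>k\<close>.\<close>

definition E22 :: "nat \<Rightarrow> E set" where
  "E22 N = {(u, v). \<forall>k\<in>{1..N}. inner (emb u) (sinL k) = 0 \<and> inner v (sinL k) = 0}"

definition E2 :: "real \<Rightarrow> nat \<Rightarrow> E set" where
  "E2 \<epsilon> N = {x + y | x y. x \<in> Em1 \<epsilon> N \<and> y \<in> E22 N}"

text \<open>The component in \<open>X\<close> for a direct sum \<open>X \<oplus> Y\<close>.\<close>

definition component :: "E set \<Rightarrow> E set \<Rightarrow> E \<Rightarrow> E" where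
  "component X Y U = (THE x. x \<in> X \<and> U - x \<in> Y)"

definition proj_P :: "real \<Rightarrow> nat \<Rightarrow> E \<Rightarrow> E" where
  "proj_P \<epsilon> N = component (E1 \<epsilon> N) (E2 \<epsilon> N)"

definition proj_Q :: "real \<Rightarrow> nat \<Rightarrow> E \<Rightarrow> E" where
  "proj_Q \<epsilon> N U = U - proj_P \<epsilon> N U"

definition inner_E11 :: "real \<Rightarrow> E \<Rightarrow> E \<Rightarrow> real" where
  "inner_E11 \<epsilon> = (\<lambda>(u1, v1) (u2, v2).
     1 / (4 * \<epsilon>\<^sup>2) * inner (emb u1) (emb u2)
     - inner (sqrt_laplacian u1) (sqrt_laplacian u2)
     + inner ((1 / (2 * \<epsilon>)) *\<^sub>R emb u1 + \<epsilon> *\<^sub>R v1) ((1 / (2 * \<epsilon>)) *\<^sub>R emb u2 + \<epsilon> *\<^sub>R v2))"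

definition inner_E22 :: "real \<Rightarrow> nat \<Rightarrow> E \<Rightarrow> E \<Rightarrow> real" where
  "inner_E22 \<epsilon> N = (\<lambda>(u1, v1) (u2, v2).
     inner (sqrt_laplacian u1) (sqrt_laplacian u2)
     + (1 / (4 * \<epsilon>\<^sup>2) - 2 * (real N + 1)\<^sup>2) * inner (emb u1) (emb u2)
     + inner ((1 / (2 * \<epsilon>)) *\<^sub>R emb u1 + \<epsilon> *\<^sub>R v1) ((1 / (2 * \<epsilon>)) *\<^sub>R emb u2 + \<epsilon> *\<^sub>R v2))"

definition inner_E :: "real \<Rightarrow> nat \<Rightarrow> E \<Rightarrow> E \<Rightarrow> real" where
  "inner_E \<epsilon> N U V =
     (let U11 = component (E11 \<epsilon> N) (E22 N) U; V11 = component (E11 \<epsilon> N) (E22 N) V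
      in inner_E11 \<epsilon> U11 V11 + inner_E22 \<epsilon> N (U - U11) (V - V11))"

definition norm_E :: "real \<Rightarrow> nat \<Rightarrow> E \<Rightarrow> real" where
  "norm_E \<epsilon> N U = sqrt (inner_E \<epsilon> N U U)"


section \<open>Noise\<close>

definition path_space :: "(real \<Rightarrow> real) set" where
  "path_space = {\<omega>. continuous_on UNIV \<omega> \<and> \<omega> 0 = 0}"

text \<open>Two-sided Wiener measure on \<open>C\<^sub>0(\<real>, \<real>)\<close>; the \<sigma>-algebra generated by the evaluations is the
  Borel \<sigma>-algebra of locally uniform convergence.\<close>

definition wiener_measure :: "(real \<Rightarrow> real) measure \<Rightarrow> bool" where
  "wiener_measure W \<longleftrightarrow>
     prob_space W \<and> space W = path_space \<and>
     sets W = sets (restrict_space (Pi\<^sub>M UNIV (\<lambda>_. borel)) path_space) \<and>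
     (\<forall>s t. s < t \<longrightarrow>
        distributed W lborel (\<lambda>\<omega>. \<omega> t - \<omega> s) (\<lambda>x. ennreal (normal_density 0 (sqrt (t - s)) x))) \<and>
     (\<forall>(n::nat) (t :: nat \<Rightarrow> real). strict_mono t \<longrightarrow>
        prob_space.indep_vars W (\<lambda>_. borel) (\<lambda>i \<omega>. \<omega> (t (Suc i)) - \<omega> (t i)) {..<n})"

definition shift_path :: "real \<Rightarrow> (real \<Rightarrow> real) \<Rightarrow> real \<Rightarrow> real" where
  "shift_path t \<omega> = (\<lambda>s. \<omega> (t + s) - \<omega> t)"

definition z_ou :: "real \<Rightarrow> (real \<Rightarrow> real) \<Rightarrow> real" where
  "z_ou \<epsilon> \<omega> = - (1 / \<epsilon> ^ 4) * (LBINT \<tau>:{..0}. exp (\<tau> / \<epsilon>\<^sup>2) * \<omega> \<tau>)"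

text \<open>The largest shift-invariant set of paths along which all \<open>z(\<theta>\<^sub>t \<omega>)\<close> are defined and have the
  required continuity and sublinear growth; it has full Wiener measure.\<close>

definition Omega_z :: "real \<Rightarrow> (real \<Rightarrow> real) set" where
  "Omega_z \<epsilon> = {\<omega>\<in>path_space.
     (\<forall>t. set_integrable lborel {..0} (\<lambda>\<tau>. exp (\<tau> / \<epsilon>\<^sup>2) * shift_path t \<omega> \<tau>)) \<and>
     continuous_on UNIV (\<lambda>t. z_ou \<epsilon> (shift_path t \<omega>)) \<and>
     ((\<lambda>t. z_ou \<epsilon> (shift_path t \<omega>) / t) \<longlongrightarrow> 0) at_top \<and>
     ((\<lambda>t. z_ou \<epsilon> (shift_path t \<omega>) / t) \<longlongrightarrow> 0) at_bot}"


section \<open>Lyapunov-Perron construction of the manifolds\<close>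

definition F_wave :: "real \<Rightarrow> (l2 \<Rightarrow> l2) \<Rightarrow> h01 \<Rightarrow> real \<Rightarrow> (real \<Rightarrow> real) \<Rightarrow> E \<Rightarrow> E" where
  "F_wave \<epsilon> f \<phi> \<delta> \<omega> = (\<lambda>(u, v). ((\<delta> * z_ou \<epsilon> \<omega>) *\<^sub>R \<phi>, (1 / \<epsilon>\<^sup>2) *\<^sub>R f (emb u)))"

definition eta :: "real \<Rightarrow> nat \<Rightarrow> real" where
  "eta \<epsilon> N = (lam_plus \<epsilon> N + lam_plus \<epsilon> (N + 1)) / 2"

text \<open>\<open>S t\<close> stands for \<open>e\<^bsup>At\<^esup>\<close>, \<open>t \<ge> 0\<close>. On the invariant finite-dimensional space \<open>E\<^sub>1\<close> it is a
  group, and this is \<open>e\<^bsup>At\<^esup>\<close> on \<open>E\<^sub>1\<close> for \<open>t \<le> 0\<close>.\<close>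

definition backward :: "real \<Rightarrow> nat \<Rightarrow> (real \<Rightarrow> E \<Rightarrow> E) \<Rightarrow> real \<Rightarrow> E \<Rightarrow> E" where
  "backward \<epsilon> N S t = inv_into (E1 \<epsilon> N) (S (- t))"

text \<open>\<open>I\<close> is the integral from \<open>t\<close> to \<open>0\<close>, whence the minus sign.\<close>

definition lp_solution ::
  "real \<Rightarrow> nat \<Rightarrow> (l2 \<Rightarrow> l2) \<Rightarrow> h01 \<Rightarrow> (real \<Rightarrow> E \<Rightarrow> E) \<Rightarrow> real \<Rightarrow> E \<Rightarrow> (real \<Rightarrow> real) \<Rightarrow> (real \<Rightarrow> E) \<Rightarrow> bool"
where
  "lp_solution \<epsilon> N f \<phi> S \<delta> \<xi> \<omega> U \<longleftrightarrow>
     continuous_on {..0} U \<and>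
     bdd_above ((\<lambda>t. exp (- eta \<epsilon> N * t) * norm_E \<epsilon> N (U t)) ` {..0}) \<and>
     (\<forall>t\<le>0. \<exists>I J.
        ((\<lambda>s. backward \<epsilon> N S (t - s) (proj_P \<epsilon> N (F_wave \<epsilon> f \<phi> \<delta> (shift_path s \<omega>) (U s)))) has_integral I) {t..0} \<and>
        ((\<lambda>s. S (t - s) (proj_Q \<epsilon> N (F_wave \<epsilon> f \<phi> \<delta> (shift_path s \<omega>) (U s)))) has_integral J) {..t} \<and>
        U t = backward \<epsilon> N S t \<xi> - I + J)"

text \<open>The condition on \<open>t > 0\<close> only makes the choice unique as a total function.\<close>

definition lp_orbit ::
  "real \<Rightarrow> nat \<Rightarrow> (l2 \<Rightarrow> l2) \<Rightarrow> h01 \<Rightarrow> (real \<Rightarrow> E \<Rightarrow> E) \<Rightarrow> real \<Rightarrow> E \<Rightarrow> (real \<Rightarrow> real) \<Rightarrow> real \<Rightarrow> E"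
where
  "lp_orbit \<epsilon> N f \<phi> S \<delta> \<xi> \<omega> =
     (THE U. lp_solution \<epsilon> N f \<phi> S \<delta> \<xi> \<omega> U \<and> (\<forall>t>0. U t = 0))"

definition h_lp ::
  "real \<Rightarrow> nat \<Rightarrow> (l2 \<Rightarrow> l2) \<Rightarrow> h01 \<Rightarrow> (real \<Rightarrow> E \<Rightarrow> E) \<Rightarrow> real \<Rightarrow> E \<Rightarrow> (real \<Rightarrow> real) \<Rightarrow> E"
where
  "h_lp \<epsilon> N f \<phi> S \<delta> \<xi> \<omega> =
     integral {..0} (\<lambda>s. S (- s) (proj_Q \<epsilon> N (F_wave \<epsilon> f \<phi> \<delta> (shift_path s \<omega>) (lp_orbit \<epsilon> N f \<phi> S \<delta> \<xi> \<omega> s))))"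

text \<open>Best Lipschitz constants for \<open>\<parallel>\<cdot>\<parallel>\<^sub>E\<close>, equal to \<open>\<infinity>\<close> if there is none.\<close>

definition Lip_F :: "real \<Rightarrow> nat \<Rightarrow> (l2 \<Rightarrow> l2) \<Rightarrow> h01 \<Rightarrow> ennreal" where
  "Lip_F \<epsilon> N f \<phi> = Inf {ennreal L | L. 0 \<le> L \<and>
     (\<forall>\<delta>\<ge>0. \<forall>\<omega>\<in>Omega_z \<epsilon>. \<forall>U V.
        norm_E \<epsilon> N (F_wave \<epsilon> f \<phi> \<delta> \<omega> U - F_wave \<epsilon> f \<phi> \<delta> \<omega> V) \<le> L * norm_E \<epsilon> N (U - V))}"

definition Lip_h :: "real \<Rightarrow> nat \<Rightarrow> (l2 \<Rightarrow> l2) \<Rightarrow> h01 \<Rightarrow> (real \<Rightarrow> E \<Rightarrow> E) \<Rightarrow> real \<Rightarrow> ennreal" where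
  "Lip_h \<epsilon> N f \<phi> S \<delta> = Inf {ennreal L | L. 0 \<le> L \<and>
     (\<forall>\<omega>\<in>Omega_z \<epsilon>. \<forall>\<xi>1\<in>E1 \<epsilon> N. \<forall>\<xi>2\<in>E1 \<epsilon> N.
        norm_E \<epsilon> N (h_lp \<epsilon> N f \<phi> S \<delta> \<xi>1 \<omega> - h_lp \<epsilon> N f \<phi> S \<delta> \<xi>2 \<omega>) \<le> L * norm_E \<epsilon> N (\<xi>1 - \<xi>2))}"

definition spectral_gap :: "real \<Rightarrow> nat \<Rightarrow> (l2 \<Rightarrow> l2) \<Rightarrow> h01 \<Rightarrow> (real \<Rightarrow> E \<Rightarrow> E) \<Rightarrow> real \<Rightarrow> bool" where
  "spectral_gap \<epsilon> N f \<phi> S \<delta> \<longleftrightarrow>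
     (let \<alpha> = lam_plus \<epsilon> N; \<beta> = lam_plus \<epsilon> (N + 1); \<eta> = eta \<epsilon> N in
      Lip_F \<epsilon> N f \<phi> * ennreal (1 / (\<alpha> - \<eta>) + 1 / (\<eta> - \<beta>))
      + Lip_h \<epsilon> N f \<phi> S \<delta> * Lip_F \<epsilon> N f \<phi> * ennreal (1 / (\<alpha> - \<eta>)) < 1)"

definition inertial_manifold ::
  "real \<Rightarrow> nat \<Rightarrow> (l2 \<Rightarrow> l2) \<Rightarrow> h01 \<Rightarrow> (real \<Rightarrow> E \<Rightarrow> E) \<Rightarrow> real \<Rightarrow> (real \<Rightarrow> real) \<Rightarrow> E set"
where
  "inertial_manifold \<epsilon> N f \<phi> S \<delta> \<omega> =
     {\<xi> + h_lp \<epsilon> N f \<phi> S \<delta> \<xi> \<omega> + (0, (\<delta> * z_ou \<epsilon> \<omega>) *\<^sub>R emb \<phi>) | \<xi>. \<xi> \<in> E1 \<epsilon> N}"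

definition h_tilde ::
  "real \<Rightarrow> nat \<Rightarrow> (l2 \<Rightarrow> l2) \<Rightarrow> h01 \<Rightarrow> (real \<Rightarrow> E \<Rightarrow> E) \<Rightarrow> real \<Rightarrow> E \<Rightarrow> (real \<Rightarrow> real) \<Rightarrow> E"
where
  "h_tilde \<epsilon> N f \<phi> S \<delta> \<xi> \<omega> =
     h_lp \<epsilon> N f \<phi> S \<delta> (\<xi> - proj_P \<epsilon> N (0, (\<delta> * z_ou \<epsilon> \<omega>) *\<^sub>R emb \<phi>)) \<omega>
     + proj_Q \<epsilon> N (0, (\<delta> * z_ou \<epsilon> \<omega>) *\<^sub>R emb \<phi>)"

definition manifold_part ::
  "real \<Rightarrow> nat \<Rightarrow> (l2 \<Rightarrow> l2) \<Rightarrow> h01 \<Rightarrow> (real \<Rightarrow> E \<Rightarrow> E) \<Rightarrow> real \<Rightarrow> real \<Rightarrow> (real \<Rightarrow> real) \<Rightarrow> E set"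
where
  "manifold_part \<epsilon> N f \<phi> S R \<delta> \<omega> =
     {\<xi> + h_tilde \<epsilon> N f \<phi> S \<delta> \<xi> \<omega> | \<xi>. \<xi> \<in> E1 \<epsilon> N \<and> norm_E \<epsilon> N \<xi> \<le> R}"

text \<open>For \<open>\<delta> = 0\<close> nothing depends on the path, so \<open>M\<^sub>0\<close> is taken at the zero path.\<close>

lemma inertial_manifold_0:
  "inertial_manifold \<epsilon> N f \<phi> S 0 \<omega> = inertial_manifold \<epsilon> N f \<phi> S 0 \<omega>'"
proof -
  define G where "G = F_wave \<epsilon> f \<phi> 0 (\<lambda>_. 0)"
  have F0: "F_wave \<epsilon> f \<phi> 0 w = G" for w
    by (simp add: F_wave_def G_def)
  have "h_lp \<epsilon> N f \<phi> S 0 \<xi> \<omega> = h_lp \<epsilon> N f \<phi> S 0 \<xi> \<omega>'" for \<xi>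
    unfolding h_lp_def lp_orbit_def lp_solution_def F0 ..
  then show ?thesis
    by (simp add: inertial_manifold_def)
qed

definition manifold_0 :: "real \<Rightarrow> nat \<Rightarrow> (l2 \<Rightarrow> l2) \<Rightarrow> h01 \<Rightarrow> (real \<Rightarrow> E \<Rightarrow> E) \<Rightarrow> E set" where
  "manifold_0 \<epsilon> N f \<phi> S = inertial_manifold \<epsilon> N f \<phi> S 0 (\<lambda>_. 0)"

end

theory Submission
  imports Defs
begin

text \<open>The distance of \<open>M\<^sub>\<delta>\<^sup>R(\<omega>)\<close> from \<open>M\<^sub>0\<close> is at most \<open>C(\<omega>) \<delta>\<close>, with a constant that does not depend
  on \<open>R\<close>.

  Take a point \<open>U = \<xi> + h_tilde(\<xi>, \<omega>)\<close> of \<open>M\<^sub>\<delta>(\<omega>)\<close> and put \<open>\<zeta> = \<xi> - P(0, \<delta>\<phi>z(\<omega>))\<close>. Then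
  \<open>U = \<zeta> + h\<^sub>\<delta>(\<zeta>, \<omega>) + (0, \<delta>\<phi>z(\<omega>))\<close>, and the point \<open>V = \<zeta> + h\<^sub>0(\<zeta>)\<close> of \<open>M\<^sub>0\<close> has the same base point, so
  \<open>U - V = h\<^sub>\<delta>(\<zeta>, \<omega>) - h\<^sub>0(\<zeta>) + (0, \<delta>\<phi>z(\<omega>))\<close>. The two orbits that define \<open>h\<^sub>\<delta>(\<zeta>, \<omega>)\<close> and \<open>h\<^sub>0(\<zeta>)\<close> solve
  Lyapunov-Perron equations with the same initial term and the same nonlinearity; these differ only
  by the forcing \<open>\<delta> z(\<theta>\<^sub>s\<omega>) (\<phi>, 0)\<close>. In the norm \<open>sup\<^sub>t e\<^bsup>-\<eta>t\<^esup> \<parallel>U(t)\<parallel>\<^sub>E\<close> the Lyapunov-Perron operator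
  contracts with a factor \<open>\<kappa> < 1\<close>, by the first term of the spectral gap condition, and a forcing
  \<open>b\<close> changes its value by at most \<open>2 \<integral> e\<^bsup>-\<eta>s\<^esup> \<parallel>b(s)\<parallel>\<^sub>E ds\<close> over the negative half-line. Hence the
  orbits, and with them \<open>h\<^sub>\<delta>\<close> and \<open>h\<^sub>0\<close>, differ by \<open>O(\<delta>)\<close> as soon as
  \<open>\<integral> e\<^bsup>-\<eta>s\<^esup> \<bar>z(\<theta>\<^sub>s\<omega>)\<bar> ds\<close> is finite (\<open>solutions_close\<close>, \<open>stable_part_close\<close>,
  \<open>manifold_noise_estimate\<close>). The same contraction gives the existence and uniqueness of orbits
  that the definition of \<open>h\<^sub>\<delta>\<close> presupposes (\<open>solution_exists\<close>, \<open>solution_unique\<close>).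

  That integral is finite for almost every path: from the first moments of \<open>\<omega>(s)\<close> and Tonelli's
  theorem, \<open>e\<^bsup>cs\<^esup> \<omega>(s)\<close> is almost surely integrable over \<open>s \<le> 0\<close> for \<open>c = -\<eta>/2\<close>, and \<open>z(\<theta>\<^sub>t\<omega>)\<close> is an
  explicit expression in \<open>\<omega>(t)\<close> and an exponentially weighted integral of \<open>\<omega>\<close> up to time \<open>t\<close>
  (\<open>wiener_exp_integrable\<close>, \<open>ou_regularity\<close>).

  The contraction needs \<open>\<parallel>e\<^bsup>At\<^esup>\<parallel> \<le> e\<^bsup>\<alpha>t\<^esup>\<close> on \<open>E\<^sub>1\<close> for \<open>t \<le> 0\<close> and \<open>\<parallel>e\<^bsup>At\<^esup>\<parallel> \<le> e\<^bsup>\<beta>t\<^esup>\<close> on \<open>E\<^sub>2\<close> for \<open>t \<ge> 0\<close>, in the norm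
  \<open>\<parallel>\<cdot>\<parallel>\<^sub>E\<close>. All objects diagonalise in sine coefficients: \<open>\<parallel>U\<parallel>\<^sub>E\<^sup>2\<close> is the sum over the modes of a
  quadratic form in the two coefficients of the mode, and \<open>E\<^sub>1\<close>, \<open>E\<^sub>2\<close> are cut out by linear conditions
  on these. The semigroup is known through its generator only. On the domain of the generator, each
  eigenvector coordinate of a mode \<open>k \<le> N\<close> satisfies a scalar linear differential equation, and the
  energy of each mode \<open>k > N\<close> decays at the rate \<open>2\<beta>\<close>; both facts extend to all of \<open>E\<close> by
  density of the domain (\<open>semigroup_eigenfunctional\<close>, \<open>semigroup_energy_decay\<close>, \<open>norm_E_S_le\<close>).\<close>


section \<open>Completeness of \<open>L\<^sup>2(0, \<pi>)\<close> and \<open>H\<^sub>0\<^sup>1(0, \<pi>)\<close>\<close>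

lemma square_integrable_rep: "square_integrable (rep_l2 u)"
  using Quotient3_rep_reflp[OF Quotient3_l2, of u] by simp

lemma l2_of_rep [simp]: "l2_of (rep_l2 u) = u"
  by (rule Quotient3_abs_rep[OF Quotient3_l2])

lemma l2_of_eq_iff:
  assumes "square_integrable f" "square_integrable g"
  shows "l2_of f = l2_of g \<longleftrightarrow> (AE x in ivl. f x = g x)"
  using Quotient3_rel[OF Quotient3_l2, of f g] assms by (auto simp: l2_rel_def)

lemma square_integrable_diff:
  assumes "square_integrable f" "square_integrable g"
  shows "square_integrable (\<lambda>x. f x - g x)"
  using square_integrable_add[OF assms(1) square_integrable_scale[OF assms(2), of "-1"]] by simp

lemma l2_of_diff:
  assumes "square_integrable f" "square_integrable g"
  shows "l2_of (\<lambda>x. f x - g x) = l2_of f - l2_of g"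
  using l2_of_add[OF assms(1) square_integrable_scale[OF assms(2), of "-1"]]
    l2_of_scale[OF assms(2), of "-1"] by simp

lemma norm_l2_of_sq: "square_integrable f \<Longrightarrow> (norm (l2_of f))\<^sup>2 = integral\<^sup>L ivl (\<lambda>x. (f x)\<^sup>2)"
  by (simp add: power2_norm_eq_inner inner_l2_of) (simp add: power2_eq_square)

lemma nn_integral_sq_l2:
  assumes "square_integrable f"
  shows "(\<integral>\<^sup>+x. ennreal ((f x)\<^sup>2) \<partial>ivl) = ennreal ((norm (l2_of f))\<^sup>2)"
  using assms by (subst nn_integral_eq_integral) (auto simp: norm_l2_of_sq square_integrable_def)

lemma square_integrable_nnI:
  assumes "f \<in> borel_measurable ivl" "(\<integral>\<^sup>+x. ennreal ((f x)\<^sup>2) \<partial>ivl) < \<infinity>"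
  shows "square_integrable f"
  unfolding square_integrable_def
  using assms by (auto intro!: integrableI_nonneg)

lemma emeasure_ivl: "emeasure ivl (space ivl) = ennreal pi"
  by (simp add: emeasure_restrict_space)

lemma integral_abs_le_norm:
  assumes "square_integrable f"
  shows "(\<integral>\<^sup>+x. ennreal \<bar>f x\<bar> \<partial>ivl) \<le> ennreal (norm (l2_of f) * sqrt pi)"
proof -
  have 1: "square_integrable (\<lambda>_. 1)" by (rule square_integrable_continuous) simp
  have a: "square_integrable (\<lambda>x. \<bar>f x\<bar>)"
    using assms by (auto simp: square_integrable_def)
  have n1: "(norm (l2_of (\<lambda>_. 1)))\<^sup>2 = pi"
    using nn_integral_sq_l2[OF 1] emeasure_ivl by simp
  have na: "(norm (l2_of (\<lambda>x. \<bar>f x\<bar>)))\<^sup>2 = (norm (l2_of f))\<^sup>2"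
    using assms a by (simp add: norm_l2_of_sq)
  have int: "integrable ivl (\<lambda>x. \<bar>f x\<bar>)"
    using square_integrable_mult[OF a 1] by simp
  have "integral\<^sup>L ivl (\<lambda>x. \<bar>f x\<bar>) = inner (l2_of (\<lambda>x. \<bar>f x\<bar>)) (l2_of (\<lambda>_. 1))"
    using a 1 by (simp add: inner_l2_of)
  also have "\<dots> \<le> norm (l2_of (\<lambda>x. \<bar>f x\<bar>)) * norm (l2_of (\<lambda>_. 1))"
    by (rule norm_cauchy_schwarz)
  also have "\<dots> = norm (l2_of f) * sqrt pi"
    using n1 na by (metis norm_ge_zero power2_eq_iff_nonneg real_sqrt_unique)
  finally show ?thesis
    using int by (subst nn_integral_eq_integral) (auto intro: ennreal_leI)
qed

lemma Cauchy_geometric_subseq: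
  fixes X :: "nat \<Rightarrow> 'a::real_normed_vector"
  assumes "Cauchy X"
  obtains r where "strict_mono r" "\<And>n. norm (X (r (Suc n)) - X (r n)) \<le> (1/2)^n"
proof -
  have ex: "\<exists>M. \<forall>m\<ge>M. \<forall>k\<ge>M. norm (X m - X k) < (1/2)^n" for n :: nat
    using CauchyD[OF assms, of "(1/2)^n"] by simp
  define M where "M n = (SOME M. \<forall>m\<ge>M. \<forall>k\<ge>M. norm (X m - X k) < (1/2)^n)" for n :: nat
  have M: "norm (X m - X k) < (1/2)^n" if "m \<ge> M n" "k \<ge> M n" for m k n
    using someI_ex[OF ex[of n]] that unfolding M_def by blast
  define r where "r = rec_nat (M 0) (\<lambda>n x. max (Suc x) (M (Suc n)))"
  have r: "r 0 = M 0" "r (Suc n) = max (Suc (r n)) (M (Suc n))" for n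
    by (simp_all add: r_def)
  have "strict_mono r" by (auto simp: strict_mono_Suc_iff r)
  moreover have rM: "r n \<ge> M n" for n by (cases n) (simp_all add: r)
  have "norm (X (r (Suc n)) - X (r n)) \<le> (1/2)^n" for n
    by (rule less_imp_le, rule M) (use rM[of n] r(2)[of n] in auto)
  ultimately show ?thesis using that by blast
qed

text \<open>Riesz-Fischer: along a subsequence with geometrically small increments the increments are
  absolutely summable almost everywhere, so representatives converge pointwise almost everywhere;
  Fatou's lemma turns this into convergence in norm.\<close>

instance l2 :: banach
proof
  fix X :: "nat \<Rightarrow> l2" assume "Cauchy X"
  then obtain r where r: "strict_mono r" and geo: "\<And>n. norm (X (r (Suc n)) - X (r n)) \<le> (1/2)^n"
    using Cauchy_geometric_subseq by blast
  define F where "F n = rep_l2 (X (r n))" for n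
  have sF: "square_integrable (F n)" and XF: "l2_of (F n) = X (r n)" for n
    by (auto simp: F_def square_integrable_rep)
  have mF [measurable]: "F n \<in> borel_measurable ivl" for n
    using sF by (auto simp: square_integrable_def)
  have "(\<integral>\<^sup>+x. (\<Sum>n. ennreal \<bar>F (Suc n) x - F n x\<bar>) \<partial>ivl) = (\<Sum>n. \<integral>\<^sup>+x. ennreal \<bar>F (Suc n) x - F n x\<bar> \<partial>ivl)"
    by (rule nn_integral_suminf) auto
  also have "\<dots> \<le> (\<Sum>n. ennreal ((1/2)^n * sqrt pi))"
  proof (rule suminf_le)
    show "(\<integral>\<^sup>+x. ennreal \<bar>F (Suc n) x - F n x\<bar> \<partial>ivl) \<le> ennreal ((1/2)^n * sqrt pi)" for n
    proof -
      have "(\<integral>\<^sup>+x. ennreal \<bar>F (Suc n) x - F n x\<bar> \<partial>ivl) \<le> ennreal (norm (l2_of (\<lambda>x. F (Suc n) x - F n x)) * sqrt pi)"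
        by (intro integral_abs_le_norm square_integrable_diff sF)
      also have "\<dots> \<le> ennreal ((1/2)^n * sqrt pi)"
        using geo by (intro ennreal_leI mult_right_mono) (auto simp: l2_of_diff sF XF)
      finally show ?thesis .
    qed
  qed auto
  also have "\<dots> = ennreal (\<Sum>n. (1/2)^n * sqrt pi)"
    by (intro suminf_ennreal2 summable_mult2 summable_geometric) auto
  finally have "(\<integral>\<^sup>+x. (\<Sum>n. ennreal \<bar>F (Suc n) x - F n x\<bar>) \<partial>ivl) \<noteq> \<infinity>"
    by (auto simp: top_unique)
  then have "AE x in ivl. (\<Sum>n. ennreal \<bar>F (Suc n) x - F n x\<bar>) \<noteq> \<infinity>"
    by (intro nn_integral_PInf_AE) auto
  then have conv: "AE x in ivl. convergent (\<lambda>n. F n x)"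
  proof (rule AE_mp, intro AE_I2 impI)
    fix x assume "(\<Sum>n. ennreal \<bar>F (Suc n) x - F n x\<bar>) \<noteq> \<infinity>"
    then have "summable (\<lambda>n. \<bar>F (Suc n) x - F n x\<bar>)"
      by (intro summable_suminf_not_top) auto
    then have "summable (\<lambda>n. F (Suc n) x - F n x)"
      by (rule summable_rabs_cancel)
    then have "convergent (\<lambda>n. \<Sum>i<n. F (Suc i) x - F i x)"
      by (simp add: summable_iff_convergent)
    then have "convergent (\<lambda>n. F n x - F 0 x)"
      unfolding sum_lessThan_telescope[of "\<lambda>n. F n x"] .
    then show "convergent (\<lambda>n. F n x)"
      using convergent_add_const_right_iff[of "\<lambda>n. F n x" "- F 0 x"] by simp
  qed
  define f where "f x = lim (\<lambda>n. F n x)" for x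
  have mf [measurable]: "f \<in> borel_measurable ivl"
    unfolding f_def by (rule borel_measurable_lim_metric) auto
  have fl: "AE x in ivl. (\<lambda>n. F n x) \<longlonglongrightarrow> f x"
    using conv by eventually_elim (auto simp: f_def convergent_LIMSEQ_iff)
  have est: "(\<integral>\<^sup>+x. ennreal ((f x - F n x)\<^sup>2) \<partial>ivl) \<le> ennreal (e\<^sup>2)"
    if n: "\<And>m. m \<ge> n \<Longrightarrow> norm (X (r m) - X (r n)) \<le> e" for n e
  proof -
    have "(\<integral>\<^sup>+x. ennreal ((f x - F n x)\<^sup>2) \<partial>ivl) = (\<integral>\<^sup>+x. liminf (\<lambda>m. ennreal ((F m x - F n x)\<^sup>2)) \<partial>ivl)"
    proof (rule nn_integral_cong_AE, use fl in eventually_elim)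
      fix x assume "(\<lambda>n. F n x) \<longlonglongrightarrow> f x"
      then have "(\<lambda>m. ennreal ((F m x - F n x)\<^sup>2)) \<longlonglongrightarrow> ennreal ((f x - F n x)\<^sup>2)"
        by (intro tendsto_intros) auto
      then show "ennreal ((f x - F n x)\<^sup>2) = liminf (\<lambda>m. ennreal ((F m x - F n x)\<^sup>2))"
        by (intro lim_imp_Liminf[symmetric]) auto
    qed
    also have "\<dots> \<le> liminf (\<lambda>m. \<integral>\<^sup>+x. ennreal ((F m x - F n x)\<^sup>2) \<partial>ivl)"
      by (rule nn_integral_liminf) auto
    also have "\<dots> = liminf (\<lambda>m. ennreal ((norm (X (r m) - X (r n)))\<^sup>2))"
      by (simp add: nn_integral_sq_l2 square_integrable_diff sF l2_of_diff XF)
    also have "\<dots> \<le> ennreal (e\<^sup>2)"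
    proof (rule Liminf_le)
      show "\<forall>\<^sub>F m in sequentially. ennreal ((norm (X (r m) - X (r n)))\<^sup>2) \<le> ennreal (e\<^sup>2)"
        using eventually_ge_at_top[of n]
        by eventually_elim (intro ennreal_leI power_mono n, auto)
    qed auto
    finally show ?thesis .
  qed
  have cau: "\<exists>M. \<forall>n\<ge>M. \<forall>m\<ge>M. norm (X (r m) - X (r n)) \<le> e" if "e > 0" for e
    using CauchyD[OF Cauchy_subseq_Cauchy[OF \<open>Cauchy X\<close> r] that]
    by (auto simp: o_def intro: less_imp_le)
  obtain n0 where n0: "\<And>m. m \<ge> n0 \<Longrightarrow> norm (X (r m) - X (r n0)) \<le> 1"
    using cau[of 1] by auto
  have "square_integrable (\<lambda>x. f x - F n0 x)"
    using est[OF n0] by (intro square_integrable_nnI) (auto intro: le_less_trans)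
  from square_integrable_add[OF this sF[of n0]] have sf: "square_integrable f" by simp
  have "(\<lambda>n. X (r n)) \<longlonglongrightarrow> l2_of f"
  proof (rule LIMSEQ_I)
    fix e :: real assume "e > 0"
    then obtain M where M: "\<And>n m. n \<ge> M \<Longrightarrow> m \<ge> M \<Longrightarrow> norm (X (r m) - X (r n)) \<le> e/2"
      using cau[of "e/2"] by auto
    have "norm (X (r n) - l2_of f) < e" if "n \<ge> M" for n
    proof -
      have "ennreal ((norm (l2_of f - X (r n)))\<^sup>2) \<le> ennreal ((e/2)\<^sup>2)"
        using est[of n "e/2"] M[OF that] that sf
        by (simp add: nn_integral_sq_l2 square_integrable_diff sF l2_of_diff XF)
      then have "(norm (l2_of f - X (r n)))\<^sup>2 \<le> (e/2)\<^sup>2"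
        by (simp add: ennreal_le_iff)
      then have "norm (l2_of f - X (r n)) \<le> e/2"
        by (rule power2_le_imp_le) (use \<open>e > 0\<close> in simp)
      then show ?thesis using \<open>e > 0\<close> by (simp add: norm_minus_commute)
    qed
    then show "\<exists>no. \<forall>n\<ge>no. norm (X (r n) - l2_of f) < e" by blast
  qed
  then have "X \<longlonglongrightarrow> l2_of f"
    by (intro Cauchy_converges_subseq[OF \<open>Cauchy X\<close> r]) (simp add: o_def)
  then show "convergent X" by (auto simp: convergent_def)
qed

lemma emb_simps [simp]:
  "emb 0 = 0" "emb (u + v) = emb u + emb v" "emb (u - v) = emb u - emb v"
  "emb (- u) = - emb u" "emb (c *\<^sub>R u) = c *\<^sub>R emb u"
  by (simp_all add: zero_h01.rep_eq plus_h01.rep_eq minus_h01.rep_eq uminus_h01.rep_eq scaleR_h01.rep_eq)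

lemma emb_inject_iff [simp]: "emb u = emb v \<longleftrightarrow> u = v"
  by (rule emb_inject)

text \<open>The weak derivative as an operator on the type of \<open>H\<^sub>0\<^sup>1\<close> functions, where it is total and linear.\<close>

definition dx :: "h01 \<Rightarrow> l2" where "dx u = weak_deriv (emb u)"

lemma dx_simps [simp]:
  "dx (u + v) = dx u + dx v" "dx (c *\<^sub>R u) = c *\<^sub>R dx u"
  using emb[of u] emb[of v] by (simp_all add: dx_def weak_deriv_add weak_deriv_scaleR)

lemma dx_simps' [simp]: "dx 0 = 0" "dx (- u) = - dx u" "dx (u - v) = dx u - dx v"
  using dx_simps(2)[of 0 0] dx_simps(2)[of "-1" u] dx_simps(1)[of u "-v"] dx_simps(2)[of "-1" v]
  by simp_all

lemma inner_h01_eq: "inner u v = inner (emb u) (emb v) + inner (dx u) (dx v)"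
  unfolding dx_def by transfer simp

lemma norm_h01_sq: "(norm (u::h01))\<^sup>2 = (norm (emb u))\<^sup>2 + (norm (dx u))\<^sup>2"
  by (simp add: power2_norm_eq_inner inner_h01_eq)

lemma norm_emb_le: "norm (emb u) \<le> norm u" and norm_dx_le: "norm (dx u) \<le> norm u"
  by (rule power2_le_imp_le; simp add: norm_h01_sq)+

lemma norm_h01_le: "norm u \<le> norm (emb u) + norm (dx u)"
  by (rule power2_le_imp_le) (auto simp: norm_h01_sq power2_sum)

lemma bounded_linear_emb: "bounded_linear emb" and bounded_linear_dx: "bounded_linear dx"
  by (rule bounded_linear_intro[where K=1]; simp add: norm_emb_le norm_dx_le)+

text \<open>The weak derivative is a closed operator, and \<open>H\<^sub>0\<^sup>1\<close> is closed under limits in its graph norm.\<close>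

lemma H01I_limit:
  assumes "\<And>n. X n \<in> H01" "X \<longlonglongrightarrow> u" "(\<lambda>n. weak_deriv (X n)) \<longlonglongrightarrow> g"
  shows "u \<in> H01" "weak_deriv u = g"
proof -
  have w: "has_weak_deriv u g"
    unfolding has_weak_deriv_def
  proof
    fix \<psi> assume "\<psi> \<in> C1c"
    then have e: "inner (X n) (l2_of (deriv \<psi>)) = - inner (weak_deriv (X n)) (l2_of \<psi>)" for n
      using H01_has_weak_deriv[OF assms(1)] by (auto simp: has_weak_deriv_def)
    have "(\<lambda>n. inner (X n) (l2_of (deriv \<psi>))) \<longlonglongrightarrow> inner u (l2_of (deriv \<psi>))"
      by (intro tendsto_intros assms)
    moreover have "(\<lambda>n. - inner (weak_deriv (X n)) (l2_of \<psi>)) \<longlonglongrightarrow> - inner g (l2_of \<psi>)"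
      by (intro tendsto_intros assms)
    ultimately show "inner u (l2_of (deriv \<psi>)) = - inner g (l2_of \<psi>)"
      unfolding e using LIMSEQ_unique by blast
  qed
  then show "weak_deriv u = g" by (rule weak_deriv_eq)
  show "u \<in> H01"
    unfolding H01_def
  proof (clarsimp, intro exI[of _ g] conjI allI impI w)
    fix e :: real assume "e > 0"
    then obtain n where n: "norm (X n - u) < e/2" "norm (weak_deriv (X n) - g) < e/2"
      using LIMSEQ_D[OF assms(2), of "e/2"] LIMSEQ_D[OF assms(3), of "e/2"]
      by (metis half_gt_zero linorder_le_cases order_refl)
    obtain \<psi> where p: "\<psi> \<in> C1c" "norm (X n - l2_of \<psi>) < e/2" "norm (weak_deriv (X n) - l2_of (deriv \<psi>)) < e/2"
      using assms(1)[of n] half_gt_zero[OF \<open>e > 0\<close>] weak_deriv_eq unfolding H01_def by blast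
    have "norm (u - l2_of \<psi>) < e" "norm (g - l2_of (deriv \<psi>)) < e"
      using n p norm_triangle_ineq[of "u - X n" "X n - l2_of \<psi>"]
        norm_triangle_ineq[of "g - weak_deriv (X n)" "weak_deriv (X n) - l2_of (deriv \<psi>)"]
      by (auto simp: norm_minus_commute)
    with p(1) show "\<exists>\<psi>\<in>C1c. norm (u - l2_of \<psi>) < e \<and> norm (g - l2_of (deriv \<psi>)) < e" by blast
  qed
qed

instance h01 :: banach
proof
  fix X :: "nat \<Rightarrow> h01" assume "Cauchy X"
  then have "Cauchy (\<lambda>n. emb (X n))" "Cauchy (\<lambda>n. dx (X n))"
    by (auto intro: bounded_linear.Cauchy bounded_linear_emb bounded_linear_dx)
  then obtain u g where ug: "(\<lambda>n. emb (X n)) \<longlonglongrightarrow> u" "(\<lambda>n. dx (X n)) \<longlonglongrightarrow> g"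
    by (meson Cauchy_convergent convergent_def)
  have "u \<in> H01" "weak_deriv u = g"
    using H01I_limit[of "\<lambda>n. emb (X n)" u g] ug emb by (auto simp: dx_def)
  then have U: "emb (Abs_h01 u) = u" "dx (Abs_h01 u) = g"
    by (simp_all add: Abs_h01_inverse dx_def)
  have "(\<lambda>n. norm (emb (X n) - u) + norm (dx (X n) - g)) \<longlonglongrightarrow> 0 + 0"
    by (intro tendsto_add tendsto_norm_zero LIM_zero ug)
  then have l0: "(\<lambda>n. norm (emb (X n) - u) + norm (dx (X n) - g)) \<longlonglongrightarrow> 0" by simp
  have "norm (X n - Abs_h01 u) \<le> norm (emb (X n) - u) + norm (dx (X n) - g)" for n
    using norm_h01_le[of "X n - Abs_h01 u"] U by simp
  then have "(\<lambda>n. X n - Abs_h01 u) \<longlonglongrightarrow> 0"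
    by (intro Lim_null_comparison[OF _ l0] always_eventually) auto
  then show "convergent X"
    using LIM_zero_cancel unfolding convergent_def by blast
qed


section \<open>Orthonormal bases\<close>

definition orthonormal_seq :: "(nat \<Rightarrow> 'a::real_inner) \<Rightarrow> bool" where
  "orthonormal_seq e \<longleftrightarrow> (\<forall>i j. inner (e i) (e j) = (if i = j then 1 else 0))"

lemma orthonormal_sum_norm:
  assumes "orthonormal_seq e" "finite A"
  shows "(norm (\<Sum>i\<in>A. c i *\<^sub>R e i))\<^sup>2 = (\<Sum>i\<in>A. (c i)\<^sup>2)"
  unfolding power2_norm_eq_inner using assms
  by (simp add: inner_sum_left inner_sum_right orthonormal_seq_def
      if_distrib[of "\<lambda>x. _ * x"] power2_eq_square cong: if_cong)

lemma orthonormal_summable: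
  fixes e :: "nat \<Rightarrow> 'a::{real_inner, banach}"
  assumes "orthonormal_seq e" "summable (\<lambda>n. (c n)\<^sup>2)"
  shows "summable (\<lambda>n. c n *\<^sub>R e n)"
  unfolding summable_Cauchy
proof (intro allI impI)
  fix r :: real assume "r > 0"
  then have "r\<^sup>2 > 0" by simp
  then obtain M where M: "\<And>m n. m \<ge> M \<Longrightarrow> norm (\<Sum>i\<in>{m..<n}. (c i)\<^sup>2) < r\<^sup>2"
    using assms(2) unfolding summable_Cauchy by blast
  have "norm (\<Sum>i\<in>{m..<n}. c i *\<^sub>R e i) < r" if "m \<ge> M" for m n
    by (rule power2_less_imp_less)
       (use M[OF that, of n] \<open>r > 0\<close> in \<open>auto simp: orthonormal_sum_norm[OF assms(1)]\<close>)
  then show "\<exists>M. \<forall>m\<ge>M. \<forall>n. norm (\<Sum>i\<in>{m..<n}. c i *\<^sub>R e i) < r" by blast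
qed

lemma orthonormal_sums_inner:
  assumes "orthonormal_seq e" "(\<lambda>n. c n *\<^sub>R e n) sums x"
  shows "inner x (e n) = c n"
proof -
  have "(\<lambda>i. inner (c i *\<^sub>R e i) (e n)) sums inner x (e n)"
    by (rule bounded_linear.sums[OF bounded_linear_inner_left assms(2)])
  moreover have "(\<lambda>i. inner (c i *\<^sub>R e i) (e n)) sums (\<Sum>i\<in>{n}. inner (c i *\<^sub>R e i) (e n))"
    by (rule sums_finite) (use assms in \<open>auto simp: orthonormal_seq_def\<close>)
  ultimately have "inner x (e n) = (\<Sum>i\<in>{n}. inner (c i *\<^sub>R e i) (e n))"
    by (rule sums_unique2)
  then show ?thesis using assms by (simp add: orthonormal_seq_def)
qed

lemma bessel:
  assumes "orthonormal_seq e"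
  shows "summable (\<lambda>n. (inner x (e n))\<^sup>2)"
proof (rule summableI_nonneg_bounded)
  fix n
  let ?s = "\<Sum>i<n. inner x (e i) *\<^sub>R e i"
  have "inner x ?s = (\<Sum>i<n. (inner x (e i))\<^sup>2)"
    by (simp add: inner_sum_right power2_eq_square)
  moreover have "(norm ?s)\<^sup>2 = (\<Sum>i<n. (inner x (e i))\<^sup>2)"
    by (rule orthonormal_sum_norm[OF assms]) simp
  moreover have "0 \<le> (norm (x - ?s))\<^sup>2" by simp
  ultimately show "(\<Sum>i<n. (inner x (e i))\<^sup>2) \<le> (norm x)\<^sup>2"
    unfolding power2_norm_eq_inner by (simp add: inner_diff_left inner_diff_right inner_commute)
qed simp

text \<open>Totality is expressed by a trivial orthogonal complement; in a complete space this is equivalent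
  to a dense span.\<close>

definition hilbert_basis :: "(nat \<Rightarrow> 'a::real_inner) \<Rightarrow> bool" where
  "hilbert_basis e \<longleftrightarrow> orthonormal_seq e \<and> (\<forall>x. (\<forall>n. inner x (e n) = 0) \<longrightarrow> x = 0)"

text \<open>The Fourier series converges by completeness and Bessel's inequality, and the difference between \<open>x\<close>
  and its sum is orthogonal to the basis.\<close>

lemma hilbert_basis_sums:
  fixes e :: "nat \<Rightarrow> 'a::{real_inner, banach}"
  assumes "hilbert_basis e"
  shows "(\<lambda>n. inner x (e n) *\<^sub>R e n) sums x"
proof -
  have o: "orthonormal_seq e" using assms by (simp add: hilbert_basis_def)
  obtain y where y: "(\<lambda>n. inner x (e n) *\<^sub>R e n) sums y"
    using orthonormal_summable[OF o bessel[OF o]] by (auto simp: summable_def)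
  have "inner (x - y) (e n) = 0" for n
    using orthonormal_sums_inner[OF o y] by (simp add: inner_diff_left)
  then have "x - y = 0" using assms unfolding hilbert_basis_def by blast
  with y show ?thesis by simp
qed

lemma parseval:
  fixes e :: "nat \<Rightarrow> 'a::{real_inner, banach}"
  assumes "hilbert_basis e"
  shows "(\<lambda>n. inner x (e n) * inner y (e n)) sums inner x y"
  using bounded_linear.sums[OF bounded_linear_inner_left hilbert_basis_sums[OF assms], of y x]
  by (simp add: inner_commute mult.commute)


section \<open>Sine and cosine bases of \<open>L\<^sup>2(0, \<pi>)\<close>\<close>

lemma integral_ivl_FTC:
  assumes "\<And>x. (F has_real_derivative f x) (at x)" "continuous_on UNIV f"
  shows "integral\<^sup>L ivl f = F pi - F 0"
proof -
  have "integrable ivl f"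
    using square_integrable_mult[OF square_integrable_continuous[OF assms(2)] square_integrable_continuous[of "\<lambda>_. 1"]]
    by simp
  then have "integral\<^sup>L ivl f = integral {0<..<pi} f"
    by (intro lebesgue_integral_eq_integral) auto
  also have "\<dots> = integral {0..pi} f"
    using integral_open_interval_real[of 0 pi f] by simp
  also have "(f has_integral F pi - F 0) {0..pi}"
    by (rule fundamental_theorem_of_calculus)
       (use assms in \<open>auto simp: has_real_derivative_iff_has_vector_derivative[symmetric] intro: has_field_derivative_at_within\<close>)
  then have "integral {0..pi} f = F pi - F 0" by blast
  finally show ?thesis .
qed

lemma integral_cos_int:
  "integral\<^sup>L ivl (\<lambda>x. cos (of_int j * x)) = (if j = 0 then pi else 0)"
proof (cases "j = 0")
  case True
  have "integral\<^sup>L ivl (\<lambda>_. 1 :: real) = pi - 0"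
    by (rule integral_ivl_FTC[where F = "\<lambda>x. x"]) auto
  then show ?thesis using True by simp
next
  case False
  have "integral\<^sup>L ivl (\<lambda>x. cos (of_int j * x)) = sin (of_int j * pi) / of_int j - sin (of_int j * 0) / of_int j"
    by (rule integral_ivl_FTC) (use False in \<open>auto intro!: derivative_eq_intros continuous_intros\<close>)
  then show ?thesis using False by (simp add: sin_zero_iff_int2)
qed

lemma square_integrable_trig:
  "square_integrable (\<lambda>x. sin (real k * x))" "square_integrable (\<lambda>x. cos (real k * x))"
  by (intro square_integrable_continuous continuous_intros)+

definition cosL :: "nat \<Rightarrow> l2" where
  "cosL k = l2_of (\<lambda>x. cos (real k * x))"

lemma integral_cos_diff_sum:
  fixes s :: real
  shows "integral\<^sup>L ivl (\<lambda>x. (cos (real i * x - real j * x) + s * cos (real i * x + real j * x)) / 2)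
     = ((if i = j then pi else 0) + s * (if i + j = 0 then pi else 0)) / 2"
proof -
  have i: "integrable ivl (\<lambda>x. cos (of_int k * x))" for k
    using square_integrable_mult[OF square_integrable_continuous[of "\<lambda>x. cos (of_int k * x)"] square_integrable_continuous[of "\<lambda>_. 1"]]
    by (simp add: continuous_intros)
  have e: "cos (real i * x - real j * x) = cos (of_int (int i - int j) * x)"
    "cos (real i * x + real j * x) = cos (of_int (int i + int j) * x)" for x
    by (simp_all add: algebra_simps)
  have "integral\<^sup>L ivl (\<lambda>x. (cos (of_int (int i - int j) * x) + s * cos (of_int (int i + int j) * x)) / 2)
     = (integral\<^sup>L ivl (\<lambda>x. cos (of_int (int i - int j) * x)) + s * integral\<^sup>L ivl (\<lambda>x. cos (of_int (int i + int j) * x))) / 2"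
    by (simp only: integral_divide_zero Bochner_Integration.integral_add i integrable_mult_right integral_mult_right_zero)
  then show ?thesis unfolding e unfolding integral_cos_int by auto
qed

lemma inner_sinL: "inner (sinL i) (sinL j) = (if i = j \<and> i \<noteq> 0 then pi / 2 else 0)"
proof -
  have "inner (sinL i) (sinL j) = integral\<^sup>L ivl (\<lambda>x. sin (real i * x) * sin (real j * x))"
    unfolding sinL_def by (intro inner_l2_of square_integrable_trig)
  also have "\<dots> = integral\<^sup>L ivl (\<lambda>x. (cos (real i * x - real j * x) + (-1) * cos (real i * x + real j * x)) / 2)"
    by (simp add: sin_times_sin)
  finally show ?thesis unfolding integral_cos_diff_sum by (cases "i = j") auto
qed

lemma inner_cosL: "inner (cosL i) (cosL j) = (if i = j then (if i = 0 then pi else pi / 2) else 0)"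
proof -
  have "inner (cosL i) (cosL j) = integral\<^sup>L ivl (\<lambda>x. cos (real i * x) * cos (real j * x))"
    unfolding cosL_def by (intro inner_l2_of square_integrable_trig)
  also have "\<dots> = integral\<^sup>L ivl (\<lambda>x. (cos (real i * x - real j * x) + 1 * cos (real i * x + real j * x)) / 2)"
    by (simp add: cos_times_cos)
  finally show ?thesis unfolding integral_cos_diff_sum by auto
qed

text \<open>Normalised and indexed from \<open>0\<close>, so that \<open>esin n\<close> belongs to the eigenvalue \<open>(n + 1)\<^sup>2\<close>.\<close>

definition esin :: "nat \<Rightarrow> l2" where
  "esin n = sqrt (2 / pi) *\<^sub>R sinL (Suc n)"

definition ecos :: "nat \<Rightarrow> l2" where
  "ecos n = (if n = 0 then 1 / sqrt pi else sqrt (2 / pi)) *\<^sub>R cosL n"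

lemma sqrt_2_pi: "sqrt (2 / pi) * (sqrt (2 / pi) * pi) = 2" "sqrt (2 / pi) * sqrt (2 / pi) = 2 / pi"
  by (simp_all add: mult.assoc[symmetric] del: real_sqrt_divide)

lemma orthonormal_esin: "orthonormal_seq esin"
  unfolding orthonormal_seq_def esin_def by (auto simp: inner_sinL sqrt_2_pi simp del: real_sqrt_divide)

lemma orthonormal_ecos: "orthonormal_seq ecos"
  unfolding orthonormal_seq_def ecos_def by (auto simp: inner_cosL sqrt_2_pi simp del: real_sqrt_divide)

text \<open>Since \<open>cos\<close> maps \<open>[0, \<pi>]\<close> homeomorphically onto \<open>[-1, 1]\<close>, Weierstrass' theorem makes the polynomials
  in \<open>cos x\<close> uniformly dense in the continuous functions on \<open>[0, \<pi>]\<close>.\<close>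

lemma ivl_zero_if_cos_moments:
  assumes g: "square_integrable g" and 0: "\<And>n. integral\<^sup>L ivl (\<lambda>x. g x * cos x ^ n) = 0"
  shows "AE x in ivl. g x = 0"
proof (rule ivl_zero_if[OF g])
  fix \<psi> assume "\<psi> \<in> C1c"
  then have c\<psi>: "continuous_on UNIV \<psi>" by (rule C1cD)
  have 1: "square_integrable (\<lambda>_. 1)" by (rule square_integrable_continuous) simp
  have ig: "integrable ivl (\<lambda>x. \<bar>g x\<bar>)"
    using square_integrable_mult[OF g 1] by simp
  define I where "I = integral\<^sup>L ivl (\<lambda>x. \<bar>g x\<bar>)"
  have I: "I \<ge> 0" unfolding I_def by (rule integral_nonneg_AE) auto
  have bound: "\<bar>integral\<^sup>L ivl (\<lambda>x. g x * \<psi> x)\<bar> \<le> e * I" if "e > 0" for e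
  proof -
    have "continuous_on {-1..1} (\<psi> \<circ> arccos)"
      by (intro continuous_on_compose continuous_on_arccos') (rule continuous_on_subset[OF c\<psi>], simp)
    then obtain q where q: "real_polynomial_function q" "\<And>y. y \<in> {-1..1} \<Longrightarrow> \<bar>(\<psi> \<circ> arccos) y - q y\<bar> < e"
      using Stone_Weierstrass_real_polynomial_function[of "{-1..1}" "\<psi> \<circ> arccos" e] \<open>e > 0\<close> by auto
    then obtain a n where q': "q = (\<lambda>x. \<Sum>i\<le>n. a i * x ^ i)"
      by (auto simp: real_polynomial_function_iff_sum)
    have sq: "square_integrable (\<lambda>x. cos x ^ i)" for i
      by (intro square_integrable_continuous continuous_intros)
    have "integral\<^sup>L ivl (\<lambda>x. g x * q (cos x)) = integral\<^sup>L ivl (\<lambda>x. \<Sum>i\<le>n. a i * (g x * cos x ^ i))"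
      by (simp add: q' sum_distrib_left mult_ac)
    also have "\<dots> = (\<Sum>i\<le>n. a i * integral\<^sup>L ivl (\<lambda>x. g x * cos x ^ i))"
      by (subst Bochner_Integration.integral_sum) (auto intro!: square_integrable_mult g sq)
    finally have q0: "integral\<^sup>L ivl (\<lambda>x. g x * q (cos x)) = 0" by (simp add: 0)
    have cq: "continuous_on UNIV (\<lambda>x. q (cos x))"
      unfolding q' by (intro continuous_intros)
    have i\<psi>: "integrable ivl (\<lambda>x. g x * \<psi> x)" and iq: "integrable ivl (\<lambda>x. g x * q (cos x))"
      by (intro square_integrable_mult g square_integrable_continuous c\<psi> cq)+
    have "\<bar>integral\<^sup>L ivl (\<lambda>x. g x * \<psi> x)\<bar> = \<bar>integral\<^sup>L ivl (\<lambda>x. g x * \<psi> x - g x * q (cos x))\<bar>"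
      using i\<psi> iq q0 by simp
    also have "\<dots> \<le> integral\<^sup>L ivl (\<lambda>x. \<bar>g x * \<psi> x - g x * q (cos x)\<bar>)"
      by (rule integral_abs_bound)
    also have "\<dots> \<le> integral\<^sup>L ivl (\<lambda>x. e * \<bar>g x\<bar>)"
    proof (rule integral_mono)
      fix x assume "x \<in> space ivl"
      then have "x \<in> {0<..<pi}" by simp
      then have "\<bar>\<psi> x - q (cos x)\<bar> \<le> e"
        using q(2)[of "cos x"] by (auto simp: arccos_cos)
      then show "\<bar>g x * \<psi> x - g x * q (cos x)\<bar> \<le> e * \<bar>g x\<bar>"
        by (simp only: abs_mult mult_right_mono mult.commute[of e] mult_left_mono abs_ge_zero flip: right_diff_distrib)
    qed (use ig i\<psi> iq in auto)
    also have "\<dots> = e * I" by (simp add: I_def)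
    finally show ?thesis .
  qed
  have "\<bar>integral\<^sup>L ivl (\<lambda>x. g x * \<psi> x)\<bar> \<le> 0"
  proof (rule field_le_epsilon)
    fix e :: real assume "e > 0"
    have "\<bar>integral\<^sup>L ivl (\<lambda>x. g x * \<psi> x)\<bar> \<le> e / (I + 1) * I"
      using I \<open>e > 0\<close> by (intro bound) auto
    also have "\<dots> \<le> 0 + e" using I \<open>e > 0\<close> by (simp add: field_simps)
    finally show "\<bar>integral\<^sup>L ivl (\<lambda>x. g x * \<psi> x)\<bar> \<le> 0 + e" .
  qed
  then show "integral\<^sup>L ivl (\<lambda>x. g x * \<psi> x) = 0" by simp
qed

lemma l2_of_eq_0_iff: "square_integrable f \<Longrightarrow> l2_of f = 0 \<longleftrightarrow> (AE x in ivl. f x = 0)"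
  by (simp add: zero_l2_def l2_of_eq_iff)

text \<open>Multiplying a family of trigonometric functions by \<open>cos\<close> shifts its frequencies by \<open>\<plusminus>1\<close>, so a
  function orthogonal to the family is orthogonal to its products with all powers of \<open>cos\<close>.\<close>

lemma integral_cos_power_zero:
  assumes f: "square_integrable f" and cont: "\<And>k. continuous_on UNIV (\<tau> k)"
    and shift: "\<And>k x. \<tau> k x * cos x = (\<tau> (Suc k) x + s k * \<tau> (m k) x) / 2"
    and zero: "\<And>k. integral\<^sup>L ivl (\<lambda>x. f x * \<tau> k x) = 0"
  shows "integral\<^sup>L ivl (\<lambda>x. f x * (\<tau> k x * cos x ^ n)) = 0"
proof (induction n arbitrary: k)
  case 0 show ?case using zero by simp
next
  case (Suc n)
  have i: "integrable ivl (\<lambda>x. f x * (\<tau> k x * cos x ^ n))" for k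
    by (intro square_integrable_mult f square_integrable_continuous continuous_intros cont)
  have "integral\<^sup>L ivl (\<lambda>x. f x * (\<tau> k x * cos x ^ Suc n)) =
    integral\<^sup>L ivl (\<lambda>x. (f x * (\<tau> (Suc k) x * cos x ^ n) + s k * (f x * (\<tau> (m k) x * cos x ^ n))) / 2)"
  proof (rule Bochner_Integration.integral_cong[OF refl])
    fix x
    have "f x * (\<tau> k x * cos x ^ Suc n) = f x * (\<tau> k x * cos x) * cos x ^ n" by simp
    then show "f x * (\<tau> k x * cos x ^ Suc n)
      = (f x * (\<tau> (Suc k) x * cos x ^ n) + s k * (f x * (\<tau> (m k) x * cos x ^ n))) / 2"
      unfolding shift by (simp add: field_simps)
  qed
  also have "\<dots> = 0"
    using Suc.IH i
    by (simp only: integral_divide_zero Bochner_Integration.integral_add integrable_mult_right integral_mult_right_zero) simp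
  finally show ?case .
qed

lemma l2_zero_if_cosL:
  assumes "\<And>k. inner w (cosL k) = 0"
  shows "w = 0"
proof -
  define f where "f = rep_l2 w"
  have f: "square_integrable f" "w = l2_of f" by (auto simp: f_def square_integrable_rep)
  have "integral\<^sup>L ivl (\<lambda>x. f x * (cos (real 0 * x) * cos x ^ n)) = 0" for n
  proof (rule integral_cos_power_zero[OF f(1), of "\<lambda>k x. cos (real k * x)" "\<lambda>_. 1" "\<lambda>k. if k = 0 then 1 else k - 1"])
    fix k x
    show "cos (real k * x) * cos x = (cos (real (Suc k) * x) + 1 * cos (real (if k = 0 then 1 else k - 1) * x)) / 2"
      using cos_times_cos[of "real k * x" x] by (cases k) (simp_all add: algebra_simps)
    show "integral\<^sup>L ivl (\<lambda>x. f x * cos (real k * x)) = 0"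
      using assms[of k] f by (simp add: cosL_def inner_l2_of square_integrable_trig)
  qed (intro continuous_intros)
  then show ?thesis
    using ivl_zero_if_cos_moments[OF f(1)] f by (simp add: l2_of_eq_0_iff)
qed

lemma l2_zero_if_sinL:
  assumes "\<And>k. inner w (sinL (Suc k)) = 0"
  shows "w = 0"
proof -
  define f where "f = rep_l2 w"
  have f: "square_integrable f" "w = l2_of f" by (auto simp: f_def square_integrable_rep)
  have "integral\<^sup>L ivl (\<lambda>x. f x * (sin (real 1 * x) * cos x ^ n)) = 0" for n
  proof (rule integral_cos_power_zero[OF f(1), of "\<lambda>k x. sin (real k * x)" "\<lambda>k. if k = 0 then -1 else 1" "\<lambda>k. if k = 0 then 1 else k - 1"])
    fix k x
    show "sin (real k * x) * cos x = (sin (real (Suc k) * x) + (if k = 0 then -1 else 1) * sin (real (if k = 0 then 1 else k - 1) * x)) / 2"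
      using sin_times_cos[of "real k * x" x] by (cases k) (simp_all add: algebra_simps)
    show "integral\<^sup>L ivl (\<lambda>x. f x * sin (real k * x)) = 0"
      using assms[of "k - 1"] f unfolding sinL_def
      by (cases k) (simp_all add: inner_l2_of square_integrable_trig del: of_nat_Suc)
  qed (intro continuous_intros)
  then have m: "integral\<^sup>L ivl (\<lambda>x. (f x * sin x) * cos x ^ n) = 0" for n
    by (simp add: mult.assoc)
  \<comment> \<open>The moments are those of \<open>f \<cdot> sin\<close>, and \<open>sin\<close> has no zero inside the interval.\<close>
  have "square_integrable (\<lambda>x. f x * sin x)"
    unfolding square_integrable_def
  proof
    have s: "sin \<in> borel_measurable ivl"
      using square_integrable_trig(1)[of 1] by (simp add: square_integrable_def)
    have fm: "f \<in> borel_measurable ivl" "integrable ivl (\<lambda>x. (f x)\<^sup>2)"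
      using f by (auto simp: square_integrable_def)
    show fs: "(\<lambda>x. f x * sin x) \<in> borel_measurable ivl"
      using s fm by auto
    show "integrable ivl (\<lambda>x. (f x * sin x)\<^sup>2)"
    proof (rule Bochner_Integration.integrable_bound[OF fm(2)])
      show "AE x in ivl. norm ((f x * sin x)\<^sup>2) \<le> norm ((f x)\<^sup>2)"
        by (intro AE_I2) (auto simp: power_mult_distrib intro!: mult_left_le abs_square_le_1[THEN iffD2])
    qed (use fs in auto)
  qed
  from ivl_zero_if_cos_moments[OF this m] have "AE x in ivl. f x = 0"
  proof (rule AE_mp, intro AE_I2 impI)
    fix x assume "x \<in> space ivl" "f x * sin x = 0"
    then show "f x = 0" using sin_gt_zero[of x] by auto
  qed
  then show ?thesis using f by (simp add: l2_of_eq_0_iff)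
qed

lemma hilbert_basis_esin: "hilbert_basis esin"
  unfolding hilbert_basis_def using orthonormal_esin l2_zero_if_sinL by (auto simp: esin_def)

lemma hilbert_basis_ecos: "hilbert_basis ecos"
  unfolding hilbert_basis_def
proof (intro conjI orthonormal_ecos allI impI)
  fix x assume "\<forall>n. inner x (ecos n) = 0"
  then have "inner x (cosL k) = 0" for k
    by (drule_tac x=k in spec) (auto simp: ecos_def split: if_splits)
  then show "x = 0" by (rule l2_zero_if_cosL)
qed


section \<open>Fourier coefficients and the space \<open>H\<^sub>0\<^sup>1\<close>\<close>

lemma square_integrable_C1c:
  assumes "\<psi> \<in> C1c" shows "square_integrable \<psi>" "square_integrable (deriv \<psi>)"
  using assms by (auto intro: square_integrable_continuous C1cD)

lemma integral_by_parts_C1c: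
  assumes \<psi>: "\<psi> \<in> C1c" and g: "\<And>x. (g has_real_derivative g' x) (at x)" "continuous_on UNIV g'"
  shows "integral\<^sup>L ivl (\<lambda>x. deriv \<psi> x * g x) = - integral\<^sup>L ivl (\<lambda>x. \<psi> x * g' x)"
proof -
  have cg: "continuous_on UNIV g"
    using g(1) by (intro continuous_at_imp_continuous_on ballI DERIV_isCont) auto
  have i: "integrable ivl (\<lambda>x. deriv \<psi> x * g x)" "integrable ivl (\<lambda>x. \<psi> x * g' x)"
    by (intro square_integrable_mult square_integrable_C1c \<psi> square_integrable_continuous cg g)+
  obtain a b where ab: "0 < a" "b < pi" "\<And>x. x \<notin> {a..b} \<Longrightarrow> \<psi> x = 0"
    using \<psi> by (auto simp: C1c_def)
  have "integral\<^sup>L ivl (\<lambda>x. deriv \<psi> x * g x + \<psi> x * g' x) = \<psi> pi * g pi - \<psi> 0 * g 0"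
    by (rule integral_ivl_FTC)
       (auto intro!: derivative_eq_intros C1cD[OF \<psi>] g continuous_intros cg)
  also have "\<dots> = 0" using ab by simp
  finally show ?thesis using i by simp
qed

lemma H01_approx:
  assumes "u \<in> H01"
  obtains \<psi> where "\<And>n. \<psi> n \<in> C1c" "(\<lambda>n. l2_of (\<psi> n)) \<longlonglongrightarrow> u" "(\<lambda>n. l2_of (deriv (\<psi> n))) \<longlonglongrightarrow> weak_deriv u"
proof -
  have "\<exists>\<psi>\<in>C1c. norm (u - l2_of \<psi>) < inverse (real (Suc n)) \<and> norm (weak_deriv u - l2_of (deriv \<psi>)) < inverse (real (Suc n))" for n
  proof -
    obtain g where "has_weak_deriv u g" "\<And>e. e > 0 \<Longrightarrow> \<exists>\<psi>\<in>C1c. norm (u - l2_of \<psi>) < e \<and> norm (g - l2_of (deriv \<psi>)) < e"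
      using assms unfolding H01_def by blast
    then show ?thesis using weak_deriv_eq by (metis inverse_positive_iff_positive of_nat_0_less_iff zero_less_Suc)
  qed
  then obtain \<psi> where p: "\<And>n. \<psi> n \<in> C1c" "\<And>n. norm (u - l2_of (\<psi> n)) < inverse (real (Suc n))"
    "\<And>n. norm (weak_deriv u - l2_of (deriv (\<psi> n))) < inverse (real (Suc n))"
    by metis
  have "(\<lambda>n. l2_of (\<psi> n) - u) \<longlonglongrightarrow> 0" "(\<lambda>n. l2_of (deriv (\<psi> n)) - weak_deriv u) \<longlonglongrightarrow> 0"
    by (rule Lim_null_comparison[OF always_eventually LIMSEQ_inverse_real_of_nat], rule allI,
        subst norm_minus_commute, rule less_imp_le, rule p)+
  then have "(\<lambda>n. l2_of (\<psi> n)) \<longlonglongrightarrow> u" "(\<lambda>n. l2_of (deriv (\<psi> n))) \<longlonglongrightarrow> weak_deriv u"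
    by (auto intro: LIM_zero_cancel)
  with p(1) show ?thesis by (rule that)
qed

text \<open>There is no boundary term although \<open>g\<close> need not vanish at \<open>0\<close> and \<open>\<pi>\<close>: \<open>u\<close> is a limit in \<open>H\<^sup>1\<close> of
  functions with compact support.\<close>

lemma inner_dx_smooth:
  assumes g: "\<And>x. (g has_real_derivative g' x) (at x)" "continuous_on UNIV g'"
  shows "inner (dx u) (l2_of g) = - inner (emb u) (l2_of g')"
proof -
  have cg: "continuous_on UNIV g"
    using g(1) by (intro continuous_at_imp_continuous_on ballI DERIV_isCont) auto
  obtain \<psi> where p: "\<And>n. \<psi> n \<in> C1c" "(\<lambda>n. l2_of (\<psi> n)) \<longlonglongrightarrow> emb u" "(\<lambda>n. l2_of (deriv (\<psi> n))) \<longlonglongrightarrow> dx u"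
    using H01_approx[OF emb[of u]] unfolding dx_def by blast
  have e: "inner (l2_of (deriv (\<psi> n))) (l2_of g) = - inner (l2_of (\<psi> n)) (l2_of g')" for n
    using integral_by_parts_C1c[OF p(1) g]
    by (simp add: inner_l2_of square_integrable_C1c p(1) square_integrable_continuous cg g(2))
  have "(\<lambda>n. inner (l2_of (deriv (\<psi> n))) (l2_of g)) \<longlonglongrightarrow> inner (dx u) (l2_of g)"
    "(\<lambda>n. - inner (l2_of (\<psi> n)) (l2_of g')) \<longlonglongrightarrow> - inner (emb u) (l2_of g')"
    by (intro tendsto_intros p)+
  then show ?thesis unfolding e using LIMSEQ_unique by blast
qed

lemma inner_dx_cosL: "inner (dx u) (cosL k) = real k * inner (emb u) (sinL k)"
proof -
  have "inner (dx u) (cosL k) = - inner (emb u) (l2_of (\<lambda>x. - real k * sin (real k * x)))"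
    unfolding cosL_def
    by (rule inner_dx_smooth) (auto intro!: derivative_eq_intros continuous_intros)
  also have "l2_of (\<lambda>x. - real k * sin (real k * x)) = (- real k) *\<^sub>R sinL k"
    unfolding sinL_def by (rule l2_of_scale) (rule square_integrable_trig)
  finally show ?thesis by simp
qed

text \<open>The weak formulation of \<open>-\<Delta>u = w\<close>, extended from test functions to all of \<open>H\<^sub>0\<^sup>1\<close> by density.\<close>

lemma inner_neg_laplacian:
  assumes "(u, w) \<in> neg_laplacian"
  shows "inner (dx u) (dx v) = inner w (emb v)"
proof -
  obtain \<psi> where p: "\<And>n. \<psi> n \<in> C1c" "(\<lambda>n. l2_of (\<psi> n)) \<longlonglongrightarrow> emb v" "(\<lambda>n. l2_of (deriv (\<psi> n))) \<longlonglongrightarrow> dx v"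
    using H01_approx[OF emb[of v]] unfolding dx_def by blast
  have e: "inner (dx u) (l2_of (deriv (\<psi> n))) = inner w (l2_of (\<psi> n))" for n
    using assms p(1)[of n] by (auto simp: neg_laplacian_def has_weak_deriv_def dx_def)
  have "(\<lambda>n. inner (dx u) (l2_of (deriv (\<psi> n)))) \<longlonglongrightarrow> inner (dx u) (dx v)"
    "(\<lambda>n. inner w (l2_of (\<psi> n))) \<longlonglongrightarrow> inner w (emb v)"
    by (intro tendsto_intros p)+
  then show ?thesis unfolding e using LIMSEQ_unique by blast
qed

definition coef :: "l2 \<Rightarrow> nat \<Rightarrow> real" where "coef w n = inner w (esin n)"

lemma coef_simps [simp]:
  "coef (u + v) n = coef u n + coef v n" "coef (c *\<^sub>R u) n = c * coef u n"
  "coef (u - v) n = coef u n - coef v n" "coef (- u) n = - coef u n" "coef 0 n = 0"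
  by (simp_all add: coef_def inner_add_left inner_diff_left)

text \<open>The coefficient of \<open>u'\<close> at the constant function vanishes because \<open>u\<close> vanishes at both ends. Thus the
  cosine coefficients of \<open>u'\<close> are those of the sine series of \<open>u\<close>, differentiated term by term.\<close>

lemma inner_dx_ecos: "inner (dx u) (ecos 0) = 0" "inner (dx u) (ecos (Suc n)) = real (Suc n) * coef (emb u) n"
  by (simp_all add: ecos_def esin_def coef_def inner_dx_cosL)

lemma coef_parseval: "(\<lambda>n. coef u n * coef v n) sums inner u v"
  unfolding coef_def by (rule parseval[OF hilbert_basis_esin])

lemma coef_eqI: assumes "\<And>n. coef u n = coef v n" shows "u = v"
proof -
  have "\<forall>n. inner (u - v) (esin n) = 0" using assms by (simp add: inner_diff_left coef_def)
  then show ?thesis using hilbert_basis_esin unfolding hilbert_basis_def by (metis right_minus_eq)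
qed

lemma coef_parseval_dx: "(\<lambda>n. (real (Suc n))\<^sup>2 * (coef (emb u) n * coef (emb v) n)) sums inner (dx u) (dx v)"
proof -
  have "(\<lambda>n. inner (dx u) (ecos (Suc n)) * inner (dx v) (ecos (Suc n))) sums inner (dx u) (dx v)"
    using parseval[OF hilbert_basis_ecos, of "dx u" "dx v"]
    by (subst sums_Suc_iff) (simp add: inner_dx_ecos(1))
  then show ?thesis unfolding inner_dx_ecos(2) by (simp only: power2_eq_square mult_ac)
qed

text \<open>The series that defines the square root converges because Bessel's inequality for \<open>u'\<close> in the cosine
  basis bounds the sum of the squares of its coefficients.\<close>

lemma sqrt_laplacian_sums:
  "(\<lambda>n. (real (Suc n) * coef (emb u) n) *\<^sub>R esin n) sums sqrt_laplacian u"
proof -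
  have "summable (\<lambda>n. (real (Suc n) * coef (emb u) n) *\<^sub>R esin n)"
    by (rule orthonormal_summable[OF orthonormal_esin])
       (use coef_parseval_dx[of u u] in \<open>auto simp: sums_iff power_mult_distrib power2_eq_square mult_ac\<close>)
  moreover have "(real (Suc n) * coef (emb u) n) *\<^sub>R esin n =
      (real (Suc n) * (2 / pi * inner (emb u) (sinL (Suc n)))) *\<^sub>R sinL (Suc n)" for n
    using sqrt_2_pi(2) by (simp add: coef_def esin_def mult_ac del: real_sqrt_divide) 
  ultimately show ?thesis unfolding sqrt_laplacian_def by (simp add: summable_sums)
qed

lemma coef_sqrt_laplacian: "coef (sqrt_laplacian u) n = real (Suc n) * coef (emb u) n"
  unfolding coef_def[of "sqrt_laplacian u"] by (rule orthonormal_sums_inner[OF orthonormal_esin sqrt_laplacian_sums])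

text \<open>Both sides have the same expansion, the right one by Parseval's identity for the cosine basis. It
  replaces the series by the weak derivative in the definition of \<open>\<parallel>\<cdot>\<parallel>\<^sub>E\<close>.\<close>

lemma inner_sqrt_laplacian: "inner (sqrt_laplacian u) (sqrt_laplacian v) = inner (dx u) (dx v)"
proof (rule sums_unique2)
  show "(\<lambda>n. (real (Suc n))\<^sup>2 * (coef (emb u) n * coef (emb v) n)) sums inner (sqrt_laplacian u) (sqrt_laplacian v)"
    using coef_parseval[of "sqrt_laplacian u" "sqrt_laplacian v"]
    by (simp add: coef_sqrt_laplacian power2_eq_square mult_ac)
qed (rule coef_parseval_dx)

subsection \<open>Sine functions belong to \<open>H\<^sub>0\<^sup>1\<close>\<close>

lemma C1c_in_H01:
  assumes "\<psi> \<in> C1c"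
  shows "l2_of \<psi> \<in> H01" "weak_deriv (l2_of \<psi>) = l2_of (deriv \<psi>)"
proof -
  have w: "has_weak_deriv (l2_of \<psi>) (l2_of (deriv \<psi>))"
    unfolding has_weak_deriv_def
  proof
    fix \<rho> assume c: "\<rho> \<in> C1c"
    show "inner (l2_of \<psi>) (l2_of (deriv \<rho>)) = - inner (l2_of (deriv \<psi>)) (l2_of \<rho>)"
      using integral_by_parts_C1c[OF assms C1cD(1,2)[OF c]]
      by (simp add: inner_l2_of square_integrable_C1c assms c)
  qed
  then show "weak_deriv (l2_of \<psi>) = l2_of (deriv \<psi>)" by (rule weak_deriv_eq)
  show "l2_of \<psi> \<in> H01" unfolding H01_def using w assms by force
qed

lemma l2_of_dominated_convergence:
  assumes "\<And>n. square_integrable (f n)" "square_integrable g"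
    and "\<And>n x. x \<in> {0<..<pi} \<Longrightarrow> \<bar>f n x\<bar> \<le> C" "\<And>x. x \<in> {0<..<pi} \<Longrightarrow> (\<lambda>n. f n x) \<longlonglongrightarrow> g x"
  shows "(\<lambda>n. l2_of (f n)) \<longlonglongrightarrow> l2_of g"
proof -
  have gC: "\<bar>g x\<bar> \<le> C" if "x \<in> {0<..<pi}" for x
    by (rule LIMSEQ_le_const2[OF tendsto_rabs[OF assms(4)[OF that]]]) (use assms(3) that in auto)
  have "(\<lambda>n. integral\<^sup>L ivl (\<lambda>x. (f n x - g x)\<^sup>2)) \<longlonglongrightarrow> integral\<^sup>L ivl (\<lambda>x. 0)"
  proof (rule integral_dominated_convergence[where w = "\<lambda>_. (2 * C)\<^sup>2"])
    show "(\<lambda>x. (f n x - g x)\<^sup>2) \<in> borel_measurable ivl" for n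
      using assms(1)[of n] assms(2) by (auto simp: square_integrable_def)
    show "integrable ivl (\<lambda>_. (2 * C)\<^sup>2)"
      using square_integrable_continuous[of "\<lambda>_. 2 * C"] by (simp add: square_integrable_def)
    show "AE x in ivl. (\<lambda>n. (f n x - g x)\<^sup>2) \<longlonglongrightarrow> 0"
    proof (rule AE_I2)
      fix x assume "x \<in> space ivl"
      then have "(\<lambda>n. (f n x - g x)\<^sup>2) \<longlonglongrightarrow> (g x - g x)\<^sup>2"
        by (intro tendsto_intros assms(4)) simp
      then show "(\<lambda>n. (f n x - g x)\<^sup>2) \<longlonglongrightarrow> 0" by simp
    qed
    show "AE x in ivl. norm ((f n x - g x)\<^sup>2) \<le> (2 * C)\<^sup>2" for n
    proof (rule AE_I2)
      fix x assume "x \<in> space ivl"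
      then have "\<bar>f n x - g x\<bar> \<le> 2 * C" using assms(3)[of x n] gC[of x] by force
      then show "norm ((f n x - g x)\<^sup>2) \<le> (2 * C)\<^sup>2"
        using abs_le_square_iff[of "f n x - g x" "2 * C"] by simp
    qed
  qed simp
  then have "(\<lambda>n. (norm (l2_of (f n) - l2_of g))\<^sup>2) \<longlonglongrightarrow> 0"
    using assms(1,2) by (simp add: l2_of_diff[symmetric] norm_l2_of_sq square_integrable_diff)
  then have "(\<lambda>n. sqrt ((norm (l2_of (f n) - l2_of g))\<^sup>2)) \<longlonglongrightarrow> sqrt 0"
    by (rule tendsto_real_sqrt)
  then show ?thesis by (simp add: tendsto_norm_zero_iff LIM_zero_iff)
qed

text \<open>Approximation by the products \<open>g \<cdot> \<rho>\<^sub>n\<close>, where the cutoff \<open>\<rho>\<^sub>n = r\<^sup>2/(r\<^sup>2 + a\<^sup>2)\<close> is built from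
  \<open>r = max 0 (x(\<pi> - x) - a)\<close> with \<open>a = 1/(n+1)\<close>. Its derivative is of order \<open>1/a\<close> near the boundary, where
  \<open>g\<close> is of order \<open>a\<close>; so \<open>g \<rho>\<^sub>n'\<close> stays bounded, and as it tends to \<open>0\<close> pointwise, dominated
  convergence applies to the derivatives.\<close>

lemma smooth_in_H01:
  assumes g: "\<And>x. (g has_real_derivative g' x) (at x)" "continuous_on UNIV g'"
    and C: "\<And>x. x \<in> {0..pi} \<Longrightarrow> \<bar>g x\<bar> \<le> C * (x * (pi - x))"
  shows "l2_of g \<in> H01" "weak_deriv (l2_of g) = l2_of g'"
proof -
  have cg: "continuous_on UNIV g"
    using g(1) by (intro continuous_at_imp_continuous_on ballI DERIV_isCont) auto
  obtain D where D: "\<And>x. x \<in> {0..pi} \<Longrightarrow> \<bar>g' x\<bar> \<le> D"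
  proof -
    have "compact (g' ` {0..pi})"
      by (intro compact_continuous_image continuous_on_subset[OF g(2)]) auto
    then have "bounded (g' ` {0..pi})" by (rule compact_imp_bounded)
    then obtain c where "\<forall>y\<in>g' ` {0..pi}. norm y \<le> c" by (auto simp: bounded_iff)
    then show ?thesis by (intro that[of c]) auto
  qed
  obtain B where B: "\<And>x. x \<in> {0..pi} \<Longrightarrow> \<bar>g x\<bar> \<le> B"
  proof -
    have "compact (g ` {0..pi})"
      by (intro compact_continuous_image continuous_on_subset[OF cg]) auto
    then have "bounded (g ` {0..pi})" by (rule compact_imp_bounded)
    then obtain c where "\<forall>y\<in>g ` {0..pi}. norm y \<le> c" by (auto simp: bounded_iff)
    then show ?thesis by (intro that[of c]) auto
  qed
  have C0: "C \<ge> 0"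
  proof -
    have "0 \<le> C * (1 * (pi - 1))" by (rule order_trans[OF _ C]) (use pi_gt3 in auto)
    then show ?thesis using pi_gt3 by (simp add: zero_le_mult_iff)
  qed
  define a where "a n = inverse (real (Suc n))" for n
  have a0: "a n > 0" for n by (simp add: a_def)
  have a_lim: "a \<longlonglongrightarrow> 0" unfolding a_def by (rule LIMSEQ_inverse_real_of_nat)
  define r where "r n x = max 0 (x * (pi - x) - a n)" for n x
  define \<rho> where "\<rho> n x = (r n x)\<^sup>2 / ((r n x)\<^sup>2 + (a n)\<^sup>2)" for n x
  define \<rho>' where "\<rho>' n x = 2 * r n x * (pi - 2 * x) * (a n)\<^sup>2 / ((r n x)\<^sup>2 + (a n)\<^sup>2)\<^sup>2" for n x
  have pos: "(r n x)\<^sup>2 + (a n)\<^sup>2 > 0" for n x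
    using a0[of n] by (simp add: add_nonneg_pos)
  have dr: "((\<lambda>x. (r n x)\<^sup>2) has_real_derivative 2 * r n x * (pi - 2 * x)) (at x)" for n x
  proof -
    have "((\<lambda>x. x * (pi - x) - a n) has_real_derivative (pi - 2 * x)) (at x)"
      by (auto intro!: derivative_eq_intros)
    from DERIV_chain2[OF DERIV_max_sq this] show ?thesis unfolding r_def .
  qed
  have d\<rho>: "(\<rho> n has_real_derivative \<rho>' n x) (at x)" for n x
  proof -
    have e: "\<rho> n = (\<lambda>x. (r n x)\<^sup>2 / ((r n x)\<^sup>2 + (a n)\<^sup>2))" by (auto simp: \<rho>_def)
    have nz: "(r n x)\<^sup>2 + (a n)\<^sup>2 \<noteq> 0" using pos[of n x] by (rule less_imp_neq[symmetric])
    have "(\<rho> n has_real_derivative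
        (2 * r n x * (pi - 2 * x) * ((r n x)\<^sup>2 + (a n)\<^sup>2) - (r n x)\<^sup>2 * (2 * r n x * (pi - 2 * x) + 0)) /
        (((r n x)\<^sup>2 + (a n)\<^sup>2) * ((r n x)\<^sup>2 + (a n)\<^sup>2))) (at x)"
      unfolding e by (rule DERIV_divide[OF dr DERIV_add[OF dr DERIV_const] nz])
    moreover have "2 * r n x * (pi - 2 * x) * ((r n x)\<^sup>2 + (a n)\<^sup>2) - (r n x)\<^sup>2 * (2 * r n x * (pi - 2 * x) + 0)
      = 2 * r n x * (pi - 2 * x) * (a n)\<^sup>2"
      by (simp add: algebra_simps)
    ultimately show ?thesis unfolding \<rho>'_def power2_eq_square[of "(r n x)\<^sup>2 + (a n)\<^sup>2"] by metis
  qed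
  have cr: "continuous_on UNIV (r n)" for n unfolding r_def by (intro continuous_intros)
  have c\<rho>: "continuous_on UNIV (\<rho> n)" "continuous_on UNIV (\<rho>' n)" for n
    unfolding \<rho>_def \<rho>'_def using pos[of n]
    by (intro continuous_intros cr; metis less_irrefl power_not_zero)+
  define \<psi> where "\<psi> n x = g x * \<rho> n x" for n x
  define \<psi>' where "\<psi>' n x = g' x * \<rho> n x + g x * \<rho>' n x" for n x
  have d\<psi>: "(\<psi> n has_real_derivative \<psi>' n x) (at x)" for n x
  proof -
    have e: "\<psi> n = (\<lambda>x. g x * \<rho> n x)" by (auto simp: \<psi>_def)
    show ?thesis unfolding e \<psi>'_def by (auto intro!: derivative_eq_intros g d\<rho>)
  qed
  have c\<psi>: "continuous_on UNIV (\<psi>' n)" for n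
    unfolding \<psi>'_def by (intro continuous_intros c\<rho> cg g)
  have \<psi>C: "\<psi> n \<in> C1c" for n
  proof (rule C1cI[OF d\<psi> c\<psi>, where a = "a n / 4" and b = "pi - a n / 4"])
    fix x assume x: "x \<notin> {a n / 4..pi - a n / 4}"
    have "x * (pi - x) \<le> a n"
    proof (cases "0 < x \<and> x < pi")
      case False
      then consider "x \<le> 0" "0 \<le> pi - x" | "pi - x \<le> 0" "0 \<le> x"
        using pi_gt_zero by linarith
      then have "x * (pi - x) \<le> 0"
        by cases (auto intro: mult_nonpos_nonneg mult_nonneg_nonpos)
      then show ?thesis using a0[of n] by linarith
    next
      case True
      show ?thesis
      proof (cases "x < a n / 4")
        case True2: True
        have "x * (pi - x) \<le> (a n / 4) * 4" using True True2 pi_less_4 by (intro mult_mono) auto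
        then show ?thesis by simp
      next
        case False
        then have "pi - x \<le> a n / 4" using x by auto
        then have "x * (pi - x) \<le> 4 * (a n / 4)" using True pi_less_4 by (intro mult_mono) auto
        then show ?thesis by simp
      qed
    qed
    then show "\<psi> n x = 0" by (simp add: \<psi>_def \<rho>_def r_def)
  qed (use a0[of n] in auto)
  have der: "deriv (\<psi> n) = \<psi>' n" for n
    using d\<psi> by (intro ext DERIV_imp_deriv)
  have \<rho>1: "0 \<le> \<rho> n x" "\<rho> n x \<le> 1" for n x
    using pos[of n x] by (auto simp: \<rho>_def divide_le_eq)
  have \<rho>'b: "\<bar>g x * \<rho>' n x\<bar> \<le> 2 * pi * C" if x: "x \<in> {0<..<pi}" for n x
  proof (cases "r n x = 0")
    case True then show ?thesis using C0 by (simp add: \<rho>'_def)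
  next
    case False
    then have rp: "r n x > 0" and rx: "x * (pi - x) = r n x + a n" by (auto simp: r_def max_def split: if_splits)
    define R A where "R = r n x" and "A = a n"
    have RA: "R > 0" "A > 0" using rp a0[of n] by (auto simp: R_def A_def)
    have "\<bar>g x * \<rho>' n x\<bar> = \<bar>g x\<bar> * (2 * R * \<bar>pi - 2 * x\<bar> * A\<^sup>2 / (R\<^sup>2 + A\<^sup>2)\<^sup>2)"
      using RA by (simp add: \<rho>'_def R_def A_def abs_mult)
    also have "\<dots> \<le> (C * (R + A)) * (2 * R * pi * A\<^sup>2 / (R\<^sup>2 + A\<^sup>2)\<^sup>2)"
    proof (rule mult_mono)
      show "\<bar>g x\<bar> \<le> C * (R + A)" using C[of x] x rx by (simp add: R_def A_def)
      show "2 * R * \<bar>pi - 2 * x\<bar> * A\<^sup>2 / (R\<^sup>2 + A\<^sup>2)\<^sup>2 \<le> 2 * R * pi * A\<^sup>2 / (R\<^sup>2 + A\<^sup>2)\<^sup>2"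
        using x RA by (intro divide_right_mono mult_right_mono mult_left_mono) auto
    qed (use C0 RA in auto)
    also have "\<dots> = 2 * pi * C * ((R + A) * R * A\<^sup>2 / (R\<^sup>2 + A\<^sup>2)\<^sup>2)" by simp
    also have "\<dots> \<le> 2 * pi * C * 1"
    proof (rule mult_left_mono)
      have "(R + A) * R * A\<^sup>2 \<le> (R\<^sup>2 + A\<^sup>2)\<^sup>2"
      proof -
        have "0 \<le> R^4 + R\<^sup>2 * A\<^sup>2 + A^4 - R * A^3"
        proof -
          have "0 \<le> (R * A - A\<^sup>2)\<^sup>2" "0 \<le> (R * A)\<^sup>2" "0 \<le> (A\<^sup>2)\<^sup>2" "0 \<le> (R\<^sup>2)\<^sup>2" by simp_all
          then show ?thesis by (simp add: power2_eq_square power3_eq_cube power4_eq_xxxx algebra_simps)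
        qed
        then show ?thesis by (simp add: power2_eq_square power3_eq_cube power4_eq_xxxx algebra_simps)
      qed
      then show "(R + A) * R * A\<^sup>2 / (R\<^sup>2 + A\<^sup>2)\<^sup>2 \<le> 1" using RA by (simp add: divide_le_eq add_pos_pos)
    qed (use C0 in auto)
    finally show ?thesis by simp
  qed
  have rlim: "(\<lambda>n. r n x) \<longlonglongrightarrow> x * (pi - x)" if x: "x \<in> {0<..<pi}" for x
  proof -
    have "(\<lambda>n. max 0 (x * (pi - x) - a n)) \<longlonglongrightarrow> max 0 (x * (pi - x) - 0)"
      by (intro tendsto_intros a_lim)
    then show ?thesis using x by (simp add: r_def)
  qed
  have ne: "(x * (pi - x))\<^sup>2 + 0\<^sup>2 \<noteq> 0" if "x \<in> {0<..<pi}" for x :: real using that by simp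
  have \<rho>lim: "(\<lambda>n. \<rho> n x) \<longlonglongrightarrow> 1" if x: "x \<in> {0<..<pi}" for x
  proof -
    have "(\<lambda>n. \<rho> n x) \<longlonglongrightarrow> (x * (pi - x))\<^sup>2 / ((x * (pi - x))\<^sup>2 + 0\<^sup>2)"
      unfolding \<rho>_def by (intro tendsto_intros rlim a_lim x ne)
    then show ?thesis using x by simp
  qed
  have \<rho>'lim: "(\<lambda>n. \<rho>' n x) \<longlonglongrightarrow> 0" if x: "x \<in> {0<..<pi}" for x
  proof -
    have "(\<lambda>n. \<rho>' n x) \<longlonglongrightarrow> 2 * (x * (pi - x)) * (pi - 2 * x) * 0\<^sup>2 / ((x * (pi - x))\<^sup>2 + 0\<^sup>2)\<^sup>2"
      unfolding \<rho>'_def by (intro tendsto_intros rlim a_lim x power_not_zero ne)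
    then show ?thesis by simp
  qed
  have l1: "(\<lambda>n. l2_of (\<psi> n)) \<longlonglongrightarrow> l2_of g"
  proof (rule l2_of_dominated_convergence)
    show "\<bar>\<psi> n x\<bar> \<le> B" if "x \<in> {0<..<pi}" for n x
      using B[of x] that \<rho>1[of n x] mult_mono[of "\<bar>g x\<bar>" B "\<rho> n x" 1] by (force simp: \<psi>_def abs_mult)
    show "(\<lambda>n. \<psi> n x) \<longlonglongrightarrow> g x" if "x \<in> {0<..<pi}" for x
      using tendsto_mult[OF tendsto_const[of "g x"] \<rho>lim[OF that]] by (simp add: \<psi>_def)
  qed (auto intro: square_integrable_C1c \<psi>C square_integrable_continuous cg)
  have l2: "(\<lambda>n. l2_of (\<psi>' n)) \<longlonglongrightarrow> l2_of g'"
  proof (rule l2_of_dominated_convergence)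
    show "\<bar>\<psi>' n x\<bar> \<le> D + 2 * pi * C" if "x \<in> {0<..<pi}" for n x
    proof -
      have "\<bar>g' x * \<rho> n x\<bar> \<le> D"
        using D[of x] that \<rho>1[of n x] mult_mono[of "\<bar>g' x\<bar>" D "\<rho> n x" 1] by (force simp: abs_mult)
      with \<rho>'b[OF that, of n] show ?thesis unfolding \<psi>'_def by linarith
    qed
    show "(\<lambda>n. \<psi>' n x) \<longlonglongrightarrow> g' x" if "x \<in> {0<..<pi}" for x
      using tendsto_add[OF tendsto_mult[OF tendsto_const[of "g' x"] \<rho>lim[OF that]]
        tendsto_mult[OF tendsto_const[of "g x"] \<rho>'lim[OF that]]] by (simp add: \<psi>'_def)
  qed (auto intro: square_integrable_continuous c\<psi> g)
  show "l2_of g \<in> H01" "weak_deriv (l2_of g) = l2_of g'"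
    using H01I_limit[of "\<lambda>n. l2_of (\<psi> n)", OF _ l1] C1c_in_H01[OF \<psi>C] l2 by (auto simp: der)
qed

lemma sin_bound: "x \<in> {0..pi} \<Longrightarrow> \<bar>sin (real k * x)\<bar> \<le> real k * (x * (pi - x))"
proof -
  assume x: "x \<in> {0..pi}"
  have s: "\<bar>sin (real k * y)\<bar> \<le> real k * y" if "y \<ge> 0" for y
    using abs_sin_x_le_abs_x[of "real k * y"] that by simp
  have e: "\<bar>sin (real k * x)\<bar> = \<bar>sin (real k * (pi - x))\<bar>"
  proof -
    have "sin (real k * (pi - x)) = sin (real k * pi - real k * x)" by (simp add: algebra_simps)
    also have "\<dots> = - cos (real k * pi) * sin (real k * x)" by (simp add: sin_diff)
    finally show ?thesis by (simp add: abs_mult)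
  qed
  have p: "pi > 3" by (rule pi_gt3)
  show ?thesis
  proof (cases "x \<le> pi / 2")
    case True
    have "x * 1 \<le> x * (pi - x)" using True x p by (intro mult_left_mono) auto
    then have "real k * x \<le> real k * (x * (pi - x))" by (intro mult_left_mono) auto
    then show ?thesis using s[of x] x by auto
  next
    case False
    have "1 * (pi - x) \<le> x * (pi - x)" using False x p by (intro mult_right_mono) auto
    then have "real k * (pi - x) \<le> real k * (x * (pi - x))" by (intro mult_left_mono) auto
    then show ?thesis using s[of "pi - x"] x e by auto
  qed
qed

lemma sinL_H01: "sinL k \<in> H01" "weak_deriv (sinL k) = real k *\<^sub>R cosL k"
proof -
  have "l2_of (\<lambda>x. real k * cos (real k * x)) = real k *\<^sub>R cosL k"
    unfolding cosL_def by (rule l2_of_scale) (rule square_integrable_trig)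
  moreover have "sinL k \<in> H01 \<and> weak_deriv (sinL k) = l2_of (\<lambda>x. real k * cos (real k * x))"
    unfolding sinL_def
    by (intro conjI smooth_in_H01[of _ "\<lambda>x. real k * cos (real k * x)" "real k"] sin_bound)
       (auto intro!: derivative_eq_intros continuous_intros)
  ultimately show "sinL k \<in> H01" "weak_deriv (sinL k) = real k *\<^sub>R cosL k" by auto
qed

lemma emb_sinH [simp]: "emb (sinH k) = sinL k"
  by (simp add: sinH_def Abs_h01_inverse sinL_H01)

lemma dx_sinH [simp]: "dx (sinH k) = real k *\<^sub>R cosL k"
  by (simp add: dx_def sinL_H01)


section \<open>Strongly continuous semigroups\<close>

text \<open>The principle of uniform boundedness, by the gliding hump method. If the operator norms are
  unbounded, pick operators of norm above \<open>4\<^sup>k\<close> and build a point by successive steps of length \<open>3\<^bsup>-k\<^esup>\<close>,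
  the sign of the step being chosen such that the \<open>k\<close>-th operator is large after it. The later steps add
  up to at most half of the \<open>k\<close>-th step, hence cannot undo this, and the orbit of the limit point is
  unbounded.\<close>

lemma uniform_boundedness_sequence:
  fixes T :: "nat \<Rightarrow> 'a::banach \<Rightarrow> 'b::real_normed_vector"
  assumes bl: "\<And>n. bounded_linear (T n)" and pw: "\<And>x. \<exists>B. \<forall>n. norm (T n x) \<le> B"
  shows "\<exists>M. \<forall>n. onorm (T n) \<le> M"
proof (rule ccontr)
  assume "\<not> ?thesis"
  then have "\<exists>n. onorm (T n) > 4 ^ k" for k :: nat by (metis not_le)
  then obtain n where n: "\<And>k. onorm (T (n k)) > 4 ^ k" by metis
  \<comment> \<open>The factor \<open>2/3\<close> only has to lie between \<open>1/2\<close>, the bound for the later steps, and \<open>1\<close>.\<close>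
  have "\<exists>y. norm y = (1/3)^k \<and> norm (T (n k) y) \<ge> 2/3 * onorm (T (n k)) * (1/3)^k" for k
  proof -
    have o: "onorm (T (n k)) > 0" by (rule less_trans[OF _ n]) simp
    have "\<exists>x. norm (T (n k) x) > 2/3 * onorm (T (n k)) * norm x"
    proof (rule ccontr)
      assume "\<not> ?thesis"
      then have "\<And>x. norm (T (n k) x) \<le> 2/3 * onorm (T (n k)) * norm x" by (simp add: not_less)
      then have "onorm (T (n k)) \<le> 2/3 * onorm (T (n k))" by (intro onorm_bound) (use o in auto)
      then show False using o by simp
    qed
    then obtain x where x: "norm (T (n k) x) > 2/3 * onorm (T (n k)) * norm x" by blast
    then have "x \<noteq> 0" using linear_0[OF bounded_linear.linear[OF bl]] by auto
    then have nx: "norm x > 0" by simp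
    define c where "c = (1/3)^k / norm x"
    have c: "c > 0" using nx by (simp add: c_def)
    have "norm (c *\<^sub>R x) = (1/3)^k" using nx by (simp add: c_def)
    moreover have "norm (T (n k) (c *\<^sub>R x)) \<ge> 2/3 * onorm (T (n k)) * (1/3)^k"
    proof -
      have "norm (T (n k) (c *\<^sub>R x)) = c * norm (T (n k) x)"
        using c by (simp add: linear_cmul[OF bounded_linear.linear[OF bl]])
      also have "\<dots> \<ge> c * (2/3 * onorm (T (n k)) * norm x)"
        using x c by (intro mult_left_mono) auto
      also have "c * (2/3 * onorm (T (n k)) * norm x) = 2/3 * onorm (T (n k)) * (1/3)^k"
        using nx by (simp add: c_def)
      finally show ?thesis .
    qed
    ultimately show ?thesis by blast
  qed
  then obtain y where y: "\<And>k. norm (y k) = (1/3)^k" "\<And>k. norm (T (n k) (y k)) \<ge> 2/3 * onorm (T (n k)) * (1/3)^k"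
    by metis
  define x where "x = rec_nat 0 (\<lambda>k z. if norm (T (n k) (z + y k)) \<ge> norm (T (n k) (z - y k)) then z + y k else z - y k)"
  have xS: "x (Suc k) = (if norm (T (n k) (x k + y k)) \<ge> norm (T (n k) (x k - y k)) then x k + y k else x k - y k)" for k
    by (simp add: x_def)
  have Tx: "norm (T (n k) (x (Suc k))) \<ge> norm (T (n k) (y k))" for k
  proof -
    have "2 *\<^sub>R T (n k) (y k) = T (n k) (x k + y k) - T (n k) (x k - y k)"
      by (simp add: linear_add linear_diff bounded_linear.linear[OF bl] scaleR_2)
    then have "2 * norm (T (n k) (y k)) \<le> norm (T (n k) (x k + y k)) + norm (T (n k) (x k - y k))"
      by (metis norm_scaleR norm_triangle_ineq4 abs_numeral)
    then show ?thesis by (auto simp: xS)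
  qed
  have dx: "norm (x (Suc k) - x k) = (1/3)^k" for k by (simp add: xS y)
  have "summable (\<lambda>k. x (Suc k) - x k)"
    by (rule summable_comparison_test'[of "\<lambda>k. (1/3)^k" 0]) (simp_all add: dx)
  then have "convergent (\<lambda>m. \<Sum>k<m. x (Suc k) - x k)" by (simp add: summable_iff_convergent)
  then have "convergent (\<lambda>m. x m - x 0)" unfolding sum_lessThan_telescope .
  then obtain X where X: "x \<longlonglongrightarrow> X"
    by (auto simp: x_def convergent_def)
  obtain B where B: "\<And>m. norm (T m X) \<le> B" using pw by blast
  have tail: "norm (X - x (Suc k)) \<le> 1/2 * (1/3)^k" for k
  proof (rule norm_sums_le)
    show "(\<lambda>j. x (Suc (j + Suc k)) - x (j + Suc k)) sums (X - x (Suc k))"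
      using telescope_sums[of "\<lambda>j. x (j + Suc k)" X] LIMSEQ_ignore_initial_segment[OF X, of "Suc k"] by simp
    have "(\<lambda>j. (1/3)^Suc k * (1/3)^j) sums ((1/3)^Suc k * (1 / (1 - 1/3 :: real)))"
      by (intro sums_mult geometric_sums) simp
    then show "(\<lambda>j. (1/3)^(j + Suc k)) sums (1/2 * (1/3 :: real)^k)"
      by (simp add: power_add mult_ac)
    show "norm (x (Suc (j + Suc k)) - x (j + Suc k)) \<le> (1/3)^(j + Suc k)" for j
      using dx[of "j + Suc k"] by simp
  qed
  have "(4/3)^k \<le> 6 * B" for k
  proof -
    have "norm (T (n k) (X - x (Suc k))) \<le> onorm (T (n k)) * (1/2 * (1/3)^k)"
      by (rule order_trans[OF onorm[OF bl]]) (intro mult_left_mono tail onorm_pos_le bl)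
    moreover have "norm (T (n k) (x (Suc k))) - norm (T (n k) (X - x (Suc k))) \<le> norm (T (n k) X)"
      using norm_triangle_ineq2[of "T (n k) (x (Suc k))" "- T (n k) (X - x (Suc k))"]
      by (simp add: linear_diff bounded_linear.linear[OF bl] norm_minus_commute)
    ultimately have "1/6 * (onorm (T (n k)) * (1/3)^k) \<le> B"
      using Tx[of k] y(2)[of k] B[of "n k"] by (simp add: mult_ac)
    moreover have "4^k * (1/3)^k \<le> onorm (T (n k)) * (1/3)^k"
      using n[of k] by (intro mult_right_mono) auto
    moreover have "(4::real)^k * (1/3)^k = (4/3)^k" by (simp add: power_mult_distrib[symmetric])
    ultimately show ?thesis by simp
  qed
  moreover obtain k where "(4/3 :: real)^k > 6 * B" using real_arch_pow[of "4/3" "6 * B"] by auto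
  ultimately show False by (metis not_le)
qed

context
  fixes S :: "real \<Rightarrow> 'a::banach \<Rightarrow> 'a"
  assumes S: "C0_semigroup S"
begin

lemma semigroup_linear: "t \<ge> 0 \<Longrightarrow> bounded_linear (S t)"
  and semigroup_0 [simp]: "S 0 x = x"
  and semigroup_add: "s \<ge> 0 \<Longrightarrow> t \<ge> 0 \<Longrightarrow> S (s + t) x = S s (S t x)"
  and semigroup_tendsto: "((\<lambda>t. S t x) \<longlongrightarrow> x) (at_right 0)"
  using S by (auto simp: C0_semigroup_def)

lemma semigroup_near_0:
  assumes "e > 0" obtains d where "d > 0" "\<And>t. 0 \<le> t \<Longrightarrow> t < d \<Longrightarrow> norm (S t x - x) < e"
proof -
  have "\<forall>\<^sub>F t in at_right 0. dist (S t x) x < e"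
    using semigroup_tendsto assms by (rule tendstoD)
  then obtain d where "d > 0" "\<And>t. 0 < t \<Longrightarrow> t < d \<Longrightarrow> norm (S t x - x) < e"
    by (auto simp: eventually_at_right_field dist_norm)
  then show ?thesis using that[of d] assms by (metis order_le_less semigroup_0 diff_self norm_zero)
qed

text \<open>Otherwise some sequence \<open>S(t\<^sub>n)\<close> with \<open>t\<^sub>n \<rightarrow> 0\<close> has unbounded norms, although it converges pointwise to
  the identity.\<close>

lemma semigroup_bounded_near_0: "\<exists>d>0. \<exists>M. \<forall>t. 0 \<le> t \<and> t \<le> d \<longrightarrow> onorm (S t) \<le> M"
proof (rule ccontr)
  assume "\<not> ?thesis"
  then have "\<forall>n::nat. \<exists>t. 0 \<le> t \<and> t \<le> inverse (real (Suc n)) \<and> onorm (S t) > real n"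
    by (meson not_le inverse_positive_iff_positive of_nat_0_less_iff zero_less_Suc)
  then obtain t where t: "\<And>n. 0 \<le> t n" "\<And>n. t n \<le> inverse (real (Suc n))" "\<And>n. onorm (S (t n)) > real n"
    by metis
  have "\<exists>M. \<forall>n. onorm (S (t n)) \<le> M"
  proof (rule uniform_boundedness_sequence)
    fix x
    obtain d where d: "d > 0" "\<And>t. 0 \<le> t \<Longrightarrow> t < d \<Longrightarrow> norm (S t x - x) < 1"
      using semigroup_near_0[of 1 x] by auto
    obtain N where N: "inverse (real (Suc N)) < d" using reals_Archimedean[OF d(1)] by blast
    define B where "B = (\<Sum>n<N. norm (S (t n) x)) + (norm x + 1)"
    have "norm (S (t n) x) \<le> B" for n
    proof (cases "n < N")
      case True
      then have "norm (S (t n) x) \<le> (\<Sum>n<N. norm (S (t n) x))" by (intro member_le_sum) auto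
      then show ?thesis unfolding B_def using norm_ge_zero[of x] by linarith
    next
      case False
      then have "inverse (real (Suc n)) \<le> inverse (real (Suc N))" by simp
      then have "norm (S (t n) x - x) < 1" using d(2)[OF t(1)[of n]] t(2)[of n] N by linarith
      moreover have "(\<Sum>n<N. norm (S (t n) x)) \<ge> 0" by (intro sum_nonneg) auto
      ultimately show ?thesis unfolding B_def using norm_triangle_ineq2[of "S (t n) x" x] by linarith
    qed
    then show "\<exists>B. \<forall>n. norm (S (t n) x) \<le> B" by blast
  qed (use t semigroup_linear in auto)
  then obtain M where M: "\<And>n. onorm (S (t n)) \<le> M" by blast
  obtain n where "M \<le> real n" using real_arch_simple by blast
  then show False using M[of n] t(3)[of n] by linarith
qed

lemma semigroup_locally_bounded:
  obtains M where "\<And>t x. 0 \<le> t \<Longrightarrow> t \<le> T \<Longrightarrow> norm (S t x) \<le> M * norm x" "M \<ge> 0"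
proof -
  obtain d M where d: "d > 0" and M: "\<And>t. 0 \<le> t \<Longrightarrow> t \<le> d \<Longrightarrow> onorm (S t) \<le> M"
    using semigroup_bounded_near_0 by blast
  define L where "L = max 1 M"
  have L: "norm (S t x) \<le> L * norm x" if "0 \<le> t" "t \<le> d" for t x
  proof -
    have "norm (S t x) \<le> onorm (S t) * norm x" by (rule onorm[OF semigroup_linear[OF that(1)]])
    also have "\<dots> \<le> L * norm x" using M[OF that] by (intro mult_right_mono) (auto simp: L_def)
    finally show ?thesis .
  qed
  have L1: "L \<ge> 1" by (simp add: L_def)
  have "norm (S t x) \<le> L ^ Suc n * norm x" if "0 \<le> t" "t \<le> real (Suc n) * d" for n t x
    using that
  proof (induction n arbitrary: t)
    case 0 then show ?case using L by simp
  next
    case (Suc n)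
    show ?case
    proof (cases "t \<le> d")
      case True
      have "L * norm x \<le> L ^ Suc (Suc n) * norm x"
        using L1 power_increasing[of 1 "Suc (Suc n)" L] by (intro mult_right_mono) auto
      then show ?thesis using L[of t x] True Suc by linarith
    next
      case False
      have "norm (S t x) = norm (S d (S (t - d) x))" using semigroup_add[of d "t - d" x] False d by simp
      also have "\<dots> \<le> L * norm (S (t - d) x)" using L d by simp
      also have "\<dots> \<le> L * (L ^ Suc n * norm x)"
        using Suc False L1 by (intro mult_left_mono Suc.IH) (auto simp: algebra_simps)
      finally show ?thesis by simp
    qed
  qed
  moreover obtain n :: nat where "T / d \<le> real n" using real_arch_simple by blast
  then have "T \<le> real (Suc n) * d" using d by (simp add: field_simps)
  ultimately have "\<And>t x. 0 \<le> t \<Longrightarrow> t \<le> T \<Longrightarrow> norm (S t x) \<le> L ^ Suc n * norm x" by force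
  then show ?thesis using L1 by (intro that[of "L ^ Suc n"]) auto
qed

lemma continuous_on_semigroup: "continuous_on {0..} (\<lambda>t. S t x)"
  unfolding continuous_on_iff
proof (intro ballI allI impI)
  fix t e :: real assume t: "t \<in> {0..}" and "e > 0"
  obtain M where M: "\<And>s x. 0 \<le> s \<Longrightarrow> s \<le> t + 1 \<Longrightarrow> norm (S s x) \<le> M * norm x" "M \<ge> 0"
    using semigroup_locally_bounded[of "t + 1"] by blast
  obtain d where d: "d > 0" "\<And>s. 0 \<le> s \<Longrightarrow> s < d \<Longrightarrow> norm (S s x - x) < e / (M + 1)"
    using semigroup_near_0[of "e / (M + 1)" x] M \<open>e > 0\<close> by auto
  have *: "norm (S (s + h) x - S s x) < e" if "0 \<le> s" "0 \<le> h" "s \<le> t + 1" "h < d" for s h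
  proof -
    have "S (s + h) x - S s x = S s (S h x - x)"
      using that semigroup_add linear_diff[OF bounded_linear.linear[OF semigroup_linear]] by simp
    then have "norm (S (s + h) x - S s x) \<le> M * norm (S h x - x)" using M that by simp
    also have "\<dots> \<le> M * (e / (M + 1))" using d that M by (intro mult_left_mono) (auto intro: less_imp_le)
    also have "\<dots> < e" using M \<open>e > 0\<close> by (simp add: field_simps)
    finally show ?thesis .
  qed
  have "dist (S t' x) (S t x) < e" if "t' \<in> {0..}" "dist t' t < min d 1" for t'
  proof (cases "t \<le> t'")
    case True
    then show ?thesis using *[of t "t' - t"] that t by (simp add: dist_norm)
  next
    case False
    then show ?thesis using *[of t' "t - t'"] that t by (simp add: dist_norm norm_minus_commute)
  qed
  then show "\<exists>d>0. \<forall>t'\<in>{0..}. dist t' t < d \<longrightarrow> dist (S t' x) (S t x) < e"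
    using d(1) by (intro exI[of _ "min d 1"]) auto
qed

text \<open>The generator is defined by right difference quotients. For the derivative from the left, write
  \<open>S(t - h) x - S(t) x = - S(t - h)(S(h) x - x)\<close> and use local boundedness and strong continuity.\<close>

lemma semigroup_generator_deriv:
  assumes g: "(x, y) \<in> generator S" and t: "t \<ge> 0"
  shows "((\<lambda>s. S s x) has_vector_derivative S t y) (at t within {0..})"
  unfolding has_vector_derivative_def
proof (subst has_derivative_within_alt2, intro conjI allI impI)
  show "bounded_linear (\<lambda>h. h *\<^sub>R S t y)" by (rule bounded_linear_scaleR_left)
  fix e :: real assume "e > 0"
  obtain M where M: "\<And>s x. 0 \<le> s \<Longrightarrow> s \<le> t + 1 \<Longrightarrow> norm (S s x) \<le> M * norm x" "M \<ge> 0"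
    using semigroup_locally_bounded[of "t + 1"] by blast
  define e' where "e' = e / (2 * (M + 1))"
  have e': "e' > 0" "M * e' \<le> e / 2" using M \<open>e > 0\<close> by (auto simp: e'_def field_simps)
  have "\<forall>\<^sub>F h in at_right 0. dist ((1 / h) *\<^sub>R (S h x - x)) y < e'"
    using g e' unfolding generator_def by (auto dest: tendstoD)
  then obtain d where d: "d > 0" and d1: "\<And>h. 0 < h \<Longrightarrow> h < d \<Longrightarrow> norm ((1 / h) *\<^sub>R (S h x - x) - y) < e'"
    by (auto simp: eventually_at_right_field dist_norm)
  have d2: "norm (S h x - x - h *\<^sub>R y) \<le> e' * h" if "0 < h" "h < d" for h
  proof -
    have "S h x - x - h *\<^sub>R y = h *\<^sub>R ((1 / h) *\<^sub>R (S h x - x) - y)" using that by (simp add: scaleR_diff_right)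
    then have "norm (S h x - x - h *\<^sub>R y) = h * norm ((1 / h) *\<^sub>R (S h x - x) - y)" using that by simp
    then show ?thesis using mult_left_mono[OF less_imp_le[OF d1[OF that]], of h] that by (simp add: mult.commute)
  qed
  obtain d3 where d3: "d3 > 0" "\<And>t'. t' \<in> {0..} \<Longrightarrow> dist t' t < d3 \<Longrightarrow> dist (S t' y) (S t y) < e / 2"
    using continuous_on_semigroup[of y] t \<open>e > 0\<close> unfolding continuous_on_iff
    by (metis atLeast_iff half_gt_zero)
  have lin: "linear (S s)" if "s \<ge> 0" for s using semigroup_linear[OF that] by (rule bounded_linear.linear)
  have main: "norm (S t' x - S t x - (t' - t) *\<^sub>R S t y) \<le> e * norm (t' - t)"
    if t': "t' \<in> {0..}" "dist t' t < min d (min d3 1)" for t'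
  proof -
    consider "t' = t" | "t' > t" | "t' < t" by linarith
    then show ?thesis
    proof cases
      case 2
      define h where "h = t' - t"
      have h: "0 < h" "h < d" "t' = t + h" using 2 that by (auto simp: h_def dist_norm)
      have "S t' x - S t x - (t' - t) *\<^sub>R S t y = S t (S h x - x - h *\<^sub>R y)"
        using h t by (simp add: semigroup_add linear_diff linear_cmul lin)
      then have "norm (S t' x - S t x - (t' - t) *\<^sub>R S t y) \<le> M * norm (S h x - x - h *\<^sub>R y)" using M t by simp
      also have "\<dots> \<le> M * (e' * h)" using M h by (intro mult_left_mono d2) auto
      also have "\<dots> \<le> e / 2 * h" using e' h mult_right_mono[of "M * e'" "e / 2" h] by (simp add: mult.assoc)
      also have "\<dots> \<le> e * norm (t' - t)" using h \<open>e > 0\<close> by simp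
      finally show ?thesis .
    next
      case 3
      define h where "h = t - t'"
      have h: "0 < h" "h < d" "t = t' + h" "t' \<ge> 0" "t' \<le> t + 1" using 3 that by (auto simp: h_def dist_norm)
      have "S t' x - S t x - (t' - t) *\<^sub>R S t y = - S t' (S h x - x - h *\<^sub>R y) + h *\<^sub>R (S t y - S t' y)"
        using h by (simp add: semigroup_add linear_diff linear_cmul lin scaleR_diff_right)
      then have "norm (S t' x - S t x - (t' - t) *\<^sub>R S t y) \<le> norm (S t' (S h x - x - h *\<^sub>R y)) + h * norm (S t y - S t' y)"
        using norm_triangle_ineq[of "- S t' (S h x - x - h *\<^sub>R y)" "h *\<^sub>R (S t y - S t' y)"] h by simp
      also have "norm (S t' (S h x - x - h *\<^sub>R y)) \<le> M * norm (S h x - x - h *\<^sub>R y)" using M h by simp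
      also have "M * norm (S h x - x - h *\<^sub>R y) \<le> M * (e' * h)" using M h by (intro mult_left_mono d2) auto
      also have "M * (e' * h) \<le> e / 2 * h" using e' h mult_right_mono[of "M * e'" "e / 2" h] by (simp add: mult.assoc)
      also have "h * norm (S t y - S t' y) \<le> h * (e / 2)"
        using d3(2)[of t'] that h by (intro mult_left_mono) (auto simp: dist_norm norm_minus_commute)
      also have "e / 2 * h + h * (e / 2) = e * norm (t' - t)" using h by simp
      finally show ?thesis by simp
    qed simp
  qed
  show "\<forall>\<^sub>F y' in at t within {0..}. norm (S y' x - S t x - (y' - t) *\<^sub>R S t y) \<le> e * norm (y' - t)"
    unfolding eventually_at using main d d3 by (intro exI[of _ "min d (min d3 1)"]) auto
qed

lemma semigroup_generator_invariant:
  assumes g: "(x, y) \<in> generator S" and t: "t \<ge> 0"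
  shows "(S t x, S t y) \<in> generator S"
proof -
  have "((\<lambda>h. S t ((1 / h) *\<^sub>R (S h x - x))) \<longlongrightarrow> S t y) (at_right 0)"
    using g by (intro bounded_linear.tendsto[OF semigroup_linear[OF t]]) (simp add: generator_def)
  moreover have "\<forall>\<^sub>F h in at_right 0. S t ((1 / h) *\<^sub>R (S h x - x)) = (1 / h) *\<^sub>R (S h (S t x) - S t x)"
  proof (rule eventually_at_rightI[of 0 1])
    fix h :: real assume "h \<in> {0<..<1}"
    then have "S t (S h x) = S h (S t x)"
      using semigroup_add[of t h x] semigroup_add[of h t x] t by (simp add: add.commute)
    then show "S t ((1 / h) *\<^sub>R (S h x - x)) = (1 / h) *\<^sub>R (S h (S t x) - S t x)"
      by (simp add: linear_diff linear_cmul bounded_linear.linear[OF semigroup_linear[OF t]])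
  qed simp
  ultimately show ?thesis
    unfolding generator_def by (simp add: tendsto_cong)
qed

text \<open>The mean values \<open>(1/h) \<integral>\<^sub>0\<^sup>h S(s) x ds\<close> lie in the domain of the generator and tend to \<open>x\<close>.\<close>

lemma semigroup_generator_dense:
  assumes "e > 0"
  obtains z w where "(z, w) \<in> generator S" "norm (z - x) < e"
proof -
  obtain d where d: "d > 0" "\<And>s. 0 \<le> s \<Longrightarrow> s < d \<Longrightarrow> norm (S s x - x) < e / 2"
    using semigroup_near_0[of "e / 2" x] assms by auto
  define h where "h = d / 2"
  have h: "h > 0" "h < d" using d by (auto simp: h_def)
  have int: "(\<lambda>s. S s x) integrable_on {a..b}" if "0 \<le> a" for a b
    using that by (intro integrable_continuous_interval continuous_on_subset[OF continuous_on_semigroup]) auto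
  define I where "I t = integral {0..t} (\<lambda>s. S s x)" for t
  have dI: "(I has_vector_derivative S t x) (at t within {0..h + 1})" if "t \<in> {0..h + 1}" for t
    unfolding I_def
    by (rule integral_has_vector_derivative) (use that continuous_on_subset[OF continuous_on_semigroup] in auto)
  have I0: "I 0 = 0" by (simp add: I_def)
  have SI: "S r (I h) = I (h + r) - I r" if r: "0 \<le> r" for r
  proof -
    have "S r (I h) = integral {0..h} (\<lambda>s. S r (S s x))"
      unfolding I_def using integral_linear[OF int semigroup_linear[OF r], of 0 h] by (simp add: o_def)
    also have "\<dots> = integral {0..h} (\<lambda>s. S (s + r) x)"
      by (rule integral_cong) (metis add.commute atLeastAtMost_iff r semigroup_add)
    also have "\<dots> = integral {r..h + r} (\<lambda>s. S s x)"
      using integral_shift_real_ivl[of r r "h + r" "\<lambda>s. S s x"] by simp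
    also have "\<dots> = I (h + r) - I r"
      unfolding I_def using Henstock_Kurzweil_Integration.integral_combine[of 0 r "h + r" "\<lambda>s. S s x"] int r h
      by (simp add: eq_diff_eq add.commute)
    finally show ?thesis .
  qed
  have rd: "((\<lambda>r. (1 / r) *\<^sub>R (I (t + r) - I t)) \<longlongrightarrow> S t x) (at_right 0)" if t: "0 \<le> t" "t \<le> h" for t
  proof -
    let ?F = "\<lambda>y. (1 / norm (y - t)) *\<^sub>R (I y - (I t + (y - t) *\<^sub>R S t x))"
    have "(?F \<longlongrightarrow> 0) (at t within {0..h+1})"
      using dI[of t] t by (simp add: has_vector_derivative_def has_derivative_within)
    moreover have "filterlim (\<lambda>r. t + r) (at t within {0..h+1}) (at_right 0)"
      unfolding filterlim_at
    proof
      show "\<forall>\<^sub>F r in at_right 0. t + r \<in> {0..h+1} \<and> t + r \<noteq> t"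
        by (rule eventually_at_rightI[of 0 1]) (use t in auto)
      have "((\<lambda>r. t + r) \<longlongrightarrow> t + 0) (at_right 0)" by (intro tendsto_intros)
      then show "((\<lambda>r. t + r) \<longlongrightarrow> t) (at_right 0)" by simp
    qed
    ultimately have "((\<lambda>r. ?F (t + r)) \<longlongrightarrow> 0) (at_right 0)" by (rule filterlim_compose)
    then have "((\<lambda>r. ?F (t + r) + S t x) \<longlongrightarrow> 0 + S t x) (at_right 0)" by (intro tendsto_intros)
    moreover have "\<forall>\<^sub>F r in at_right 0. ?F (t + r) + S t x = (1 / r) *\<^sub>R (I (t + r) - I t)"
      by (rule eventually_at_rightI[of 0 1]) (auto simp: algebra_simps)
    ultimately show ?thesis by (simp add: tendsto_cong)
  qed
  have "((\<lambda>r. (1 / r) *\<^sub>R (I (h + r) - I h) - (1 / r) *\<^sub>R (I (0 + r) - I 0)) \<longlongrightarrow> S h x - S 0 x) (at_right 0)"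
    by (intro tendsto_diff rd) (use h in auto)
  moreover have "\<forall>\<^sub>F r in at_right 0. (1 / r) *\<^sub>R (I (h + r) - I h) - (1 / r) *\<^sub>R (I (0 + r) - I 0) = (1 / r) *\<^sub>R (S r (I h) - I h)"
    by (rule eventually_at_rightI[of 0 1])
       (use I0 in \<open>auto simp: SI algebra_simps\<close>)
  ultimately have gI: "(I h, S h x - S 0 x) \<in> generator S"
    unfolding generator_def by (simp add: tendsto_cong)
  have "norm ((1 / h) *\<^sub>R I h - x) \<le> e / 2"
  proof -
    have "(1 / h) *\<^sub>R I h - x = (1 / h) *\<^sub>R (integral {0..h} (\<lambda>s. S s x) - integral {0..h} (\<lambda>s. x))"
      using h by (simp add: I_def algebra_simps)
    also have "integral {0..h} (\<lambda>s. S s x) - integral {0..h} (\<lambda>s. x) = integral {0..h} (\<lambda>s. S s x - x)"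
      using int by (subst Henstock_Kurzweil_Integration.integral_diff) auto
    finally have "norm ((1 / h) *\<^sub>R I h - x) = (1 / h) * norm (integral {0..h} (\<lambda>s. S s x - x))"
      using h by simp
    also have "(1 / h) * norm (integral {0..h} (\<lambda>s. S s x - x)) \<le> (1 / h) * integral {0..h} (\<lambda>s. e / 2)"
      using h d by (intro mult_left_mono integral_norm_bound_integral integrable_diff int) (auto intro: less_imp_le)
    finally show ?thesis using h by simp
  qed
  then have "norm ((1 / h) *\<^sub>R I h - x) < e" using assms by linarith
  moreover have "((1 / h) *\<^sub>R I h, (1 / h) *\<^sub>R (S h x - S 0 x)) \<in> generator S"
  proof -
    have "((\<lambda>t. (1 / h) *\<^sub>R ((1 / t) *\<^sub>R (S t (I h) - I h))) \<longlongrightarrow> (1 / h) *\<^sub>R (S h x - S 0 x)) (at_right 0)"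
      using gI by (intro tendsto_intros) (simp add: generator_def)
    moreover have "\<forall>\<^sub>F t in at_right 0. (1 / h) *\<^sub>R ((1 / t) *\<^sub>R (S t (I h) - I h)) = (1 / t) *\<^sub>R (S t ((1 / h) *\<^sub>R I h) - (1 / h) *\<^sub>R I h)"
      by (rule eventually_at_rightI[of 0 1])
         (auto simp: linear_cmul bounded_linear.linear[OF semigroup_linear] scaleR_diff_right mult.commute)
    ultimately show ?thesis unfolding generator_def by (simp add: tendsto_cong)
  qed
  ultimately show ?thesis by (rule that[rotated])
qed

text \<open>An eigenvector of the adjoint generator, stated without the adjoint: on the domain of the generator
  \<open>l(S(t) x)\<close> solves \<open>y' = c y\<close>, and both sides are continuous in \<open>x\<close>.\<close>

lemma semigroup_eigenfunctional:
  fixes l :: "'a \<Rightarrow> real"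
  assumes l: "bounded_linear l" and eig: "\<And>x y. (x, y) \<in> generator S \<Longrightarrow> l y = c * l x" and t: "t \<ge> 0"
  shows "l (S t x) = exp (c * t) * l x"
proof -
  have D: "l (S t x) = exp (c * t) * l x" if g: "(x, y) \<in> generator S" for x y
  proof (cases "t = 0")
    case False
    then have t0: "0 < t" using t by simp
    define f where "f s = exp (- c * s) * l (S s x)" for s
    have df: "(f has_real_derivative 0) (at s within {0..})" if "s \<ge> 0" for s
    proof -
      have "((\<lambda>s. l (S s x)) has_vector_derivative l (S s y)) (at s within {0..})"
        by (rule bounded_linear.has_vector_derivative[OF l semigroup_generator_deriv[OF g that]])
      then have "((\<lambda>s. l (S s x)) has_real_derivative c * l (S s x)) (at s within {0..})"
        using eig[OF semigroup_generator_invariant[OF g that]] by (simp add: has_real_derivative_iff_has_vector_derivative)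
      then show ?thesis unfolding f_def
        by (auto intro!: derivative_eq_intros)
    qed
    have "\<exists>k. \<forall>s\<in>{0..}. f s = k"
      by (rule has_field_derivative_zero_constant) (use df in auto)
    then have "f t = f 0" using t by force
    then show ?thesis by (simp add: f_def exp_minus field_simps)
  qed simp
  define m where "m x = l (S t x) - exp (c * t) * l x" for x
  have m: "bounded_linear m" unfolding m_def
    using bounded_linear_compose[OF l semigroup_linear[OF t]] bounded_linear_const_mult[OF l] by (intro bounded_linear_sub)
  obtain K where K: "K > 0" "\<And>x. norm (m x) \<le> norm x * K" using bounded_linear.pos_bounded[OF m] by blast
  have "\<bar>m x\<bar> \<le> 0"
  proof (rule field_le_epsilon)
    fix e :: real assume "e > 0"
    then obtain z w where z: "(z, w) \<in> generator S" "norm (z - x) < e / K"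
      using semigroup_generator_dense[of "e / K" x] K by auto
    have "m z = 0" using D[OF z(1)] by (simp add: m_def)
    then have "m x = - m (z - x)" by (simp add: linear_diff bounded_linear.linear[OF m])
    then have "\<bar>m x\<bar> \<le> norm (z - x) * K" using K(2)[of "z - x"] by simp
    also have "\<dots> \<le> e" using z K by (simp add: field_simps less_imp_le)
    finally show "\<bar>m x\<bar> \<le> 0 + e" by simp
  qed
  then show ?thesis by (simp add: m_def)
qed

text \<open>Gronwall's argument for the quadratic form \<open>c l\<^sup>2 + m\<^sup>2\<close>: if the generator is dissipative for it up to the
  rate \<open>\<beta>\<close>, then \<open>e\<^bsup>-2\<beta>t\<^esup> (c l\<^sup>2 + m\<^sup>2)\<close> decreases along orbits in the domain, and density does the rest.\<close>

lemma semigroup_energy_decay: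
  fixes l m :: "'a \<Rightarrow> real"
  assumes l: "bounded_linear l" and m: "bounded_linear m"
    and dis: "\<And>x y. (x, y) \<in> generator S \<Longrightarrow> c * (l x * l y) + m x * m y \<le> \<beta> * (c * (l x)\<^sup>2 + (m x)\<^sup>2)"
    and t: "t \<ge> 0"
  shows "c * (l (S t x))\<^sup>2 + (m (S t x))\<^sup>2 \<le> exp (2 * \<beta> * t) * (c * (l x)\<^sup>2 + (m x)\<^sup>2)"
proof -
  define q where "q x = c * (l x)\<^sup>2 + (m x)\<^sup>2" for x
  have D: "q (S t x) \<le> exp (2 * \<beta> * t) * q x" if g: "(x, y) \<in> generator S" for x y
  proof (cases "t = 0")
    case False
    then have t0: "0 < t" using t by simp
    define f where "f s = exp (- (2 * \<beta>) * s) * q (S s x)" for s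
    have df: "\<exists>D. (f has_real_derivative D) (at s within {0..}) \<and> D \<le> 0" if "s \<ge> 0" for s
    proof -
      have dl: "((\<lambda>s. l (S s x)) has_real_derivative l (S s y)) (at s within {0..})"
        and dm: "((\<lambda>s. m (S s x)) has_real_derivative m (S s y)) (at s within {0..})"
        using bounded_linear.has_vector_derivative[OF l semigroup_generator_deriv[OF g that]]
          bounded_linear.has_vector_derivative[OF m semigroup_generator_deriv[OF g that]]
        by (simp_all add: has_real_derivative_iff_has_vector_derivative)
      have "(f has_real_derivative exp (- (2 * \<beta>) * s) * (2 * (c * (l (S s x) * l (S s y)) + m (S s x) * m (S s y)) - 2 * \<beta> * q (S s x))) (at s within {0..})"
        unfolding f_def q_def
        by (auto intro!: derivative_eq_intros dl dm simp: algebra_simps power2_eq_square)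
      moreover have "2 * (c * (l (S s x) * l (S s y)) + m (S s x) * m (S s y)) - 2 * \<beta> * q (S s x) \<le> 0"
        using dis[OF semigroup_generator_invariant[OF g that]] by (simp add: q_def)
      ultimately show ?thesis by (blast intro: mult_nonneg_nonpos[OF exp_ge_zero])
    qed
    have "f t \<le> f 0"
    proof (rule DERIV_nonpos_imp_decreasing_open[OF t])
      fix s assume "0 < s" "s < t"
      then show "\<exists>y. DERIV f s :> y \<and> y \<le> 0"
        using df[of s] at_within_interior[of s "{0..}"] by (auto simp: interior_Ici[of "-1"])
    next
      show "continuous_on {0..t} f"
        by (rule continuous_on_subset[of "{0..}"])
           (use df in \<open>force simp: continuous_on_eq_continuous_within dest: DERIV_continuous\<close>, simp)
    qed
    then show ?thesis by (simp add: f_def exp_minus field_simps)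
  qed simp
  define p where "p x = exp (2 * \<beta> * t) * q x - q (S t x)" for x
  have cl: "continuous (at x) l" "continuous (at x) m" "continuous (at x) (S t)" for x
    using l m semigroup_linear[OF t] by (auto intro: linear_continuous_at)
  have cp: "isCont p x"
    unfolding p_def q_def 
    by (intro continuous_intros bounded_linear.isCont[OF l] bounded_linear.isCont[OF m] bounded_linear.isCont[OF semigroup_linear[OF t]])
  have "p x \<ge> 0"
  proof (rule ccontr)
    assume "\<not> p x \<ge> 0"
    then obtain d where d: "d > 0" "\<And>z. dist z x < d \<Longrightarrow> dist (p z) (p x) < - p x"
      using cp unfolding continuous_at_eps_delta by (metis neg_0_less_iff_less not_le)
    obtain z w where "(z, w) \<in> generator S" "norm (z - x) < d" using semigroup_generator_dense[OF d(1)] by blast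
    then have "p z \<ge> 0" "dist (p z) (p x) < - p x" using D d(2)[of z] by (auto simp: p_def dist_norm)
    then show False by (simp add: dist_norm)
  qed
  then show ?thesis by (simp add: p_def q_def)
qed

end


section \<open>Coordinates on the energy space\<close>

text \<open>The sine coefficients of both components. Mode \<open>n\<close> is the frequency \<open>n + 1\<close> throughout.\<close>

definition acoef :: "E \<Rightarrow> nat \<Rightarrow> real" where "acoef U n = coef (emb (fst U)) n"
definition bcoef :: "E \<Rightarrow> nat \<Rightarrow> real" where "bcoef U n = coef (snd U) n"

lemma acoef_simps [simp]:
  "acoef (U + V) n = acoef U n + acoef V n" "acoef (c *\<^sub>R U) n = c * acoef U n"
  "acoef (U - V) n = acoef U n - acoef V n" "acoef (- U) n = - acoef U n" "acoef 0 n = 0"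
  by (simp_all add: acoef_def)

lemma bcoef_simps [simp]:
  "bcoef (U + V) n = bcoef U n + bcoef V n" "bcoef (c *\<^sub>R U) n = c * bcoef U n"
  "bcoef (U - V) n = bcoef U n - bcoef V n" "bcoef (- U) n = - bcoef U n" "bcoef 0 n = 0"
  by (simp_all add: bcoef_def)

lemma acoef_sum [simp]: "acoef (\<Sum>i\<in>A. f i) n = (\<Sum>i\<in>A. acoef (f i) n)"
  by (induction A rule: infinite_finite_induct) auto

lemma bcoef_sum [simp]: "bcoef (\<Sum>i\<in>A. f i) n = (\<Sum>i\<in>A. bcoef (f i) n)"
  by (induction A rule: infinite_finite_induct) auto

lemma norm_esin [simp]: "norm (esin n) = 1"
  using orthonormal_esin by (simp add: orthonormal_seq_def norm_eq_sqrt_inner)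

lemma abs_coef_le: "\<bar>coef w n\<bar> \<le> norm w"
  using Cauchy_Schwarz_ineq2[of w "esin n"] by (simp add: coef_def)

lemma norm_fst_le': "norm (fst U) \<le> norm U" and norm_snd_le': "norm (snd U) \<le> norm U"
  using norm_fst_le[of "fst U" "snd U"] norm_snd_le[of "snd U" "fst U"] by simp_all

lemma abs_acoef_le: "\<bar>acoef U n\<bar> \<le> norm U"
  unfolding acoef_def by (rule order_trans[OF abs_coef_le order_trans[OF norm_emb_le norm_fst_le']])

lemma abs_bcoef_le: "\<bar>bcoef U n\<bar> \<le> norm U"
  unfolding bcoef_def by (rule order_trans[OF abs_coef_le norm_snd_le'])

lemma bounded_linear_acoef: "bounded_linear (\<lambda>U. acoef U n)"
  and bounded_linear_bcoef: "bounded_linear (\<lambda>U. bcoef U n)"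
  by (rule bounded_linear_intro[where K = 1]; simp add: abs_acoef_le abs_bcoef_le)+

lemma E_eqI:
  assumes "\<And>n. acoef U n = acoef V n" "\<And>n. bcoef U n = bcoef V n"
  shows "U = V"
proof (rule prod_eqI)
  have "emb (fst U) = emb (fst V)" by (rule coef_eqI) (use assms in \<open>simp add: acoef_def\<close>)
  then show "fst U = fst V" by simp
  show "snd U = snd V" by (rule coef_eqI) (use assms in \<open>simp add: bcoef_def\<close>)
qed

lemma coef_sinL: "coef (sinL (Suc m)) n = (if n = m then sqrt (pi / 2) else 0)"
proof -
  have "sqrt (2 / pi) * (pi / 2) = sqrt (pi / 2)"
    using sqrt_2_pi by (simp add: real_sqrt_divide field_simps)
  then show ?thesis by (auto simp: coef_def esin_def inner_sinL simp del: real_sqrt_divide)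
qed

lemma sqrt_pi_2: "sqrt (2 / pi) * sqrt (pi / 2) = 1"
  by (simp add: real_sqrt_mult[symmetric])

lemma norm_E_usual_sums:
  "(\<lambda>n. (1 + (real (Suc n))\<^sup>2) * (acoef U n)\<^sup>2 + (bcoef U n)\<^sup>2) sums (norm U)\<^sup>2"
proof -
  have "(\<lambda>n. coef (emb (fst U)) n * coef (emb (fst U)) n + (real (Suc n))\<^sup>2 * (coef (emb (fst U)) n * coef (emb (fst U)) n)
      + coef (snd U) n * coef (snd U) n) sums
     (inner (emb (fst U)) (emb (fst U)) + inner (dx (fst U)) (dx (fst U)) + inner (snd U) (snd U))"
    by (intro sums_add coef_parseval coef_parseval_dx)
  moreover have "(norm U)\<^sup>2 = inner (emb (fst U)) (emb (fst U)) + inner (dx (fst U)) (dx (fst U)) + inner (snd U) (snd U)"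
    by (simp add: norm_prod_def norm_h01_sq power2_norm_eq_inner)
  ultimately show ?thesis
    by (simp add: acoef_def bcoef_def power2_eq_square algebra_simps)
qed

text \<open>The sine coefficients of \<open>u/(2\<epsilon>) + \<epsilon>v\<close>, the combination whose \<open>L\<^sup>2\<close> norm enters \<open>\<parallel>\<cdot>\<parallel>\<^sub>E\<close>.\<close>

definition wcoef :: "real \<Rightarrow> E \<Rightarrow> nat \<Rightarrow> real" where
  "wcoef \<epsilon> U n = acoef U n / (2 * \<epsilon>) + \<epsilon> * bcoef U n"

lemma bounded_linear_wcoef: "bounded_linear (\<lambda>U. wcoef \<epsilon> U n)"
proof -
  have "bounded_linear (\<lambda>U. (1 / (2 * \<epsilon>)) * acoef U n + \<epsilon> * bcoef U n)"
    by (intro bounded_linear_add bounded_linear_const_mult bounded_linear_acoef bounded_linear_bcoef)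
  then show ?thesis by (simp add: wcoef_def)
qed

lemma wcoef_simps [simp]:
  "wcoef \<epsilon> (U + V) n = wcoef \<epsilon> U n + wcoef \<epsilon> V n" "wcoef \<epsilon> (c *\<^sub>R U) n = c * wcoef \<epsilon> U n"
  "wcoef \<epsilon> (U - V) n = wcoef \<epsilon> U n - wcoef \<epsilon> V n" "wcoef \<epsilon> 0 n = 0"
  by (simp_all add: wcoef_def algebra_simps add_divide_distrib diff_divide_distrib)

lemma wcoef_sums:
  "(\<lambda>n. wcoef \<epsilon> U n * wcoef \<epsilon> V n) sums
   inner ((1 / (2 * \<epsilon>)) *\<^sub>R emb (fst U) + \<epsilon> *\<^sub>R snd U) ((1 / (2 * \<epsilon>)) *\<^sub>R emb (fst V) + \<epsilon> *\<^sub>R snd V)"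
proof -
  have "wcoef \<epsilon> U n = coef ((1 / (2 * \<epsilon>)) *\<^sub>R emb (fst U) + \<epsilon> *\<^sub>R snd U) n" for U n
    by (simp add: wcoef_def acoef_def bcoef_def)
  then show ?thesis by (simp only: coef_parseval)
qed

lemma inner_E11_sums:
  "(\<lambda>n. (1 / (4 * \<epsilon>\<^sup>2) - (real (Suc n))\<^sup>2) * (acoef U n * acoef V n) + wcoef \<epsilon> U n * wcoef \<epsilon> V n) sums inner_E11 \<epsilon> U V"
proof -
  have "(\<lambda>n. 1 / (4 * \<epsilon>\<^sup>2) * (acoef U n * acoef V n) - (real (Suc n))\<^sup>2 * (acoef U n * acoef V n) + wcoef \<epsilon> U n * wcoef \<epsilon> V n) sums
     (1 / (4 * \<epsilon>\<^sup>2) * inner (emb (fst U)) (emb (fst V)) - inner (dx (fst U)) (dx (fst V)) +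
       inner ((1 / (2 * \<epsilon>)) *\<^sub>R emb (fst U) + \<epsilon> *\<^sub>R snd U) ((1 / (2 * \<epsilon>)) *\<^sub>R emb (fst V) + \<epsilon> *\<^sub>R snd V))"
    unfolding acoef_def
    by (intro sums_add sums_diff sums_mult coef_parseval coef_parseval_dx wcoef_sums)
  also have "(1 / (4 * \<epsilon>\<^sup>2) * inner (emb (fst U)) (emb (fst V)) - inner (dx (fst U)) (dx (fst V)) +
       inner ((1 / (2 * \<epsilon>)) *\<^sub>R emb (fst U) + \<epsilon> *\<^sub>R snd U) ((1 / (2 * \<epsilon>)) *\<^sub>R emb (fst V) + \<epsilon> *\<^sub>R snd V)) = inner_E11 \<epsilon> U V"
    by (simp only: inner_E11_def inner_sqrt_laplacian case_prod_beta)
  finally show ?thesis by (simp only: left_diff_distrib)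
qed

lemma inner_E22_eq:
  "inner_E22 \<epsilon> N U V = inner (dx (fst U)) (dx (fst V)) + (1 / (4 * \<epsilon>\<^sup>2) - 2 * (real N + 1)\<^sup>2) * inner (emb (fst U)) (emb (fst V)) +
       inner ((1 / (2 * \<epsilon>)) *\<^sub>R emb (fst U) + \<epsilon> *\<^sub>R snd U) ((1 / (2 * \<epsilon>)) *\<^sub>R emb (fst V) + \<epsilon> *\<^sub>R snd V)"
  by (simp only: inner_E22_def inner_sqrt_laplacian case_prod_beta)

lemma inner_E22_sums:
  "(\<lambda>n. ((real (Suc n))\<^sup>2 + 1 / (4 * \<epsilon>\<^sup>2) - 2 * (real N + 1)\<^sup>2) * (acoef U n * acoef V n) + wcoef \<epsilon> U n * wcoef \<epsilon> V n) sums inner_E22 \<epsilon> N U V"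
proof -
  have "(\<lambda>n. (real (Suc n))\<^sup>2 * (acoef U n * acoef V n) + (1 / (4 * \<epsilon>\<^sup>2) - 2 * (real N + 1)\<^sup>2) * (acoef U n * acoef V n) + wcoef \<epsilon> U n * wcoef \<epsilon> V n) sums inner_E22 \<epsilon> N U V"
    unfolding acoef_def inner_E22_eq
    by (intro sums_add sums_diff sums_mult coef_parseval coef_parseval_dx wcoef_sums)
  then show ?thesis by (simp only: distrib_right add_diff_eq[symmetric])
qed

lemma mem_E22_iff: "U \<in> E22 N \<longleftrightarrow> (\<forall>n<N. acoef U n = 0 \<and> bcoef U n = 0)"
proof -
  have "(inner w (sinL (Suc n)) = 0) \<longleftrightarrow> coef w n = 0" for w n
    by (simp add: coef_def esin_def)
  moreover have "{1..N} = Suc ` {..<N}"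
    by (simp add: image_Suc_lessThan)
  ultimately show ?thesis by (auto simp: E22_def acoef_def bcoef_def)
qed

locale wave_splitting =
  fixes \<epsilon> :: real and N :: nat
  assumes eps: "\<epsilon> > 0" and small: "1 / (2 * \<epsilon>) > real N + 1" and N1: "N \<ge> 1"
begin

text \<open>The eigenvalues \<open>\<lambda>\<^bsub>n+1\<^esub>\<^sup>\<plusminus>\<close>, the root in them, and the coefficient of \<open>(acoef U n)\<^sup>2\<close> in \<open>\<parallel>U\<parallel>\<^sub>E\<^sup>2\<close>. The
  eigenvalues are used for \<open>n \<le> N\<close>, where they are real. The constant \<open>gapc\<close> is the positive quantity
  behind all coercivity estimates; \<open>\<lambda>\<^bsub>N+1\<^esub>\<^sup>+ = - 1/(2\<epsilon>\<^sup>2) + sqrt gapc/\<epsilon>\<close>.\<close>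

definition "lp n = lam_plus \<epsilon> (Suc n)"
definition "lm n = lam_minus \<epsilon> (Suc n)"
definition "rt n = sqrt (1 - 4 * \<epsilon>\<^sup>2 * (real (Suc n))\<^sup>2)"
definition "gapc = 1 / (4 * \<epsilon>\<^sup>2) - (real N + 1)\<^sup>2"
definition "mode_coeff n = (if n < N then 1 / (4 * \<epsilon>\<^sup>2) - (real (Suc n))\<^sup>2
   else (real (Suc n))\<^sup>2 + 1 / (4 * \<epsilon>\<^sup>2) - 2 * (real N + 1)\<^sup>2)"

lemma gapc_pos: "gapc > 0"
proof -
  have "(real N + 1)\<^sup>2 < (1 / (2 * \<epsilon>))\<^sup>2" using small by (intro power_strict_mono) auto
  then show ?thesis by (simp add: gapc_def power_divide power_mult_distrib)
qed

lemma rt: assumes "n \<le> N" shows "rt n > 0" "(rt n)\<^sup>2 = 1 - 4 * \<epsilon>\<^sup>2 * (real (Suc n))\<^sup>2"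
proof -
  have "(real (Suc n))\<^sup>2 \<le> (real N + 1)\<^sup>2" using assms by (intro power_mono) auto
  also have "\<dots> < 1 / (4 * \<epsilon>\<^sup>2)" using gapc_pos by (simp add: gapc_def)
  finally have "1 - 4 * \<epsilon>\<^sup>2 * (real (Suc n))\<^sup>2 > 0" using eps by (simp add: field_simps)
  then show "rt n > 0" "(rt n)\<^sup>2 = 1 - 4 * \<epsilon>\<^sup>2 * (real (Suc n))\<^sup>2" by (simp_all add: rt_def)
qed

lemma lp_eq: "lp n = (- 1 + rt n) / (2 * \<epsilon>\<^sup>2)" and lm_eq: "lm n = (- 1 - rt n) / (2 * \<epsilon>\<^sup>2)"
  by (simp_all add: lp_def lm_def lam_plus_def lam_minus_def rt_def)

lemma lp_minus_lm: "lp n - lm n = rt n / \<epsilon>\<^sup>2"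
  using eps by (simp add: lp_eq lm_eq field_simps)

lemma lp_plus_lm: "lp n + lm n = - 1 / \<epsilon>\<^sup>2"
  using eps by (simp add: lp_eq lm_eq field_simps)

lemma lp_times_lm: assumes "n \<le> N" shows "lp n * lm n = (real (Suc n))\<^sup>2 / \<epsilon>\<^sup>2"
proof -
  have "lp n * lm n = (1 - (rt n)\<^sup>2) / (4 * \<epsilon>\<^sup>2 * \<epsilon>\<^sup>2)"
    by (simp add: lp_eq lm_eq power2_eq_square algebra_simps)
  then show ?thesis using eps by (simp add: rt(2)[OF assms])
qed

lemma lp_neq_lm: "n \<le> N \<Longrightarrow> lp n - lm n > 0"
  using rt eps by (simp add: lp_minus_lm)

text \<open>The coordinates of the \<open>n\<close>-th mode of \<open>U\<close> with respect to its two eigenvectors.\<close>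

definition "xc n U = (bcoef U n - lm n * acoef U n) / (lp n - lm n)"
definition "yc n U = (lp n * acoef U n - bcoef U n) / (lp n - lm n)"

lemma xc_simps [simp]: "xc n (U + V) = xc n U + xc n V" "xc n (c *\<^sub>R U) = c * xc n U" "xc n (U - V) = xc n U - xc n V" "xc n 0 = 0"
  by (simp_all add: xc_def algebra_simps add_divide_distrib diff_divide_distrib)

lemma yc_simps [simp]: "yc n (U + V) = yc n U + yc n V" "yc n (c *\<^sub>R U) = c * yc n U" "yc n (U - V) = yc n U - yc n V" "yc n 0 = 0"
  by (simp_all add: yc_def algebra_simps add_divide_distrib diff_divide_distrib)

lemma xc_sum [simp]: "xc n (\<Sum>i\<in>A. f i) = (\<Sum>i\<in>A. xc n (f i))"
  by (induction A rule: infinite_finite_induct) auto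

lemma bounded_linear_xc: "bounded_linear (xc n)" and bounded_linear_yc: "bounded_linear (yc n)"
proof -
  have "bounded_linear (\<lambda>U. (1 / (lp n - lm n)) * (bcoef U n - lm n * acoef U n))"
    "bounded_linear (\<lambda>U. (1 / (lp n - lm n)) * (lp n * acoef U n - bcoef U n))"
    by (intro bounded_linear_sub bounded_linear_const_mult bounded_linear_acoef bounded_linear_bcoef)+
  then show "bounded_linear (xc n)" "bounded_linear (yc n)" by (simp_all add: xc_def[abs_def] yc_def[abs_def])
qed

lemma eigen_coef:
  assumes "n \<le> N"
  shows "acoef U n = xc n U + yc n U" "bcoef U n = lp n * xc n U + lm n * yc n U"
proof -
  have nz: "lp n - lm n \<noteq> 0" using lp_neq_lm[OF assms] by simp
  have "xc n U + yc n U = ((lp n - lm n) * acoef U n) / (lp n - lm n)"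
    unfolding xc_def yc_def add_divide_distrib[symmetric] by (simp add: algebra_simps)
  then show "acoef U n = xc n U + yc n U" using nz by simp
  have "lp n * xc n U + lm n * yc n U = ((lp n - lm n) * bcoef U n) / (lp n - lm n)"
    unfolding xc_def yc_def times_divide_eq_right add_divide_distrib[symmetric] by (simp add: algebra_simps)
  then show "bcoef U n = lp n * xc n U + lm n * yc n U" using nz by simp
qed

lemma wcoef_eigen: assumes "n \<le> N" shows "wcoef \<epsilon> U n = rt n / (2 * \<epsilon>) * (xc n U - yc n U)"
proof -
  have "wcoef \<epsilon> U n = (1 / (2 * \<epsilon>) + \<epsilon> * lp n) * xc n U + (1 / (2 * \<epsilon>) + \<epsilon> * lm n) * yc n U"
    unfolding wcoef_def eigen_coef[OF assms] by (simp add: algebra_simps add_divide_distrib)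
  also have "1 / (2 * \<epsilon>) + \<epsilon> * lp n = rt n / (2 * \<epsilon>)"
    using eps by (simp add: lp_eq field_simps power2_eq_square)
  also have "1 / (2 * \<epsilon>) + \<epsilon> * lm n = - rt n / (2 * \<epsilon>)"
    using eps by (simp add: lm_eq field_simps power2_eq_square)
  finally show ?thesis by (simp add: algebra_simps diff_divide_distrib)
qed

text \<open>Eigenvectors scaled such that the sine coefficient of the first component is \<open>1\<close>.\<close>

definition "ep n = sqrt (2 / pi) *\<^sub>R e_plus \<epsilon> (Suc n)"
definition "em n = sqrt (2 / pi) *\<^sub>R e_minus \<epsilon> (Suc n)"

lemma coef_ep: "acoef (ep m) n = (if n = m then 1 else 0)" "bcoef (ep m) n = (if n = m then lp m else 0)"
  and coef_em: "acoef (em m) n = (if n = m then 1 else 0)" "bcoef (em m) n = (if n = m then lm m else 0)"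
  using sqrt_pi_2
  by (auto simp: ep_def em_def e_plus_def e_minus_def acoef_def bcoef_def coef_sinL lp_def lm_def mult.commute mult.left_commute
      simp del: real_sqrt_divide)

lemma eigen_ep: assumes "n \<le> N" shows "xc n (ep m) = (if n = m then 1 else 0)" "yc n (ep m) = 0"
    and eigen_em: "xc n (em m) = 0" "yc n (em m) = (if n = m then 1 else 0)"
  using lp_neq_lm[OF assms] by (auto simp: xc_def yc_def coef_ep coef_em)

text \<open>Coordinate forms of the projections onto \<open>E\<^sub>1\<close> and onto \<open>E\<^sub>1\<^sub>1\<close>.\<close>

definition "proj1 U = (\<Sum>n<N. xc n U *\<^sub>R ep n)"
definition "low_part U = (\<Sum>n<N. xc n U *\<^sub>R ep n + yc n U *\<^sub>R em n)"

lemma proj1_add [simp]: "proj1 (U + V) = proj1 U + proj1 V" and proj1_diff [simp]: "proj1 (U - V) = proj1 U - proj1 V"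
  and proj1_scale [simp]: "proj1 (c *\<^sub>R U) = c *\<^sub>R proj1 U" and proj1_0 [simp]: "proj1 0 = 0"
  by (simp_all add: proj1_def scaleR_add_left scaleR_diff_left sum.distrib sum_subtractf scaleR_sum_right)

lemma bounded_linear_proj1: "bounded_linear proj1"
proof -
  have "bounded_linear (\<lambda>U. \<Sum>n<N. xc n U *\<^sub>R ep n)"
    by (intro bounded_linear_sum bounded_linear_compose[OF bounded_linear_scaleR_left] bounded_linear_xc)
  then show ?thesis by (simp add: proj1_def[abs_def])
qed

lemma xc_proj1: "n < N \<Longrightarrow> xc n (proj1 U) = xc n U"
  by (simp add: proj1_def eigen_ep if_distrib[of "\<lambda>x. _ * x"] cong: if_cong)

lemma acoef_proj1: "acoef (proj1 U) n = (if n < N then xc n U else 0)"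
  and bcoef_proj1: "bcoef (proj1 U) n = (if n < N then lp n * xc n U else 0)"
  by (simp_all add: proj1_def coef_ep if_distrib[of "\<lambda>x. _ * x"] mult.commute cong: if_cong)

lemma yc_proj1: "n < N \<Longrightarrow> yc n (proj1 U) = 0"
  by (simp add: yc_def acoef_proj1 bcoef_proj1)

lemma acoef_low_part: "acoef (low_part U) n = (if n < N then acoef U n else 0)"
  and bcoef_low_part: "bcoef (low_part U) n = (if n < N then bcoef U n else 0)"
  by (auto simp: low_part_def coef_ep coef_em sum.distrib if_distrib[of "\<lambda>x. _ * x"] eigen_coef[of n U] mult.commute cong: if_cong)

lemma proj1_idem [simp]: "proj1 (proj1 U) = proj1 U"
  unfolding proj1_def[of "proj1 U"] by (simp add: xc_proj1) (simp add: proj1_def)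

lemma e_plus_ep: "e_plus \<epsilon> (Suc n) = sqrt (pi / 2) *\<^sub>R ep n" and e_minus_em: "e_minus \<epsilon> (Suc n) = sqrt (pi / 2) *\<^sub>R em n"
  using sqrt_pi_2 by (simp_all add: ep_def em_def mult.commute del: real_sqrt_divide)

lemma ep_E1: "n < N \<Longrightarrow> ep n \<in> E1 \<epsilon> N" and em_Em1: "n < N \<Longrightarrow> em n \<in> Em1 \<epsilon> N"
  unfolding E1_def Em1_def ep_def em_def by (rule span_scale, rule span_base, rule imageI, simp)+

lemma subspace_E1: "subspace (E1 \<epsilon> N)" and subspace_Em1: "subspace (Em1 \<epsilon> N)"
  by (simp_all add: E1_def Em1_def)

lemma mem_E1_iff: "U \<in> E1 \<epsilon> N \<longleftrightarrow> proj1 U = U"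
proof
  assume "U \<in> E1 \<epsilon> N"
  then show "proj1 U = U"
    unfolding E1_def
  proof (induction rule: span_induct_alt)
    case base show ?case by simp
  next
    case (step c x y)
    then obtain n where n: "n < N" "x = e_plus \<epsilon> (Suc n)"
      by (metis (no_types, lifting) atLeastAtMost_iff imageE not0_implies_Suc not_one_le_zero Suc_le_eq)
    have "proj1 (ep n) = ep n"
      unfolding proj1_def using n by (simp add: eigen_ep if_distrib[of "\<lambda>x. x *\<^sub>R _"] cong: if_cong)
    then have "proj1 x = x" using n by (simp add: e_plus_ep)
    then show ?case using step by simp
  qed
next
  assume "proj1 U = U"
  moreover have "proj1 U \<in> E1 \<epsilon> N"
    unfolding proj1_def by (intro subspace_sum subspace_E1 subspace_scale ep_E1) auto
  ultimately show "U \<in> E1 \<epsilon> N" by simp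
qed

lemma mem_Em1: "U \<in> Em1 \<epsilon> N \<Longrightarrow> (\<forall>n<N. xc n U = 0) \<and> (\<forall>n\<ge>N. acoef U n = 0 \<and> bcoef U n = 0)"
  unfolding Em1_def
proof (induction rule: span_induct_alt)
  case base show ?case by simp
next
  case (step c x y)
  then obtain n where n: "n < N" "x = e_minus \<epsilon> (Suc n)"
    by (metis (no_types, lifting) atLeastAtMost_iff imageE not0_implies_Suc not_one_le_zero Suc_le_eq)
  then show ?case using step by (auto simp: e_minus_em eigen_em coef_em)
qed

lemma low_part_decomp: "low_part U = proj1 U + (\<Sum>n<N. yc n U *\<^sub>R em n)"
  by (simp add: low_part_def proj1_def sum.distrib)

lemma sum_em_Em1: "(\<Sum>n<N. f n *\<^sub>R em n) \<in> Em1 \<epsilon> N"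
  by (intro subspace_sum subspace_Em1 subspace_scale em_Em1) auto

lemma diff_low_part_E22: "U - low_part U \<in> E22 N"
  by (simp add: mem_E22_iff acoef_low_part bcoef_low_part)

lemma mem_E2_iff: "U \<in> E2 \<epsilon> N \<longleftrightarrow> (\<forall>n<N. xc n U = 0)"
proof
  assume "U \<in> E2 \<epsilon> N"
  then obtain x y where "x \<in> Em1 \<epsilon> N" "y \<in> E22 N" "U = x + y" by (auto simp: E2_def)
  then show "\<forall>n<N. xc n U = 0" using mem_Em1 by (auto simp: mem_E22_iff xc_def)
next
  assume "\<forall>n<N. xc n U = 0"
  then have "proj1 U = 0" by (simp add: proj1_def)
  then have "U = (\<Sum>n<N. yc n U *\<^sub>R em n) + (U - low_part U)" by (simp add: low_part_decomp)
  then show "U \<in> E2 \<epsilon> N" 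
    unfolding E2_def mem_Collect_eq by (intro exI conjI) (rule sum_em_Em1 diff_low_part_E22 | assumption)+
qed

lemma proj_P_eq: "proj_P \<epsilon> N U = proj1 U"
  unfolding proj_P_def component_def
proof (rule the_equality)
  show "proj1 U \<in> E1 \<epsilon> N \<and> U - proj1 U \<in> E2 \<epsilon> N" by (simp add: mem_E1_iff mem_E2_iff xc_proj1)
  fix x assume x: "x \<in> E1 \<epsilon> N \<and> U - x \<in> E2 \<epsilon> N"
  then have "proj1 (U - x) = 0" unfolding proj1_def[of "U - x"] by (auto simp: mem_E2_iff)
  then show "x = proj1 U" using x by (simp add: mem_E1_iff)
qed

lemma proj_Q_eq: "proj_Q \<epsilon> N U = U - proj1 U"
  by (simp add: proj_Q_def proj_P_eq)

lemma component_E11_eq: "component (E11 \<epsilon> N) (E22 N) U = low_part U"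
  unfolding component_def
proof (rule the_equality)
  have "proj1 U \<in> E1 \<epsilon> N" by (simp add: mem_E1_iff)
  then have "low_part U \<in> E11 \<epsilon> N" 
    unfolding E11_def low_part_decomp mem_Collect_eq by (intro exI conjI) (rule refl sum_em_Em1 | assumption)+
  then show "low_part U \<in> E11 \<epsilon> N \<and> U - low_part U \<in> E22 N" using diff_low_part_E22 by blast
  fix x assume x: "x \<in> E11 \<epsilon> N \<and> U - x \<in> E22 N"
  then obtain y z where yz: "y \<in> E1 \<epsilon> N" "z \<in> Em1 \<epsilon> N" "x = y + z" by (auto simp: E11_def)
  have "acoef y n = 0 \<and> bcoef y n = 0" if "n \<ge> N" for n
    using yz(1) that acoef_proj1[of y n] bcoef_proj1[of y n] by (simp add: mem_E1_iff)
  then have "acoef x n = 0 \<and> bcoef x n = 0" if "n \<ge> N" for n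
    using yz mem_Em1 that by auto
  then show "x = low_part U"
    by (intro E_eqI) (use x in \<open>auto simp: acoef_low_part bcoef_low_part mem_E22_iff\<close>)
qed

text \<open>The inner product of \<open>E\<^sub>1\<^sub>1\<close> sees only the modes below \<open>N\<close>, that of \<open>E\<^sub>2\<^sub>2\<close> only the others; so the two
  expansions merge into one.\<close>

lemma inner_E_sums:
  "(\<lambda>n. mode_coeff n * (acoef U n * acoef V n) + wcoef \<epsilon> U n * wcoef \<epsilon> V n) sums inner_E \<epsilon> N U V"
proof -
  have w: "wcoef \<epsilon> (low_part U) n = (if n < N then wcoef \<epsilon> U n else 0)" for U n
    by (simp add: wcoef_def acoef_low_part bcoef_low_part)
  show ?thesis
    using sums_add[OF inner_E11_sums[of \<epsilon> "low_part U" "low_part V"] inner_E22_sums[of \<epsilon> N "U - low_part U" "V - low_part V"]]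
    unfolding inner_E_def component_E11_eq Let_def
    by (rule sums_cong[THEN iffD1, rotated]) (auto simp: mode_coeff_def acoef_low_part w)
qed

text \<open>The two forms differ in finitely many modes only. This expression is visibly bilinear and bounded in
  the usual norm of \<open>E\<close>.\<close>

lemma inner_E_eq:
  "inner_E \<epsilon> N U V = inner_E22 \<epsilon> N U V + (\<Sum>n<N. 2 * ((real N + 1)\<^sup>2 - (real (Suc n))\<^sup>2) * (acoef U n * acoef V n))"
proof (rule sums_unique2[OF inner_E_sums])
  have "(\<lambda>n. if n < N then 2 * ((real N + 1)\<^sup>2 - (real (Suc n))\<^sup>2) * (acoef U n * acoef V n) else 0) sums
     (\<Sum>n<N. 2 * ((real N + 1)\<^sup>2 - (real (Suc n))\<^sup>2) * (acoef U n * acoef V n))"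
    using sums_If_finite_set[of "{..<N}" "\<lambda>n. 2 * ((real N + 1)\<^sup>2 - (real (Suc n))\<^sup>2) * (acoef U n * acoef V n)"]
    by (simp only: lessThan_iff finite_lessThan simp_thms)
  from sums_add[OF inner_E22_sums[of \<epsilon> N U V] this]
  show "(\<lambda>n. mode_coeff n * (acoef U n * acoef V n) + wcoef \<epsilon> U n * wcoef \<epsilon> V n) sums
     (inner_E22 \<epsilon> N U V + (\<Sum>n<N. 2 * ((real N + 1)\<^sup>2 - (real (Suc n))\<^sup>2) * (acoef U n * acoef V n)))"
    by (rule sums_cong[THEN iffD1, rotated]) (auto simp: mode_coeff_def algebra_simps)
qed

lemma mode_coeff_ge: "mode_coeff n \<ge> gapc"
proof (cases "n < N")
  case True
  have "(real (Suc n))\<^sup>2 \<le> (real N + 1)\<^sup>2" using True by (intro power_mono) auto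
  then show ?thesis using True by (simp add: mode_coeff_def gapc_def)
next
  case False
  have "(real N + 1)\<^sup>2 \<le> (real (Suc n))\<^sup>2" using False by (intro power_mono) auto
  then show ?thesis using False by (simp add: mode_coeff_def gapc_def)
qed

lemma mode_coeff_pos: "mode_coeff n > 0" using mode_coeff_ge[of n] gapc_pos by linarith

definition "mode_energy n U = mode_coeff n * (acoef U n)\<^sup>2 + (wcoef \<epsilon> U n)\<^sup>2"

lemma mode_energy_nonneg: "mode_energy n U \<ge> 0" using mode_coeff_pos[of n] by (simp add: mode_energy_def)

lemma mode_energy_sums: "(\<lambda>n. mode_energy n U) sums inner_E \<epsilon> N U U"
  using inner_E_sums[of U U] by (simp add: mode_energy_def power2_eq_square)

lemma inner_E_nonneg: "inner_E \<epsilon> N U U \<ge> 0"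
  by (rule sums_le[OF _ sums_zero mode_energy_sums]) (rule mode_energy_nonneg)

lemma norm_E_sq: "(norm_E \<epsilon> N U)\<^sup>2 = inner_E \<epsilon> N U U"
  by (simp add: norm_E_def inner_E_nonneg)

lemma norm_E_nonneg: "norm_E \<epsilon> N U \<ge> 0"
  by (simp add: norm_E_def inner_E_nonneg)

lemma norm_E_le_modewise:
  assumes "\<And>n. mode_energy n U \<le> c\<^sup>2 * mode_energy n V" "c \<ge> 0"
  shows "norm_E \<epsilon> N U \<le> c * norm_E \<epsilon> N V"
proof (rule power2_le_imp_le)
  show "(norm_E \<epsilon> N U)\<^sup>2 \<le> (c * norm_E \<epsilon> N V)\<^sup>2"
    unfolding power_mult_distrib norm_E_sq
    by (rule sums_le[OF assms(1) mode_energy_sums sums_mult[OF mode_energy_sums]])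
qed (use assms norm_E_nonneg in auto)

text \<open>In a mode below \<open>N\<close> the two eigenvectors are orthogonal and equally long, because \<open>wcoef\<close> takes the values
  \<open>\<plusminus> sqrt(mode_coeff n)\<close> on them. This is why the projection onto \<open>E\<^sub>1\<close> is orthogonal.\<close>

lemma mode_energy_eigen: assumes "n < N" shows "mode_energy n U = 2 * mode_coeff n * ((xc n U)\<^sup>2 + (yc n U)\<^sup>2)"
proof -
  have "(rt n)\<^sup>2 = 4 * \<epsilon>\<^sup>2 * mode_coeff n"
    using rt(2)[of n] assms eps by (simp add: mode_coeff_def right_diff_distrib)
  then have "(rt n / (2 * \<epsilon>))\<^sup>2 = mode_coeff n"
    using eps by (simp add: power_divide power_mult_distrib)
  then have "(wcoef \<epsilon> U n)\<^sup>2 = mode_coeff n * (xc n U - yc n U)\<^sup>2"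
    using assms by (simp only: wcoef_eigen less_imp_le power_mult_distrib)
  then show ?thesis using assms by (simp add: mode_energy_def eigen_coef power2_eq_square algebra_simps)
qed

lemma mode_energy_cong: "acoef U n = acoef V n \<Longrightarrow> bcoef U n = bcoef V n \<Longrightarrow> mode_energy n U = mode_energy n V"
  by (simp add: mode_energy_def wcoef_def)

text \<open>The coefficient \<open>mode_coeff n\<close> dominates \<open>1 + (n+1)\<^sup>2\<close> up to the factor \<open>\<kappa>\<close>: for \<open>n < N\<close> it is at least
  \<open>gapc\<close>, and for larger \<open>n\<close> it grows like \<open>(n+1)\<^sup>2\<close> from the value \<open>gapc\<close> at \<open>n = N\<close>. The coefficient \<open>bcoef\<close>
  is recovered from \<open>wcoef\<close> and \<open>acoef\<close>.\<close>

lemma norm_E_coercive: "\<exists>c>0. \<forall>U. c * norm U \<le> norm_E \<epsilon> N U"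
proof -
  define M where "M = (real N + 1)\<^sup>2"
  define \<kappa> where "\<kappa> = min 1 gapc / (1 + M)"
  have M: "M \<ge> 0" by (simp add: M_def)
  have k: "\<kappa> > 0" "\<kappa> \<le> 1" "\<kappa> * (1 + M) \<le> gapc"
    using gapc_pos M by (auto simp: \<kappa>_def divide_le_eq)
  have c1: "\<kappa> * (1 + (real (Suc n))\<^sup>2) \<le> mode_coeff n" for n
  proof (cases "n < N")
    case True
    have "(real (Suc n))\<^sup>2 \<le> M" unfolding M_def using True by (intro power_mono) auto
    then have "\<kappa> * (1 + (real (Suc n))\<^sup>2) \<le> \<kappa> * (1 + M)" using k by (intro mult_left_mono) auto
    then show ?thesis using k(3) mode_coeff_ge[of n] by linarith
  next
    case False
    have m: "M \<le> (real (Suc n))\<^sup>2" unfolding M_def using False by (intro power_mono) auto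
    have "\<kappa> * (1 + (real (Suc n))\<^sup>2) = \<kappa> * (1 + M) + \<kappa> * ((real (Suc n))\<^sup>2 - M)" by (simp add: algebra_simps)
    also have "\<dots> \<le> gapc + 1 * ((real (Suc n))\<^sup>2 - M)" using k m by (intro add_mono mult_right_mono) auto
    also have "\<dots> = mode_coeff n" using False by (simp add: mode_coeff_def gapc_def M_def)
    finally show ?thesis .
  qed
  define c where "c = min (\<kappa> / 2) (min (\<kappa> * \<epsilon>^4) (\<epsilon>\<^sup>2 / 2))"
  have c: "c > 0" "c \<le> \<kappa> / 2" "c \<le> \<kappa> * \<epsilon>^4" "c \<le> \<epsilon>\<^sup>2 / 2" using k eps by (auto simp: c_def)
  have c2: "c * ((1 + (real (Suc n))\<^sup>2) * (acoef U n)\<^sup>2 + (bcoef U n)\<^sup>2) \<le> mode_energy n U" for n U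
  proof -
    define a b w where "a = acoef U n" and "b = bcoef U n" and "w = wcoef \<epsilon> U n"
    have "\<epsilon> * b = w - a / (2 * \<epsilon>)" by (simp add: a_def b_def w_def wcoef_def)
    then have "\<epsilon>\<^sup>2 * b\<^sup>2 = (w - a / (2 * \<epsilon>))\<^sup>2" by (metis power_mult_distrib)
    also have "\<dots> \<le> 2 * w\<^sup>2 + 2 * (a / (2 * \<epsilon>))\<^sup>2"
      using zero_le_power2[of "w + a / (2 * \<epsilon>)"] by (simp add: power2_eq_square algebra_simps)
    also have "\<dots> = 2 * w\<^sup>2 + a\<^sup>2 / (2 * \<epsilon>\<^sup>2)" by (simp add: power_divide power_mult_distrib)
    finally have b: "\<epsilon>\<^sup>2 * b\<^sup>2 \<le> 2 * w\<^sup>2 + a\<^sup>2 / (2 * \<epsilon>\<^sup>2)" .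
    have "c * b\<^sup>2 = (c / \<epsilon>\<^sup>2) * (\<epsilon>\<^sup>2 * b\<^sup>2)" using eps by simp
    also have "\<dots> \<le> (c / \<epsilon>\<^sup>2) * (2 * w\<^sup>2 + a\<^sup>2 / (2 * \<epsilon>\<^sup>2))" using c b by (intro mult_left_mono) auto
    also have "\<dots> = (2 * c / \<epsilon>\<^sup>2) * w\<^sup>2 + (c / (2 * \<epsilon>^4)) * a\<^sup>2"
      using eps by (simp add: field_simps power2_eq_square power4_eq_xxxx)
    also have "\<dots> \<le> 1 * w\<^sup>2 + (\<kappa> / 2) * a\<^sup>2"
      using c eps by (intro add_mono mult_right_mono) (auto simp: field_simps)
    finally have cb: "c * b\<^sup>2 \<le> w\<^sup>2 + (\<kappa> / 2) * a\<^sup>2" by simp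
    have "c * ((1 + (real (Suc n))\<^sup>2) * a\<^sup>2) \<le> \<kappa> / 2 * ((1 + (real (Suc n))\<^sup>2) * a\<^sup>2)"
      using c by (intro mult_right_mono) auto
    moreover have "\<kappa> / 2 * a\<^sup>2 \<le> \<kappa> / 2 * ((1 + (real (Suc n))\<^sup>2) * a\<^sup>2)"
      using k by (intro mult_left_mono) (auto simp: algebra_simps)
    moreover have "\<kappa> * ((1 + (real (Suc n))\<^sup>2) * a\<^sup>2) \<le> mode_coeff n * a\<^sup>2"
      using mult_right_mono[OF c1[of n], of "a\<^sup>2"] by (simp add: mult.assoc)
    ultimately have "c * ((1 + (real (Suc n))\<^sup>2) * a\<^sup>2) + c * b\<^sup>2 \<le> mode_coeff n * a\<^sup>2 + w\<^sup>2" using cb by linarith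
    then show ?thesis by (simp add: mode_energy_def a_def b_def w_def distrib_left)
  qed
  have "sqrt c * norm U \<le> norm_E \<epsilon> N U" for U
  proof (rule power2_le_imp_le)
    have "c * (norm U)\<^sup>2 \<le> inner_E \<epsilon> N U U"
      by (rule sums_le[OF c2 sums_mult[OF norm_E_usual_sums] mode_energy_sums])
    then show "(sqrt c * norm U)\<^sup>2 \<le> (norm_E \<epsilon> N U)\<^sup>2"
      using c by (simp add: power_mult_distrib norm_E_sq)
  qed (rule norm_E_nonneg)
  then show ?thesis using c(1) by (intro exI[of _ "sqrt c"]) auto
qed

lemma inner_E_commute: "inner_E \<epsilon> N U V = inner_E \<epsilon> N V U"
  unfolding inner_E_eq inner_E22_eq by (simp add: inner_commute mult.commute)

lemma bounded_bilinear_inner_E: "bounded_bilinear (inner_E \<epsilon> N)"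
proof
  fix U V W :: E and r :: real
  show 1: "inner_E \<epsilon> N (U + V) W = inner_E \<epsilon> N U W + inner_E \<epsilon> N V W" for U V W
    unfolding inner_E_eq inner_E22_eq
    by (simp add: inner_add_left scaleR_add_right algebra_simps sum.distrib sum_subtractf)
  then show "inner_E \<epsilon> N U (V + W) = inner_E \<epsilon> N U V + inner_E \<epsilon> N U W"
    using inner_E_commute by metis
  show 2: "inner_E \<epsilon> N (r *\<^sub>R U) V = r *\<^sub>R inner_E \<epsilon> N U V" for U V
    unfolding inner_E_eq inner_E22_eq
    by (simp add: inner_add_left inner_add_right algebra_simps sum_distrib_left)
  then show "inner_E \<epsilon> N U (r *\<^sub>R V) = r *\<^sub>R inner_E \<epsilon> N U V"
    using inner_E_commute by metis
  define c0 where "c0 = 1 / (4 * \<epsilon>\<^sup>2) - 2 * (real N + 1)\<^sup>2"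
  define d where "d n = 2 * ((real N + 1)\<^sup>2 - (real (Suc n))\<^sup>2)" for n
  define e where "e = \<bar>1 / (2 * \<epsilon>)\<bar> + \<bar>\<epsilon>\<bar>"
  define K where "K = 1 + \<bar>c0\<bar> + e * e + (\<Sum>n<N. \<bar>d n\<bar>)"
  have "norm (inner_E \<epsilon> N U V) \<le> norm U * norm V * K" for U V
  proof -
    have in_le: "\<bar>inner x y\<bar> \<le> cx * norm U * (cy * norm V)" if "norm x \<le> cx * norm U" "norm y \<le> cy * norm V" for x y :: l2 and cx cy
      by (rule order_trans[OF Cauchy_Schwarz_ineq2 mult_mono]) (use that in \<open>auto intro: order_trans[OF norm_ge_zero]\<close>)
    have ne: "norm (emb (fst W)) \<le> 1 * norm W" "norm (dx (fst W)) \<le> 1 * norm W" for W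
      unfolding mult_1 by (rule order_trans[OF norm_emb_le norm_fst_le'] order_trans[OF norm_dx_le norm_fst_le'])+
    have nw: "norm ((1 / (2 * \<epsilon>)) *\<^sub>R emb (fst W) + \<epsilon> *\<^sub>R snd W) \<le> e * norm W" for W
    proof -
      have "norm ((1 / (2 * \<epsilon>)) *\<^sub>R emb (fst W) + \<epsilon> *\<^sub>R snd W) \<le> \<bar>1 / (2 * \<epsilon>)\<bar> * norm (emb (fst W)) + \<bar>\<epsilon>\<bar> * norm (snd W)"
        by (rule order_trans[OF norm_triangle_ineq]) simp
      also have "\<dots> \<le> \<bar>1 / (2 * \<epsilon>)\<bar> * norm W + \<bar>\<epsilon>\<bar> * norm W"
        using ne(1)[of W] norm_snd_le'[of W] by (intro add_mono mult_left_mono) auto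
      finally show ?thesis by (simp add: e_def algebra_simps)
    qed
    have s: "\<bar>\<Sum>n<N. d n * (acoef U n * acoef V n)\<bar> \<le> (\<Sum>n<N. \<bar>d n\<bar>) * (norm U * norm V)"
      unfolding sum_distrib_right
      by (rule order_trans[OF sum_abs sum_mono])
         (auto simp: abs_mult intro!: mult_left_mono mult_mono abs_acoef_le)
    have "\<bar>c0 * inner (emb (fst U)) (emb (fst V))\<bar> \<le> \<bar>c0\<bar> * (norm U * norm V)"
      unfolding abs_mult using in_le[OF ne(1) ne(1)] by (intro mult_left_mono) auto
    moreover have "\<bar>inner (dx (fst U)) (dx (fst V))\<bar> \<le> norm U * norm V" using in_le[OF ne(2) ne(2)] by simp
    ultimately have "\<bar>inner_E \<epsilon> N U V\<bar> \<le> norm U * norm V + \<bar>c0\<bar> * (norm U * norm V) + e * norm U * (e * norm V) + (\<Sum>n<N. \<bar>d n\<bar>) * (norm U * norm V)"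
      using in_le[OF nw nw] s unfolding inner_E_eq inner_E22_eq c0_def[symmetric] d_def[symmetric] by linarith
    then show ?thesis by (simp add: K_def algebra_simps)
  qed
  then show "\<exists>K. \<forall>a b. norm (inner_E \<epsilon> N a b) \<le> norm a * norm b * K" by blast
qed

end


section \<open>The wave semigroup on the splitting\<close>

context wave_splitting
begin

lemma lp_antimono: assumes "m \<le> n" "n \<le> N" shows "lp n \<le> lp m"
proof -
  have "(real (Suc m))\<^sup>2 \<le> (real (Suc n))\<^sup>2" using assms by (intro power_mono) auto
  then have "rt n \<le> rt m" unfolding rt_def by (intro real_sqrt_le_mono diff_left_mono mult_left_mono) auto
  then show ?thesis using eps by (simp add: lp_eq divide_right_mono)
qed

lemma lp_strict: assumes "m < n" "n \<le> N" shows "lp n < lp m"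
proof -
  have "(real (Suc m))\<^sup>2 < (real (Suc n))\<^sup>2" using assms by (intro power_strict_mono) auto
  then have "rt n < rt m" unfolding rt_def using eps by (intro real_sqrt_less_mono diff_strict_left_mono mult_strict_left_mono) auto
  then show ?thesis using eps by (simp add: lp_eq divide_strict_right_mono)
qed

lemma lp_neg: assumes "n \<le> N" shows "lp n < 0"
proof -
  have "(rt n)\<^sup>2 < 1\<^sup>2" using eps by (simp add: rt(2)[OF assms])
  then have "rt n < 1" by (rule power2_less_imp_less) simp
  then show ?thesis using eps by (simp add: lp_eq divide_neg_pos)
qed

lemma lm_le_lp: assumes "n \<le> N" shows "lm n \<le> lp N"
proof -
  have "0 < rt n" "0 < rt N" using rt assms by auto
  then show ?thesis using eps unfolding lp_eq lm_eq by (intro divide_right_mono) auto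
qed

text \<open>The group \<open>e\<^bsup>At\<^esup>\<close> on \<open>E\<^sub>1\<close>, composed with the projection onto \<open>E\<^sub>1\<close>; it makes sense for negative times.\<close>

definition "flow1 t U = (\<Sum>n<N. (exp (lp n * t) * xc n U) *\<^sub>R ep n)"

lemma xc_flow1: "n < N \<Longrightarrow> xc n (flow1 t U) = exp (lp n * t) * xc n U"
  and acoef_flow1: "acoef (flow1 t U) n = (if n < N then exp (lp n * t) * xc n U else 0)"
  and bcoef_flow1: "bcoef (flow1 t U) n = (if n < N then lp n * (exp (lp n * t) * xc n U) else 0)"
  by (simp_all add: flow1_def eigen_ep coef_ep if_distrib[of "\<lambda>x. _ * x"] mult.commute[of "lp _" "_ * _"] cong: if_cong)

lemma yc_flow1: "n < N \<Longrightarrow> yc n (flow1 t U) = 0"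
  by (simp add: yc_def acoef_flow1 bcoef_flow1)

lemma flow1_proj1: "flow1 t (proj1 U) = flow1 t U"
  by (simp add: flow1_def xc_proj1)

lemma proj1_flow1: "proj1 (flow1 t U) = flow1 t U"
  unfolding proj1_def by (simp add: xc_flow1) (simp add: flow1_def)

lemma bounded_linear_flow1: "bounded_linear (flow1 t)"
proof -
  have "bounded_linear (\<lambda>U. \<Sum>n<N. (exp (lp n * t) * xc n U) *\<^sub>R ep n)"
    by (intro bounded_linear_sum bounded_linear_compose[OF bounded_linear_scaleR_left] bounded_linear_const_mult bounded_linear_xc)
  then show ?thesis by (simp add: flow1_def[abs_def])
qed

lemma continuous_on_flow1: "continuous_on A (\<lambda>t. flow1 t U)"
  unfolding flow1_def by (intro continuous_intros)

text \<open>For \<open>t \<le> 0\<close> the factor \<open>e\<^bsup>\<lambda>t\<^esup>\<close> decreases in \<open>\<lambda>\<close>, and \<open>\<lambda>\<^sub>N\<^sup>+\<close> is the smallest of the eigenvalues \<open>\<lambda>\<^sub>k\<^sup>+\<close> with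
  \<open>k \<le> N\<close>.\<close>

lemma norm_E_flow1_le:
  assumes "t \<le> 0"
  shows "norm_E \<epsilon> N (flow1 t U) \<le> exp (lam_plus \<epsilon> N * t) * norm_E \<epsilon> N U"
proof (rule norm_E_le_modewise)
  have l: "lam_plus \<epsilon> N = lp (N - 1)" using N1 by (simp add: lp_def)
  fix n
  show "mode_energy n (flow1 t U) \<le> (exp (lam_plus \<epsilon> N * t))\<^sup>2 * mode_energy n U"
  proof (cases "n < N")
    case True
    have "lp (N - 1) \<le> lp n" using True by (intro lp_antimono) auto
    then have "exp (lp n * t) \<le> exp (lp (N - 1) * t)" using assms by (simp add: mult_right_mono_neg)
    then have "(exp (lp n * t))\<^sup>2 \<le> (exp (lp (N - 1) * t))\<^sup>2" by (intro power_mono) auto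
    then have "2 * mode_coeff n * ((exp (lp n * t))\<^sup>2 * (xc n U)\<^sup>2) \<le> 2 * mode_coeff n * ((exp (lp (N - 1) * t))\<^sup>2 * ((xc n U)\<^sup>2 + (yc n U)\<^sup>2))"
      using mode_coeff_pos[of n] by (intro mult_left_mono mult_mono) auto
    then show ?thesis using True by (simp add: mode_energy_eigen xc_flow1 yc_flow1 l power_mult_distrib mult_ac)
  next
    case False
    then have "mode_energy n (flow1 t U) = 0" by (simp add: mode_energy_def wcoef_def acoef_flow1 bcoef_flow1)
    then show ?thesis using mode_energy_nonneg[of n U] by simp
  qed
qed simp

text \<open>Along \<open>\<epsilon>\<^sup>2 u'' + u' + k\<^sup>2 u = 0\<close> with \<open>k = n + 1 > N\<close>, half the derivative of the energy is
  \<open>- (1/(2\<epsilon>\<^sup>2))\<close> times the energy plus \<open>2 a w gapc/\<epsilon>\<close>: the square of the frequency has cancelled. By the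
  inequality of arithmetic and geometric means the last term is at most \<open>sqrt gapc/\<epsilon>\<close> times the energy,
  and the two rates add up to \<open>\<lambda>\<^bsub>N+1\<^esub>\<^sup>+\<close>, whatever the mode. The constant \<open>2(N+1)\<^sup>2\<close> in the norm is
  chosen for this.\<close>

lemma energy_dissipation:
  assumes n: "n \<ge> N" and w: "w = a / (2 * \<epsilon>) + \<epsilon> * b"
  shows "mode_coeff n * (a * b) + w * (b / (2 * \<epsilon>) + \<epsilon> * (- ((real (Suc n))\<^sup>2 * a + b) / \<epsilon>\<^sup>2)) \<le> lp N * (mode_coeff n * a\<^sup>2 + w\<^sup>2)"
proof -
  define k r where "k = (real (Suc n))\<^sup>2" and "r = rt N"
  have r: "r > 0" "r\<^sup>2 = 4 * \<epsilon>\<^sup>2 * gapc"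
    using rt[of N] eps by (auto simp: r_def gapc_def right_diff_distrib add.commute)
  have d: "gapc = r\<^sup>2 / (4 * \<epsilon>\<^sup>2)" using r(2) eps by simp
  have ck: "mode_coeff n = k - 1 / (4 * \<epsilon>\<^sup>2) + 2 * gapc" using n by (simp add: mode_coeff_def k_def gapc_def)
  have b: "b = w / \<epsilon> - a / (2 * \<epsilon>\<^sup>2)" using eps by (simp add: w field_simps power2_eq_square)
  have "mode_coeff n * (a * b) + w * (b / (2 * \<epsilon>) + \<epsilon> * (- (k * a + b) / \<epsilon>\<^sup>2))
      = - (1 / (2 * \<epsilon>\<^sup>2)) * (mode_coeff n * a\<^sup>2 + w\<^sup>2) + 2 * a * w * gapc / \<epsilon>"
    unfolding ck b using eps by (simp add: field_simps power2_eq_square)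
  also have "2 * a * w * gapc / \<epsilon> \<le> r / (2 * \<epsilon>\<^sup>2) * (gapc * a\<^sup>2 + w\<^sup>2)"
  proof -
    have "0 \<le> r / (2 * \<epsilon>\<^sup>2) * (r * a / (2 * \<epsilon>) - w)\<^sup>2" using r by simp
    also have "\<dots> = r / (2 * \<epsilon>\<^sup>2) * (gapc * a\<^sup>2 + w\<^sup>2) - 2 * a * w * gapc / \<epsilon>"
      unfolding d using eps by (simp add: field_simps power2_eq_square)
    finally show ?thesis by simp
  qed
  also have "r / (2 * \<epsilon>\<^sup>2) * (gapc * a\<^sup>2 + w\<^sup>2) \<le> r / (2 * \<epsilon>\<^sup>2) * (mode_coeff n * a\<^sup>2 + w\<^sup>2)"
    using r mode_coeff_ge[of n] by (intro mult_left_mono add_right_mono mult_right_mono) auto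
  also have "- (1 / (2 * \<epsilon>\<^sup>2)) * (mode_coeff n * a\<^sup>2 + w\<^sup>2) + r / (2 * \<epsilon>\<^sup>2) * (mode_coeff n * a\<^sup>2 + w\<^sup>2) = lp N * (mode_coeff n * a\<^sup>2 + w\<^sup>2)"
    unfolding lp_eq r_def[symmetric] by (simp add: algebra_simps add_divide_distrib diff_divide_distrib)
  finally show ?thesis by (simp add: k_def)
qed

end

locale wave_semigroup = wave_splitting +
  fixes S :: "real \<Rightarrow> E \<Rightarrow> E"
  assumes semigroup: "C0_semigroup S" and gen: "generator S = wave_op \<epsilon>"
begin

text \<open>Green's formula against the eigenfunction; the boundary conditions are contained in \<open>u \<in> H\<^sub>0\<^sup>1\<close>.\<close>

lemma coef_neg_laplacian:
  assumes "(u, w) \<in> neg_laplacian" shows "coef w n = (real (Suc n))\<^sup>2 * coef (emb u) n"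
proof -
  have "inner w (sinL (Suc n)) = inner (dx u) (real (Suc n) *\<^sub>R cosL (Suc n))"
    using inner_neg_laplacian[OF assms, of "sinH (Suc n)"] by simp
  also have "\<dots> = (real (Suc n))\<^sup>2 * inner (emb u) (sinL (Suc n))"
    by (simp add: inner_dx_cosL power2_eq_square del: of_nat_Suc)
  finally show ?thesis by (simp add: coef_def esin_def)
qed

lemma coef_generator:
  assumes "(x, y) \<in> generator S"
  shows "acoef y n = bcoef x n" "bcoef y n = - ((real (Suc n))\<^sup>2 * acoef x n + bcoef x n) / \<epsilon>\<^sup>2"
proof -
  from assms obtain u v w where g: "(u, w) \<in> neg_laplacian" "x = (u, emb v)"
    "y = (v, - (1 / \<epsilon>\<^sup>2) *\<^sub>R w - (1 / \<epsilon>\<^sup>2) *\<^sub>R emb v)"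
    unfolding gen wave_op_def by blast
  show "acoef y n = bcoef x n" by (simp add: g acoef_def bcoef_def)
  show "bcoef y n = - ((real (Suc n))\<^sup>2 * acoef x n + bcoef x n) / \<epsilon>\<^sup>2"
    using eps by (simp add: g acoef_def bcoef_def coef_neg_laplacian[OF g(1)] field_simps del: of_nat_Suc)
qed

lemma eigen_xc_yc:
  assumes g: "(x, y) \<in> generator S" and n: "n \<le> N"
  shows "xc n y = lp n * xc n x" "yc n y = lm n * yc n x"
proof -
  have e: "bcoef y n = - (lp n * lm n) * acoef x n + (lp n + lm n) * bcoef x n"
    unfolding coef_generator[OF g] lp_times_lm[OF n] lp_plus_lm using eps by (simp add: field_simps)
  show "xc n y = lp n * xc n x" "yc n y = lm n * yc n x"
    unfolding xc_def yc_def e coef_generator(1)[OF g] times_divide_eq_right by (simp_all add: algebra_simps)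
qed

lemma xc_S: "n \<le> N \<Longrightarrow> t \<ge> 0 \<Longrightarrow> xc n (S t U) = exp (lp n * t) * xc n U"
  by (rule semigroup_eigenfunctional[OF semigroup bounded_linear_xc]) (auto simp: eigen_xc_yc)

lemma yc_S: "n \<le> N \<Longrightarrow> t \<ge> 0 \<Longrightarrow> yc n (S t U) = exp (lm n * t) * yc n U"
  by (rule semigroup_eigenfunctional[OF semigroup bounded_linear_yc]) (auto simp: eigen_xc_yc)

lemma mode_energy_S:
  assumes n: "n \<ge> N" and t: "t \<ge> 0"
  shows "mode_energy n (S t U) \<le> exp (2 * lp N * t) * mode_energy n U"
  unfolding mode_energy_def
proof (rule semigroup_energy_decay[OF semigroup bounded_linear_acoef bounded_linear_wcoef _ t])
  fix x y assume g: "(x, y) \<in> generator S"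
  show "mode_coeff n * (acoef x n * acoef y n) + wcoef \<epsilon> x n * wcoef \<epsilon> y n \<le> lp N * (mode_coeff n * (acoef x n)\<^sup>2 + (wcoef \<epsilon> x n)\<^sup>2)"
    unfolding wcoef_def[of \<epsilon> y] coef_generator[OF g]
    by (rule energy_dissipation[OF n]) (simp add: wcoef_def)
qed

text \<open>Modes below \<open>N\<close> contribute only their second eigenvector, with an eigenvalue below \<open>- 1/(2\<epsilon>\<^sup>2)\<close>, hence
  below \<open>\<lambda>\<^bsub>N+1\<^esub>\<^sup>+\<close>; the others decay by the energy estimate.\<close>

lemma norm_E_S_le:
  assumes "t \<ge> 0"
  shows "norm_E \<epsilon> N (S t (U - proj1 U)) \<le> exp (lam_plus \<epsilon> (N + 1) * t) * norm_E \<epsilon> N U"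
proof (rule norm_E_le_modewise)
  have l: "lam_plus \<epsilon> (N + 1) = lp N" "lam_plus \<epsilon> (Suc N) = lp N" by (simp_all add: lp_def)
  fix n
  show "mode_energy n (S t (U - proj1 U)) \<le> (exp (lam_plus \<epsilon> (N + 1) * t))\<^sup>2 * mode_energy n U"
  proof (cases "n < N")
    case True
    have "exp (lm n * t) \<le> exp (lp N * t)" using lm_le_lp[of n] True assms by (simp add: mult_right_mono)
    then have "(exp (lm n * t))\<^sup>2 \<le> (exp (lp N * t))\<^sup>2" by (intro power_mono) auto
    then have "2 * mode_coeff n * ((exp (lm n * t))\<^sup>2 * (yc n U)\<^sup>2) \<le> 2 * mode_coeff n * ((exp (lp N * t))\<^sup>2 * ((xc n U)\<^sup>2 + (yc n U)\<^sup>2))"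
      using mode_coeff_pos[of n] by (intro mult_left_mono mult_mono) auto
    then show ?thesis
      using True assms by (simp add: mode_energy_eigen xc_S yc_S xc_proj1 yc_proj1 l power_mult_distrib mult_ac)
  next
    case False
    have "mode_energy n (S t (U - proj1 U)) \<le> exp (2 * lp N * t) * mode_energy n (U - proj1 U)"
      using False assms by (intro mode_energy_S) auto
    also have "mode_energy n (U - proj1 U) = mode_energy n U" using False by (intro mode_energy_cong) (auto simp: acoef_proj1 bcoef_proj1)
    also have "exp (2 * lp N * t) = (exp (lam_plus \<epsilon> (N + 1) * t))\<^sup>2"
      by (simp add: l exp_double[symmetric] mult.assoc)
    finally show ?thesis .
  qed
qed simp

text \<open>An element of \<open>E\<close> is determined by its coefficients, and on those the semigroup is known: explicitly
  below \<open>N\<close>, and from \<open>N\<close> on because vanishing energy stays zero.\<close>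

lemma S_flow1:
  assumes t: "t \<ge> 0" and U: "U \<in> E1 \<epsilon> N"
  shows "S t (flow1 (- t) U) = U"
proof -
  have UP: "proj1 U = U" using U by (simp add: mem_E1_iff)
  let ?V = "S t (flow1 (- t) U)"
  have x: "xc n ?V = xc n U" "yc n ?V = 0" if "n < N" for n
    using that t by (simp_all add: xc_S yc_S xc_flow1 yc_flow1 exp_minus)
  have z: "acoef ?V n = 0 \<and> bcoef ?V n = 0" if "n \<ge> N" for n
  proof -
    have "mode_energy n ?V \<le> exp (2 * lp N * t) * mode_energy n (flow1 (- t) U)" by (rule mode_energy_S[OF that t])
    also have "mode_energy n (flow1 (- t) U) = 0" using that by (simp add: mode_energy_def wcoef_def acoef_flow1 bcoef_flow1)
    finally have "mode_energy n ?V = 0" using mode_energy_nonneg[of n ?V] by simp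
    then have "acoef ?V n = 0" "wcoef \<epsilon> ?V n = 0"
      using mode_coeff_pos[of n] by (auto simp: mode_energy_def add_nonneg_eq_0_iff)
    then show ?thesis using eps by (simp add: wcoef_def)
  qed
  have u: "yc n U = 0" if "n < N" for n using yc_proj1[OF that, of U] UP by simp
  have u2: "acoef U n = 0 \<and> bcoef U n = 0" if "n \<ge> N" for n
    using acoef_proj1[of U n] bcoef_proj1[of U n] UP that by simp
  show ?thesis
  proof (rule E_eqI)
    fix n
    show "acoef ?V n = acoef U n"
      using x[of n] u[of n] z[of n] u2[of n] eigen_coef(1)[of n ?V] eigen_coef(1)[of n U] by (cases "n < N") auto
    show "bcoef ?V n = bcoef U n"
      using x[of n] u[of n] z[of n] u2[of n] eigen_coef(2)[of n ?V] eigen_coef(2)[of n U] by (cases "n < N") auto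
  qed
qed

lemma inj_on_S: assumes t: "t \<ge> 0" shows "inj_on (S t) (E1 \<epsilon> N)"
proof (rule inj_onI)
  fix x y assume xy: "x \<in> E1 \<epsilon> N" "y \<in> E1 \<epsilon> N" "S t x = S t y"
  have "xc n x = xc n y" if "n < N" for n
    using arg_cong[OF xy(3), of "xc n"] that t by (simp add: xc_S)
  then have "proj1 x = proj1 y" by (simp add: proj1_def)
  then show "x = y" using xy by (simp add: mem_E1_iff)
qed

lemma backward_eq:
  assumes "t \<le> 0" "U \<in> E1 \<epsilon> N"
  shows "backward \<epsilon> N S t U = flow1 t U"
  unfolding backward_def
proof (rule inv_into_f_eq)
  show "inj_on (S (- t)) (E1 \<epsilon> N)" using assms by (intro inj_on_S) simp
  show "flow1 t U \<in> E1 \<epsilon> N" by (simp add: mem_E1_iff proj1_flow1)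
  show "S (- t) (flow1 t U) = U" using S_flow1[of "- t" U] assms by simp
qed

end


section \<open>The Lyapunov-Perron equation\<close>

lemma has_integral_exp_atMost:
  fixes a t :: real
  assumes "a > 0"
  shows "((\<lambda>s. exp (a * (s - t))) has_integral 1 / a) {..t}"
proof -
  define f where "f s = exp (a * (s - t))" for s
  have i: "((\<lambda>x. exp (- a * t) * exp (- a * x)) has_integral exp (- a * t) * (exp (- a * (- t)) / a)) {- t..}"
    by (intro has_integral_mult_right has_integral_exp_minus_to_infinity assms)
  have e: "exp (- a * t) * exp (- a * x) = f (- x)" for x
    by (simp add: f_def exp_add[symmetric] algebra_simps)
  have v: "exp (- a * t) * (exp (- a * (- t)) / a) = 1 / a"
    by (simp add: exp_minus)
  have i': "((\<lambda>x. f (- x)) has_integral 1 / a) {- t..}" using i unfolding e v .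
  have "(\<lambda>x. f (- x)) absolutely_integrable_on {- t..}"
    by (rule nonnegative_absolutely_integrable_1) (use i' in \<open>auto simp: f_def integrable_on_def\<close>)
  moreover have "integral {- t..} (\<lambda>x. f (- x)) = 1 / a" using i' by (rule integral_unique)
  moreover have "{..t} = uminus ` {- t..}" by simp
  ultimately have "f absolutely_integrable_on {..t} \<and> integral {..t} f = 1 / a"
    using has_absolute_integral_reflect_real[of "{- t..}" "{..t}" f "1 / a"] by auto
  then show ?thesis
    using set_lebesgue_integral_eq_integral(1) by (fastforce simp: f_def[symmetric] has_integral_iff)
qed

lemma nonneg_integrable_subset:
  fixes g :: "real \<Rightarrow> real"
  assumes "g integrable_on T" "\<And>s. s \<in> T \<Longrightarrow> g s \<ge> 0" "A \<subseteq> T" "A \<in> sets borel"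
  shows "g integrable_on A" "integral A g \<le> integral T g"
proof -
  have "set_integrable lebesgue T g" using assms by (intro nonnegative_absolutely_integrable_1) auto
  then have "set_integrable lebesgue A g" by (rule set_integrable_subset) (use assms in auto)
  then show i: "g integrable_on A" by (rule set_lebesgue_integral_eq_integral(1))
  show "integral A g \<le> integral T g" using assms i by (intro integral_subset_le) auto
qed

text \<open>The equation \<open>U(t) = y(t) - \<integral>\<^sub>t\<^sup>0 K\<^sub>1(t-s) F(s) ds + \<integral>\<^bsub>-\<infinity>\<^esub>\<^sup>t K\<^sub>2(t-s) F(s) ds\<close> with \<open>F(s) = b(s) + G(U(s))\<close>, on
  a Banach space with an inner product \<open>B\<close> that induces an equivalent norm. The kernels enter through
  strong continuity and exponential bounds in this norm; for the wave equation \<open>K\<^sub>1 = e\<^bsup>At\<^esup>P\<close> and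
  \<open>K\<^sub>2 = e\<^bsup>At\<^esup>Q\<close>. The smallness condition refers to Lipschitz constants in the norm of \<open>B\<close>, so all estimates
  are made in it, while continuity and integrals refer to the norm of the space.\<close>

locale lyapunov_perron =
  fixes B :: "'a::banach \<Rightarrow> 'a \<Rightarrow> real" and K1 K2 :: "real \<Rightarrow> 'a \<Rightarrow> 'a" and \<alpha> \<beta> \<eta> c0 :: real
  assumes bilin: "bounded_bilinear B" and sym: "B x y = B y x"
    and c0: "c0 > 0" and B_coercive: "c0 * (norm x)\<^sup>2 \<le> B x x"
    and rates: "\<beta> < \<eta>" "\<eta> < \<alpha>" "\<eta> \<le> 0"
    and K1_linear: "t \<le> 0 \<Longrightarrow> bounded_linear (K1 t)"
    and K1_bound: "t \<le> 0 \<Longrightarrow> B (K1 t x) (K1 t x) \<le> (exp (\<alpha> * t))\<^sup>2 * B x x"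
    and K1_cont: "continuous_on {..0} (\<lambda>t. K1 t x)"
    and K2_linear: "t \<ge> 0 \<Longrightarrow> bounded_linear (K2 t)"
    and K2_bound: "t \<ge> 0 \<Longrightarrow> B (K2 t x) (K2 t x) \<le> (exp (\<beta> * t))\<^sup>2 * B x x"
    and K2_cont: "continuous_on {0..} (\<lambda>t. K2 t x)"
begin

definition p :: "'a \<Rightarrow> real" where "p x = sqrt (B x x)"

lemma B_nonneg: "B x x \<ge> 0" by (rule order_trans[OF _ B_coercive]) (use c0 in simp)

lemma p_sq: "(p x)\<^sup>2 = B x x" and p_nonneg [simp]: "p x \<ge> 0"
  using B_nonneg[of x] by (simp_all add: p_def)

lemma norm_le_p: "norm x \<le> p x / sqrt c0"
proof -
  have "sqrt c0 * norm x \<le> p x"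
    by (rule power2_le_imp_le) (use B_coercive[of x] c0 in \<open>simp_all add: power_mult_distrib p_sq\<close>)
  then show ?thesis using c0 by (simp add: field_simps)
qed

lemma p_le_norm: "\<exists>C>0. \<forall>x. p x \<le> C * norm x"
proof -
  obtain K where K: "K > 0" "\<And>x y. norm (B x y) \<le> norm x * norm y * K"
    using bounded_bilinear.pos_bounded[OF bilin] by blast
  have "p x \<le> sqrt K * norm x" for x
  proof (rule power2_le_imp_le)
    show "(p x)\<^sup>2 \<le> (sqrt K * norm x)\<^sup>2"
      unfolding p_sq power_mult_distrib using K(2)[of x x] K(1) by (simp add: power2_eq_square mult_ac)
  qed (use K in auto)
  then show ?thesis using K(1) by (intro exI[of _ "sqrt K"]) auto
qed

lemma p_0 [simp]: "p 0 = 0"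
  by (simp add: p_def bounded_bilinear.zero_left[OF bilin])

lemma p_eq_0: "p x = 0 \<Longrightarrow> x = 0"
  using norm_le_p[of x] by simp

lemma B_le_p: "B x y \<le> p x * p y"
proof (cases "p y = 0")
  case True
  then have "y = 0" by (rule p_eq_0)
  then show ?thesis by (simp add: bounded_bilinear.zero_right[OF bilin])
next
  case False
  then have py: "p y > 0" using p_nonneg[of y] by linarith
  define r where "r = p x / p y"
  have "0 \<le> B (x - r *\<^sub>R y) (x - r *\<^sub>R y)" by (rule B_nonneg)
  also have "\<dots> = B x x - 2 * r * B x y + r\<^sup>2 * B y y"
    by (simp add: bounded_bilinear.diff_left[OF bilin] bounded_bilinear.diff_right[OF bilin]
        bounded_bilinear.scaleR_left[OF bilin] bounded_bilinear.scaleR_right[OF bilin] sym[of y x]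
        power2_eq_square algebra_simps)
  also have "\<dots> = 2 * (p x)\<^sup>2 - 2 * r * B x y"
    using py by (simp add: p_sq[symmetric] r_def power_divide)
  finally have "r * B x y \<le> (p x)\<^sup>2" by simp
  then have "p x * B x y \<le> p x * (p x * p y)"
    using py by (simp add: r_def field_simps power2_eq_square)
  moreover have "B x y = 0" if "p x = 0"
    using p_eq_0[OF that] by (simp add: bounded_bilinear.zero_left[OF bilin])
  ultimately show ?thesis using p_nonneg[of x] by (cases "p x = 0") (auto simp: mult_le_cancel_left)
qed

lemma p_add: "p (x + y) \<le> p x + p y"
proof (rule power2_le_imp_le)
  have "B (x + y) (x + y) = B x x + 2 * B x y + B y y"
    by (simp add: bounded_bilinear.add_left[OF bilin] bounded_bilinear.add_right[OF bilin] sym[of y x])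
  also have "\<dots> \<le> (p x)\<^sup>2 + 2 * (p x * p y) + (p y)\<^sup>2"
    using B_le_p[of x y] by (simp add: p_sq)
  finally show "(p (x + y))\<^sup>2 \<le> (p x + p y)\<^sup>2" by (simp add: p_sq power2_sum)
qed simp

lemma p_scaleR: "p (r *\<^sub>R x) = \<bar>r\<bar> * p x"
proof -
  have "p (r *\<^sub>R x) = sqrt (r\<^sup>2 * B x x)"
    by (simp add: p_def bounded_bilinear.scaleR_left[OF bilin] bounded_bilinear.scaleR_right[OF bilin] power2_eq_square)
  then show ?thesis by (simp add: real_sqrt_mult p_def)
qed

lemma p_minus: "p (- x) = p x"
  by (simp add: p_def bounded_bilinear.minus_left[OF bilin] bounded_bilinear.minus_right[OF bilin])

lemma p_minus_commute: "p (x - y) = p (y - x)"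
  using p_minus[of "x - y"] by simp

lemma p_diff: "p (x - y) \<le> p x + p y"
  using p_add[of x "- y"] by (simp add: p_minus)

lemma p_triangle: "p (x - z) \<le> p (x - y) + p (y - z)"
  using p_add[of "x - y" "y - z"] by simp

lemma tendsto_p: "(f \<longlongrightarrow> x) F \<Longrightarrow> ((\<lambda>z. p (f z)) \<longlongrightarrow> p x) F"
  unfolding p_def by (intro tendsto_real_sqrt bounded_bilinear.tendsto[OF bilin])

lemma p_K1: assumes "t \<le> 0" shows "p (K1 t x) \<le> exp (\<alpha> * t) * p x"
  by (rule power2_le_imp_le) (use K1_bound[OF assms] in \<open>simp_all add: p_sq power_mult_distrib\<close>)

lemma p_K2: assumes "t \<ge> 0" shows "p (K2 t x) \<le> exp (\<beta> * t) * p x"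
  by (rule power2_le_imp_le) (use K2_bound[OF assms] in \<open>simp_all add: p_sq power_mult_distrib\<close>)

text \<open>The triangle inequality for integrals in the norm of \<open>B\<close>: integrate \<open>B I (f s) \<le> p I \<cdot> p (f s)\<close>, where \<open>I\<close>
  is the integral of \<open>f\<close>.\<close>

lemma p_integral_le:
  assumes f: "(f has_integral I) A" and g: "(g has_integral J) A" and le: "\<And>s. s \<in> A \<Longrightarrow> p (f s) \<le> g s"
  shows "p I \<le> J"
proof -
  have J: "J \<ge> 0" by (rule has_integral_nonneg[OF g]) (meson le order_trans p_nonneg)
  have "((\<lambda>s. B I (f s)) has_integral B I I) A"
    using has_integral_linear[OF f bounded_bilinear.bounded_linear_right[OF bilin]] by (simp add: o_def)
  moreover have "((\<lambda>s. p I * g s) has_integral p I * J) A" by (rule has_integral_mult_right[OF g])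
  moreover have "B I (f s) \<le> p I * g s" if "s \<in> A" for s
    by (rule order_trans[OF B_le_p]) (intro mult_left_mono le that, simp)
  ultimately have "B I I \<le> p I * J" by (rule has_integral_le)
  then have "p I * p I \<le> p I * J" by (simp add: p_sq[symmetric] power2_eq_square)
  then show ?thesis using J p_nonneg[of I] by (cases "p I = 0") (auto simp: mult_le_cancel_left)
qed

text \<open>Strong continuity and a locally uniform bound give joint continuity in time and argument.\<close>

lemma continuous_on_kernel:
  assumes lin: "\<And>t. t \<in> D \<Longrightarrow> bounded_linear (K t)" and bd: "\<And>t x. t \<in> D \<Longrightarrow> p (K t x) \<le> exp (\<gamma> * t) * p x"
    and cont: "\<And>x. continuous_on D (\<lambda>t. K t x)"
    and a: "continuous_on A a" "a ` A \<subseteq> D" and v: "continuous_on A v"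
  shows "continuous_on A (\<lambda>z. K (a z) (v z))"
  unfolding continuous_on_def
proof
  fix z0 assume z0: "z0 \<in> A"
  obtain C where C: "C > 0" "\<And>x. p x \<le> C * norm x" using p_le_norm by blast
  have 1: "((\<lambda>z. K (a z) (v z0)) \<longlongrightarrow> K (a z0) (v z0)) (at z0 within A)"
    using continuous_on_compose2[OF cont[of "v z0"] a] z0 by (auto simp: continuous_on_def)
  have "((\<lambda>z. exp (\<gamma> * a z) * (C * norm (v z - v z0)) / sqrt c0) \<longlongrightarrow> exp (\<gamma> * a z0) * (C * norm (v z0 - v z0)) / sqrt c0) (at z0 within A)"
    using a(1) v z0 c0 by (intro tendsto_intros) (auto simp: continuous_on_def)
  then have "((\<lambda>z. exp (\<gamma> * a z) * (C * norm (v z - v z0)) / sqrt c0) \<longlongrightarrow> 0) (at z0 within A)" by simp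
  then have 2: "((\<lambda>z. K (a z) (v z - v z0)) \<longlongrightarrow> 0) (at z0 within A)"
  proof (rule Lim_null_comparison[rotated])
    show "\<forall>\<^sub>F z in at z0 within A. norm (K (a z) (v z - v z0)) \<le> exp (\<gamma> * a z) * (C * norm (v z - v z0)) / sqrt c0"
      unfolding eventually_at_filter
    proof (intro always_eventually allI impI)
      fix z assume "z \<in> A"
      then have az: "a z \<in> D" using a(2) by auto
      have "norm (K (a z) (v z - v z0)) \<le> p (K (a z) (v z - v z0)) / sqrt c0" by (rule norm_le_p)
      also have "\<dots> \<le> exp (\<gamma> * a z) * (C * norm (v z - v z0)) / sqrt c0"
        by (intro divide_right_mono order_trans[OF bd[OF az]] mult_left_mono C) (use c0 in auto)
      finally show "norm (K (a z) (v z - v z0)) \<le> exp (\<gamma> * a z) * (C * norm (v z - v z0)) / sqrt c0" .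
    qed
  qed
  have "((\<lambda>z. K (a z) (v z - v z0) + K (a z) (v z0)) \<longlongrightarrow> 0 + K (a z0) (v z0)) (at z0 within A)"
    by (intro tendsto_add 1 2)
  moreover have "\<forall>\<^sub>F z in at z0 within A. K (a z) (v z - v z0) + K (a z) (v z0) = K (a z) (v z)"
    unfolding eventually_at_filter
  proof (intro always_eventually allI impI)
    fix z assume "z \<in> A"
    then have "a z \<in> D" using a(2) by auto
    then have "linear (K (a z))" using lin bounded_linear.linear by blast
    then show "K (a z) (v z - v z0) + K (a z) (v z0) = K (a z) (v z)"
      by (simp add: linear_diff)
  qed
  ultimately show "((\<lambda>z. K (a z) (v z)) \<longlongrightarrow> K (a z0) (v z0)) (at z0 within A)"
    by (simp add: tendsto_cong)
qed

lemma continuous_on_K1: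
  assumes "continuous_on A a" "a ` A \<subseteq> {..0}" "continuous_on A v"
  shows "continuous_on A (\<lambda>z. K1 (a z) (v z))"
  by (rule continuous_on_kernel[OF _ _ K1_cont assms, where \<gamma> = \<alpha>]) (auto simp: K1_linear p_K1)

lemma continuous_on_K2:
  assumes "continuous_on A a" "a ` A \<subseteq> {0..}" "continuous_on A v"
  shows "continuous_on A (\<lambda>z. K2 (a z) (v z))"
  by (rule continuous_on_kernel[OF _ _ K2_cont assms, where \<gamma> = \<beta>]) (auto simp: K2_linear p_K2)

subsection \<open>Convolution with the kernels\<close>

definition weight :: "(real \<Rightarrow> real) \<Rightarrow> bool" where
  "weight g \<longleftrightarrow> g integrable_on {..0} \<and> (\<forall>s\<le>0. g s \<ge> 0)"

definition mass :: "(real \<Rightarrow> real) \<Rightarrow> real" where "mass g = integral {..0} g"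

text \<open>The two parts of the bound reflect the two sources of \<open>F\<close>: the noise, which is only known to be
  integrable against the weight, and the nonlinearity, which is bounded in the weighted supremum norm.\<close>

definition dominated :: "(real \<Rightarrow> 'a) \<Rightarrow> (real \<Rightarrow> real) \<Rightarrow> real \<Rightarrow> bool" where
  "dominated F g M \<longleftrightarrow> continuous_on {..0} F \<and> (\<forall>s\<le>0. p (F s) \<le> exp (\<eta> * s) * (g s + M))"

definition conv1 :: "(real \<Rightarrow> 'a) \<Rightarrow> real \<Rightarrow> 'a" where "conv1 F t = integral {t..0} (\<lambda>s. K1 (t - s) (F s))"
definition conv2 :: "(real \<Rightarrow> 'a) \<Rightarrow> real \<Rightarrow> 'a" where "conv2 F t = integral {..t} (\<lambda>s. K2 (t - s) (F s))"

lemma mass_nonneg: "weight g \<Longrightarrow> mass g \<ge> 0"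
  unfolding mass_def weight_def by (intro integral_nonneg) auto

lemma conv1_has_integral:
  assumes "continuous_on {..0} F" "t \<le> 0"
  shows "((\<lambda>s. K1 (t - s) (F s)) has_integral conv1 F t) {t..0}"
  unfolding conv1_def
  by (intro integrable_integral integrable_continuous_interval continuous_on_K1 continuous_intros
      continuous_on_subset[OF assms(1)]) auto

text \<open>After division by \<open>e\<^bsup>\<eta>t\<^esup>\<close> the kernel becomes \<open>e\<^bsup>(\<alpha>-\<eta>)(t-s)\<^esup>\<close>, which is at most \<open>1\<close> and has integral at
  most \<open>1/(\<alpha>-\<eta>)\<close>; the first bound serves the integrable part \<open>g\<close>, the second the bounded part \<open>M\<close>.\<close>

lemma p_conv1_le:
  assumes F: "dominated F g M" and g: "weight g" and M: "M \<ge> 0" and t: "t \<le> 0"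
  shows "p (conv1 F t) \<le> exp (\<eta> * t) * (mass g + M / (\<alpha> - \<eta>))"
proof -
  have ae: "\<alpha> - \<eta> > 0" using rates by simp
  have gi: "(g has_integral integral {t..0} g) {t..0}"
    using nonneg_integrable_subset(1)[of g "{..0}" "{t..0}"] g by (auto simp: weight_def)
  have gle: "integral {t..0} g \<le> mass g"
    unfolding mass_def using nonneg_integrable_subset(2)[of g "{..0}" "{t..0}"] g by (auto simp: weight_def)
  have ei: "((\<lambda>s. exp ((\<alpha> - \<eta>) * (t - s))) has_integral (- exp ((\<alpha> - \<eta>) * (t - 0)) / (\<alpha> - \<eta>) - - exp ((\<alpha> - \<eta>) * (t - t)) / (\<alpha> - \<eta>))) {t..0}"
  proof (rule fundamental_theorem_of_calculus[OF t])
    fix s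
    have "((\<lambda>s. - exp (a * (t - s)) / a) has_real_derivative exp (a * (t - s))) (at s within {t..0})" if "a > 0" for a
      using that by (auto intro!: derivative_eq_intros)
    then show "((\<lambda>s. - exp ((\<alpha> - \<eta>) * (t - s)) / (\<alpha> - \<eta>)) has_vector_derivative exp ((\<alpha> - \<eta>) * (t - s))) (at s within {t..0})"
      using ae by (simp flip: has_real_derivative_iff_has_vector_derivative)
  qed
  let ?J = "exp (\<eta> * t) * (integral {t..0} g + M * (- exp ((\<alpha> - \<eta>) * (t - 0)) / (\<alpha> - \<eta>) - - exp ((\<alpha> - \<eta>) * (t - t)) / (\<alpha> - \<eta>)))"
  have J: "((\<lambda>s. exp (\<eta> * t) * (g s + M * exp ((\<alpha> - \<eta>) * (t - s)))) has_integral ?J) {t..0}"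
    by (intro has_integral_mult_right has_integral_add gi ei)
  have "p (conv1 F t) \<le> ?J"
  proof (rule p_integral_le[OF conv1_has_integral J])
    fix s assume s: "s \<in> {t..0}"
    have g0: "g s \<ge> 0" using g s by (auto simp: weight_def)
    have e1: "exp ((\<alpha> - \<eta>) * (t - s)) \<le> 1" using s ae by (simp add: mult_le_0_iff)
    have "p (K1 (t - s) (F s)) \<le> exp (\<alpha> * (t - s)) * p (F s)" using s by (intro p_K1) auto
    also have "\<dots> \<le> exp (\<alpha> * (t - s)) * (exp (\<eta> * s) * (g s + M))"
      using F s by (intro mult_left_mono) (auto simp: dominated_def)
    also have "\<dots> = exp (\<eta> * t) * (exp ((\<alpha> - \<eta>) * (t - s)) * (g s + M))"
      unfolding mult.assoc[symmetric] exp_add[symmetric] by (simp add: algebra_simps)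
    also have "exp ((\<alpha> - \<eta>) * (t - s)) * (g s + M) \<le> 1 * g s + M * exp ((\<alpha> - \<eta>) * (t - s))"
      unfolding distrib_left using e1 g0 by (intro add_mono mult_right_mono) (auto simp: mult.commute)
    finally show "p (K1 (t - s) (F s)) \<le> exp (\<eta> * t) * (g s + M * exp ((\<alpha> - \<eta>) * (t - s)))" by simp
  qed (use F t in \<open>auto simp: dominated_def\<close>)
  also have "?J \<le> exp (\<eta> * t) * (mass g + M / (\<alpha> - \<eta>))"
  proof (intro mult_left_mono add_mono gle)
    have "M * (- exp ((\<alpha> - \<eta>) * (t - 0)) / (\<alpha> - \<eta>) - - exp ((\<alpha> - \<eta>) * (t - t)) / (\<alpha> - \<eta>)) = M * (1 - exp ((\<alpha> - \<eta>) * t)) / (\<alpha> - \<eta>)"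
      by (simp add: diff_divide_distrib right_diff_distrib)
    also have "\<dots> \<le> M * 1 / (\<alpha> - \<eta>)" using ae M by (intro divide_right_mono mult_left_mono) auto
    finally show "M * (- exp ((\<alpha> - \<eta>) * (t - 0)) / (\<alpha> - \<eta>) - - exp ((\<alpha> - \<eta>) * (t - t)) / (\<alpha> - \<eta>)) \<le> M / (\<alpha> - \<eta>)" by simp
  qed simp
  finally show ?thesis .
qed

text \<open>The case \<open>r = 0\<close> is the bound for the whole integral; the factor \<open>e\<^bsup>-(\<eta>-\<beta>)r\<^esup>\<close> makes truncated integrals
  converge uniformly, whence the continuity of \<open>conv2\<close>.\<close>

lemma conv2_tail:
  assumes F: "dominated F g M" and g: "weight g" and M: "M \<ge> 0" and t: "t \<le> 0" and r: "r \<ge> 0"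
  shows "(\<lambda>s. K2 (t - s) (F s)) integrable_on {..t - r}"
    and "p (integral {..t - r} (\<lambda>s. K2 (t - s) (F s))) \<le> exp (\<eta> * t) * exp (- (\<eta> - \<beta>) * r) * (mass g + M / (\<eta> - \<beta>))"
proof -
  have ae: "\<eta> - \<beta> > 0" using rates by simp
  have gi: "(g has_integral integral {..t - r} g) {..t - r}"
    using nonneg_integrable_subset(1)[of g "{..0}" "{..t - r}"] g t r by (auto simp: weight_def)
  have gle: "integral {..t - r} g \<le> mass g"
    unfolding mass_def using nonneg_integrable_subset(2)[of g "{..0}" "{..t - r}"] g t r by (auto simp: weight_def)
  define C where "C = exp (\<eta> * t) * exp (- (\<eta> - \<beta>) * r)"
  have J: "((\<lambda>s. C * (g s + M * exp ((\<eta> - \<beta>) * (s - (t - r))))) has_integral C * (integral {..t - r} g + M * (1 / (\<eta> - \<beta>)))) {..t - r}"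
    by (intro has_integral_mult_right has_integral_add gi has_integral_exp_atMost ae)
  have le: "p (K2 (t - s) (F s)) \<le> C * (g s + M * exp ((\<eta> - \<beta>) * (s - (t - r))))" if s: "s \<in> {..t - r}" for s
  proof -
    have g0: "g s \<ge> 0" using g s t r by (auto simp: weight_def)
    have e1: "exp ((\<eta> - \<beta>) * (s - (t - r))) \<le> 1" using s ae by (simp add: mult_le_0_iff)
    have "p (K2 (t - s) (F s)) \<le> exp (\<beta> * (t - s)) * p (F s)" using s r by (intro p_K2) auto
    also have "\<dots> \<le> exp (\<beta> * (t - s)) * (exp (\<eta> * s) * (g s + M))"
      using F s t r by (intro mult_left_mono) (auto simp: dominated_def)
    also have "\<dots> = C * (exp ((\<eta> - \<beta>) * (s - (t - r))) * (g s + M))"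
      unfolding C_def mult.assoc[symmetric] exp_add[symmetric] by (simp add: algebra_simps)
    also have "\<dots> \<le> C * (1 * g s + M * exp ((\<eta> - \<beta>) * (s - (t - r))))"
      unfolding distrib_left using e1 g0 by (intro add_mono mult_right_mono mult_left_mono) (auto simp: mult.commute C_def)
    finally show ?thesis by simp
  qed
  show int: "(\<lambda>s. K2 (t - s) (F s)) integrable_on {..t - r}"
  proof (rule integrable_on_all_intervals_integrable_bound)
    fix a b :: real
    have "(\<lambda>s. K2 (t - s) (F s)) integrable_on {a..min b (t - r)}"
      using F r t by (intro integrable_continuous_interval continuous_on_K2 continuous_intros) 
        (auto simp: dominated_def intro: continuous_on_subset)
    then have "(\<lambda>s. if s \<in> {a..min b (t - r)} then K2 (t - s) (F s) else 0) integrable_on cbox a b"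
      by (subst integrable_restrict_Int) (simp add: Int_absorb1 subset_iff)
    then show "(\<lambda>s. if s \<in> {..t - r} then K2 (t - s) (F s) else 0) integrable_on cbox a b"
      by (rule integrable_eq) auto
  next
    show "norm (K2 (t - s) (F s)) \<le> C * (g s + M * exp ((\<eta> - \<beta>) * (s - (t - r)))) / sqrt c0" if "s \<in> {..t - r}" for s
      by (rule order_trans[OF norm_le_p divide_right_mono[OF le[OF that]]]) (use c0 in simp)
    show "(\<lambda>s. C * (g s + M * exp ((\<eta> - \<beta>) * (s - (t - r)))) / sqrt c0) integrable_on {..t - r}"
      using has_integral_divide[OF J, of "sqrt c0"] by (auto simp: integrable_on_def)
  qed
  have "p (integral {..t - r} (\<lambda>s. K2 (t - s) (F s))) \<le> C * (integral {..t - r} g + M * (1 / (\<eta> - \<beta>)))"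
    by (rule p_integral_le[OF integrable_integral[OF int] J le])
  also have "\<dots> \<le> C * (mass g + M / (\<eta> - \<beta>))"
    using gle by (intro mult_left_mono) (auto simp: C_def)
  finally show "p (integral {..t - r} (\<lambda>s. K2 (t - s) (F s))) \<le> exp (\<eta> * t) * exp (- (\<eta> - \<beta>) * r) * (mass g + M / (\<eta> - \<beta>))"
    by (simp add: C_def)
qed

lemma conv2_has_integral:
  assumes "dominated F g M" "weight g" "M \<ge> 0" "t \<le> 0"
  shows "((\<lambda>s. K2 (t - s) (F s)) has_integral conv2 F t) {..t}"
  using conv2_tail(1)[OF assms, of 0] unfolding conv2_def by (simp add: integrable_integral)

lemma p_conv2_le:
  assumes "dominated F g M" "weight g" "M \<ge> 0" "t \<le> 0"
  shows "p (conv2 F t) \<le> exp (\<eta> * t) * (mass g + M / (\<eta> - \<beta>))"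
  using conv2_tail(2)[OF assms, of 0] unfolding conv2_def by simp

text \<open>Both the limit of integration and the integrand depend on \<open>t\<close>; the substitution \<open>s = t r\<close> moves the
  dependence into the integrand.\<close>

lemma continuous_on_conv1:
  assumes F: "continuous_on {..0} F"
  shows "continuous_on {..0} (conv1 F)"
proof -
  have "continuous_on {..0} (\<lambda>t. integral (cbox 0 1) (\<lambda>r. K1 (t - t * r) (F (t * r))))"
  proof (rule integral_continuous_on_param)
    have cF: "continuous_on ({..0} \<times> cbox 0 1) (\<lambda>z. F (fst z * snd z))"
      by (rule continuous_on_compose2[OF F]) (auto intro!: continuous_intros simp: mult_nonpos_nonneg)
    have "continuous_on ({..0} \<times> cbox 0 1) (\<lambda>z. K1 (fst z - fst z * snd z) (F (fst z * snd z)))"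
    proof (rule continuous_on_K1[OF _ _ cF])
      show "(\<lambda>z. fst z - fst z * snd z) ` ({..0} \<times> cbox 0 1) \<subseteq> {..0::real}"
      proof clarsimp
        fix a b :: real assume "a \<le> 0" "0 \<le> b" "b \<le> 1"
        then have "a * (1 - b) \<le> 0" by (intro mult_nonpos_nonneg) auto
        then show "a \<le> a * b" by (simp add: algebra_simps)
      qed
    qed (intro continuous_intros)
    then show "continuous_on ({..0} \<times> cbox 0 1) (\<lambda>(t, r). K1 (t - t * r) (F (t * r)))"
      by (simp add: case_prod_beta)
  qed
  then have "continuous_on {..0} (\<lambda>t. (- t) *\<^sub>R integral (cbox 0 1) (\<lambda>r. K1 (t - t * r) (F (t * r))))"
    by (intro continuous_intros)
  moreover have "(- t) *\<^sub>R integral (cbox 0 1) (\<lambda>r. K1 (t - t * r) (F (t * r))) = conv1 F t" if "t \<in> {..0}" for t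
  proof (cases "t = 0")
    case False
    then have t: "t < 0" using that by simp
    have "((\<lambda>r. K1 (t - t * r) (F (t * r))) has_integral (1 / \<bar>t\<bar>) *\<^sub>R conv1 F t) ((\<lambda>x. (1 / t) * x) ` {t..0})"
      using has_integral_affinity[of "\<lambda>s. K1 (t - s) (F s)" "conv1 F t" t 0 t 0] conv1_has_integral[OF F, of t] t by simp
    moreover have "(\<lambda>x. (1 / t) * x) ` {t..0} = {0..1}"
    proof
      show "(\<lambda>x. (1 / t) * x) ` {t..0} \<subseteq> {0..1}" using t by (auto simp: divide_le_eq zero_le_divide_iff)
      show "{0..1} \<subseteq> (\<lambda>x. (1 / t) * x) ` {t..0}"
      proof
        fix r :: real assume "r \<in> {0..1}"
        then have "r = (1 / t) * (t * r)" "t * r \<in> {t..0}"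
          using t mult_left_mono_neg[of r 1 t] by (auto simp: mult_nonpos_nonneg)
        then show "r \<in> (\<lambda>x. (1 / t) * x) ` {t..0}" by blast
      qed
    qed
    ultimately have "integral (cbox 0 1) (\<lambda>r. K1 (t - t * r) (F (t * r))) = (1 / \<bar>t\<bar>) *\<^sub>R conv1 F t"
      by (simp add: integral_unique)
    then show ?thesis using t by simp
  qed (simp add: conv1_def)
  ultimately show ?thesis by (rule continuous_on_eq)
qed

text \<open>The integral over \<open>[t - n, t]\<close> becomes one over \<open>[0, n]\<close> with a parameter, and \<open>e\<^bsup>-\<eta>t\<^esup>\<close> times the
  remainder tends to \<open>0\<close> uniformly in \<open>t \<le> 0\<close>.\<close>

lemma continuous_on_conv2:
  assumes F: "dominated F g M" and g: "weight g" and M: "M \<ge> 0"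
  shows "continuous_on {..0} (conv2 F)"
proof -
  have cF: "continuous_on {..0} F" using F by (simp add: dominated_def)
  define u where "u n t = integral (cbox 0 (real n)) (\<lambda>r. K2 r (F (t - r)))" for n t
  have cu: "continuous_on {..0} (u n)" for n
    unfolding u_def
  proof (rule integral_continuous_on_param)
    have cF': "continuous_on ({..0} \<times> cbox 0 (real n)) (\<lambda>z. F (fst z - snd z))"
      by (rule continuous_on_compose2[OF cF]) (auto intro!: continuous_intros)
    have "continuous_on ({..0} \<times> cbox 0 (real n)) (\<lambda>z. K2 (snd z) (F (fst z - snd z)))"
      by (rule continuous_on_K2[OF _ _ cF']) (auto intro!: continuous_intros)
    then show "continuous_on ({..0} \<times> cbox 0 (real n)) (\<lambda>(t, r). K2 r (F (t - r)))"
      by (simp add: case_prod_beta)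
  qed
  have diff: "conv2 F t - u n t = integral {..t - real n} (\<lambda>s. K2 (t - s) (F s))" if t: "t \<le> 0" for n t
  proof -
    have i: "(\<lambda>s. K2 (t - s) (F s)) integrable_on {t - real n..t}"
      using t by (intro integrable_continuous_interval continuous_on_K2 continuous_intros continuous_on_subset[OF cF]) auto
    have "conv2 F t = integral ({..t - real n} \<union> {t - real n..t}) (\<lambda>s. K2 (t - s) (F s))"
      unfolding conv2_def by (rule arg_cong[where f = "\<lambda>A. integral A _"]) auto
    also have "\<dots> = integral {..t - real n} (\<lambda>s. K2 (t - s) (F s)) + integral {t - real n..t} (\<lambda>s. K2 (t - s) (F s))"
    proof (rule integral_Un[OF conv2_tail(1)[OF F g M t] i])
      have "{..t - real n} \<inter> {t - real n..t} \<subseteq> {t - real n}" by auto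
      then show "negligible ({..t - real n} \<inter> {t - real n..t})" by (rule negligible_subset[rotated]) simp
    qed simp
    also have "integral {t - real n..t} (\<lambda>s. K2 (t - s) (F s)) = u n t"
    proof -
      have "((\<lambda>r. K2 (t - (- 1 *\<^sub>R r + t)) (F (- 1 *\<^sub>R r + t))) has_integral
          (1 / \<bar>- 1\<bar> ^ DIM(real)) *\<^sub>R integral {t - real n..t} (\<lambda>s. K2 (t - s) (F s)))
          ((\<lambda>x. (1 / - 1) *\<^sub>R x + - ((1 / - 1) *\<^sub>R t)) ` cbox (t - real n) t)"
        by (rule has_integral_affinity) (use i in auto)
      moreover have "(\<lambda>x. (1 / - 1) *\<^sub>R x + - ((1 / - 1) *\<^sub>R t)) ` cbox (t - real n) t = cbox 0 (real n)"
      proof -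
        have "(\<lambda>x. t - x) ` {t - real n..t} = {0..real n}"
          by (auto simp: image_iff)
        then show ?thesis by (simp add: algebra_simps)
      qed
      ultimately show ?thesis unfolding u_def by (simp add: integral_unique)
    qed
    finally show ?thesis by simp
  qed
  define C where "C = (mass g + M / (\<eta> - \<beta>)) / sqrt c0"
  have C: "C \<ge> 0" using mass_nonneg[OF g] M rates c0 by (simp add: C_def)
  have "uniform_limit {..0} (\<lambda>n t. exp (- \<eta> * t) *\<^sub>R u n t) (\<lambda>t. exp (- \<eta> * t) *\<^sub>R conv2 F t) sequentially"
  proof (rule uniform_limitI)
    fix e :: real assume e: "e > 0"
    have "(\<lambda>n. C * exp (- (\<eta> - \<beta>) * real n)) \<longlonglongrightarrow> C * 0"
      using rates by (intro tendsto_mult tendsto_const filterlim_compose[OF exp_at_bot] filterlim_tendsto_neg_mult_at_bot[OF tendsto_const] filterlim_real_sequentially) auto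
    then have "\<forall>\<^sub>F n in sequentially. C * exp (- (\<eta> - \<beta>) * real n) < e"
      using e by (auto dest: order_tendstoD)
    then show "\<forall>\<^sub>F n in sequentially. \<forall>t\<in>{..0}. dist (exp (- \<eta> * t) *\<^sub>R u n t) (exp (- \<eta> * t) *\<^sub>R conv2 F t) < e"
    proof eventually_elim
      case (elim n)
      show ?case
      proof
        fix t :: real assume "t \<in> {..0}"
        then have t: "t \<le> 0" by simp
        have "dist (exp (- \<eta> * t) *\<^sub>R u n t) (exp (- \<eta> * t) *\<^sub>R conv2 F t) = exp (- \<eta> * t) * norm (conv2 F t - u n t)"
          by (simp add: dist_norm norm_minus_commute flip: scaleR_diff_right)
        also have "\<dots> \<le> exp (- \<eta> * t) * (exp (\<eta> * t) * exp (- (\<eta> - \<beta>) * real n) * (mass g + M / (\<eta> - \<beta>)) / sqrt c0)"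
          unfolding diff[OF t] using c0
          by (intro mult_left_mono order_trans[OF norm_le_p] divide_right_mono conv2_tail(2)[OF F g M t]) auto
        also have "\<dots> = C * exp (- (\<eta> - \<beta>) * real n)"
          by (simp add: C_def exp_minus)
        also have "\<dots> < e" by (rule elim)
        finally show "dist (exp (- \<eta> * t) *\<^sub>R u n t) (exp (- \<eta> * t) *\<^sub>R conv2 F t) < e" .
      qed
    qed
  qed
  then have "continuous_on {..0} (\<lambda>t. exp (- \<eta> * t) *\<^sub>R conv2 F t)"
    by (rule uniform_limit_theorem[rotated]) (auto intro!: always_eventually continuous_intros cu)
  then have "continuous_on {..0} (\<lambda>t. exp (\<eta> * t) *\<^sub>R (exp (- \<eta> * t) *\<^sub>R conv2 F t))"
    by (rule continuous_on_scaleR[rotated]) (intro continuous_intros)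
  then show ?thesis
    by (rule continuous_on_eq) (simp only: scaleR_scaleR exp_add[symmetric], simp)
qed

lemma conv_cong:
  assumes "\<And>s. s \<le> 0 \<Longrightarrow> F s = F' s" "t \<le> 0"
  shows "conv1 F t = conv1 F' t" "conv2 F t = conv2 F' t"
  unfolding conv1_def conv2_def using assms by (auto intro!: integral_cong)

lemma conv_diff:
  assumes F: "dominated F g M" "weight g" "M \<ge> 0" and F': "dominated F' g' M'" "weight g'" "M' \<ge> 0" and t: "t \<le> 0"
  shows "conv1 F t - conv1 F' t = conv1 (\<lambda>s. F s - F' s) t" "conv2 F t - conv2 F' t = conv2 (\<lambda>s. F s - F' s) t"
proof -
  have c: "continuous_on {..0} F" "continuous_on {..0} F'" using F F' by (auto simp: dominated_def)
  have "((\<lambda>s. K1 (t - s) (F s) - K1 (t - s) (F' s)) has_integral conv1 F t - conv1 F' t) {t..0}"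
    by (intro has_integral_diff conv1_has_integral c t)
  then have "((\<lambda>s. K1 (t - s) (F s - F' s)) has_integral conv1 F t - conv1 F' t) {t..0}"
    by (rule has_integral_eq[rotated]) (simp add: linear_diff bounded_linear.linear[OF K1_linear])
  then show "conv1 F t - conv1 F' t = conv1 (\<lambda>s. F s - F' s) t" unfolding conv1_def[of "\<lambda>s. F s - F' s"] by (simp add: integral_unique)
  have "((\<lambda>s. K2 (t - s) (F s) - K2 (t - s) (F' s)) has_integral conv2 F t - conv2 F' t) {..t}"
    by (intro has_integral_diff conv2_has_integral[OF F t] conv2_has_integral[OF F' t])
  then have "((\<lambda>s. K2 (t - s) (F s - F' s)) has_integral conv2 F t - conv2 F' t) {..t}"
    by (rule has_integral_eq[rotated]) (simp add: linear_diff bounded_linear.linear[OF K2_linear])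
  then show "conv2 F t - conv2 F' t = conv2 (\<lambda>s. F s - F' s) t" unfolding conv2_def[of "\<lambda>s. F s - F' s"] by (simp add: integral_unique)
qed

subsection \<open>Fixed points\<close>

definition lp_map :: "(real \<Rightarrow> 'a) \<Rightarrow> (real \<Rightarrow> 'a) \<Rightarrow> real \<Rightarrow> 'a" where
  "lp_map y F t = y t - conv1 F t + conv2 F t"

lemma dominated_diff:
  assumes "continuous_on {..0} F" "continuous_on {..0} F'" "\<And>s. s \<le> 0 \<Longrightarrow> p (F s - F' s) \<le> exp (\<eta> * s) * (g s + M)"
  shows "dominated (\<lambda>s. F s - F' s) g M"
  using assms unfolding dominated_def by (auto intro!: continuous_intros)

lemma lp_map_diff:
  assumes F: "dominated F g1 M1" "weight g1" "M1 \<ge> 0" and F': "dominated F' g2 M2" "weight g2" "M2 \<ge> 0"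
    and d: "dominated (\<lambda>s. F s - F' s) g M" "weight g" "M \<ge> 0" and t: "t \<le> 0"
  shows "p (lp_map y F t - lp_map y F' t) \<le> exp (\<eta> * t) * (2 * mass g + M * (1 / (\<alpha> - \<eta>) + 1 / (\<eta> - \<beta>)))"
proof -
  have "lp_map y F t - lp_map y F' t = conv2 (\<lambda>s. F s - F' s) t - conv1 (\<lambda>s. F s - F' s) t"
    unfolding lp_map_def conv_diff[OF F F' t, symmetric] by simp
  also have "p \<dots> \<le> exp (\<eta> * t) * (mass g + M / (\<eta> - \<beta>)) + exp (\<eta> * t) * (mass g + M / (\<alpha> - \<eta>))"
    by (rule order_trans[OF p_diff add_mono[OF p_conv2_le[OF d t] p_conv1_le[OF d t]]])
  also have "\<dots> = exp (\<eta> * t) * (2 * mass g + M * (1 / (\<alpha> - \<eta>) + 1 / (\<eta> - \<beta>)))"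
    by (simp add: algebra_simps)
  finally show ?thesis .
qed

definition tempered :: "(real \<Rightarrow> 'a) \<Rightarrow> bool" where
  "tempered U \<longleftrightarrow> continuous_on {..0} U \<and> (\<exists>C\<ge>0. \<forall>t\<le>0. p (U t) \<le> exp (\<eta> * t) * C)"

lemma continuous_on_lipschitz_p:
  assumes G: "\<And>x y. p (G x - G y) \<le> L * p (x - y)"
  shows "continuous_on A G"
  unfolding continuous_on_def
proof
  fix x
  have "((\<lambda>z. L * p (z - x) / sqrt c0) \<longlongrightarrow> L * p (x - x) / sqrt c0) (at x within A)"
    using c0 by (intro tendsto_intros tendsto_p) auto
  then have "((\<lambda>z. L * p (z - x) / sqrt c0) \<longlongrightarrow> 0) (at x within A)" by simp
  then have "((\<lambda>z. G z - G x) \<longlongrightarrow> 0) (at x within A)"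
    by (rule Lim_null_comparison[OF always_eventually, rotated])
       (use c0 in \<open>auto intro!: order_trans[OF norm_le_p] divide_right_mono G\<close>)
  then show "(G \<longlongrightarrow> G x) (at x within A)" by (rule LIM_zero_cancel)
qed

text \<open>The value \<open>G 0\<close> is harmless because \<open>\<eta> \<le> 0\<close> makes constants tempered on the negative half-line.\<close>

lemma tempered_dominated:
  assumes b: "dominated b g 0" and G: "\<And>x y. p (G x - G y) \<le> L * p (x - y)" and L: "L \<ge> 0" and U: "tempered U"
  shows "\<exists>M\<ge>0. dominated (\<lambda>s. b s + G (U s)) g M"
proof -
  obtain C where C: "C \<ge> 0" "\<And>t. t \<le> 0 \<Longrightarrow> p (U t) \<le> exp (\<eta> * t) * C" using U by (auto simp: tempered_def)
  have cU: "continuous_on {..0} U" using U by (simp add: tempered_def)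
  have "p (b s + G (U s)) \<le> exp (\<eta> * s) * (g s + (L * C + p (G 0)))" if s: "s \<le> 0" for s
  proof -
    have e1: "1 \<le> exp (\<eta> * s)" using rates(3) s by (simp add: mult_nonpos_nonpos)
    have "p (G (U s)) \<le> p (G (U s) - G 0) + p (G 0)" using p_add[of "G (U s) - G 0" "G 0"] by simp
    also have "\<dots> \<le> L * (exp (\<eta> * s) * C) + exp (\<eta> * s) * p (G 0)"
    proof (intro add_mono)
      show "p (G (U s) - G 0) \<le> L * (exp (\<eta> * s) * C)"
        using G[of "U s" 0] mult_left_mono[OF C(2)[OF s] L] by simp
      show "p (G 0) \<le> exp (\<eta> * s) * p (G 0)" using mult_right_mono[OF e1 p_nonneg] by simp
    qed
    finally show ?thesis
      using p_add[of "b s" "G (U s)"] b s by (auto simp: dominated_def algebra_simps intro: order_trans)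
  qed
  moreover have "continuous_on {..0} (\<lambda>s. b s + G (U s))"
    using b by (intro continuous_intros continuous_on_compose2[OF continuous_on_lipschitz_p[OF G] cU]) (auto simp: dominated_def)
  ultimately have "dominated (\<lambda>s. b s + G (U s)) g (L * C + p (G 0))" by (simp add: dominated_def)
  moreover have "L * C + p (G 0) \<ge> 0" using C L by simp
  ultimately show ?thesis by blast
qed

definition kappa :: "real \<Rightarrow> real" where "kappa L = L * (1 / (\<alpha> - \<eta>) + 1 / (\<eta> - \<beta>))"

lemma kappa_nonneg: "L \<ge> 0 \<Longrightarrow> kappa L \<ge> 0"
  using rates by (simp add: kappa_def)

lemma lp_map_contraction:
  assumes b: "dominated b g 0" "weight g" and b': "dominated b' g' 0" "weight g'"
    and d: "weight k" "\<And>s. s \<le> 0 \<Longrightarrow> p (b s - b' s) \<le> exp (\<eta> * s) * k s"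
    and G: "\<And>x y. p (G x - G y) \<le> L * p (x - y)" and L: "L \<ge> 0"
    and U: "tempered U" and V: "tempered V" and D: "D \<ge> 0" "\<And>s. s \<le> 0 \<Longrightarrow> p (U s - V s) \<le> exp (\<eta> * s) * D"
  shows "dominated (\<lambda>s. (b s + G (U s)) - (b' s + G (V s))) k (L * D)"
    and "t \<le> 0 \<Longrightarrow> p (lp_map y (\<lambda>s. b s + G (U s)) t - lp_map y (\<lambda>s. b' s + G (V s)) t) \<le> exp (\<eta> * t) * (2 * mass k + kappa L * D)"
proof -
  obtain M1 where M1: "M1 \<ge> 0" "dominated (\<lambda>s. b s + G (U s)) g M1"
    using tempered_dominated[OF b(1) G L U] by blast
  obtain M2 where M2: "M2 \<ge> 0" "dominated (\<lambda>s. b' s + G (V s)) g' M2"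
    using tempered_dominated[OF b'(1) G L V] by blast
  show dom: "dominated (\<lambda>s. (b s + G (U s)) - (b' s + G (V s))) k (L * D)"
  proof (rule dominated_diff)
    fix s :: real assume s: "s \<le> 0"
    have "p ((b s + G (U s)) - (b' s + G (V s))) = p ((b s - b' s) + (G (U s) - G (V s)))" by (simp add: algebra_simps)
    also have "\<dots> \<le> p (b s - b' s) + p (G (U s) - G (V s))" by (rule p_add)
    also have "\<dots> \<le> exp (\<eta> * s) * k s + L * (exp (\<eta> * s) * D)"
      using d(2)[OF s] G[of "U s" "V s"] mult_left_mono[OF D(2)[OF s] L] by linarith
    finally show "p ((b s + G (U s)) - (b' s + G (V s))) \<le> exp (\<eta> * s) * (k s + L * D)"
      by (simp add: algebra_simps)
  qed (use M1 M2 in \<open>auto simp: dominated_def\<close>)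
  show "p (lp_map y (\<lambda>s. b s + G (U s)) t - lp_map y (\<lambda>s. b' s + G (V s)) t) \<le> exp (\<eta> * t) * (2 * mass k + kappa L * D)"
    if t: "t \<le> 0"
    using lp_map_diff[OF M1(2) b(2) M1(1) M2(2) b'(2) M2(1) dom d(1) _ t, of y] D(1) L
    by (simp add: kappa_def mult_ac)
qed

definition solves :: "(real \<Rightarrow> 'a) \<Rightarrow> (real \<Rightarrow> 'a) \<Rightarrow> ('a \<Rightarrow> 'a) \<Rightarrow> (real \<Rightarrow> 'a) \<Rightarrow> bool" where
  "solves y b G U \<longleftrightarrow> tempered U \<and> (\<forall>t\<le>0. U t = lp_map y (\<lambda>s. b s + G (U s)) t)"

lemma solves_cong:
  assumes "\<And>s. s \<le> 0 \<Longrightarrow> U s = V s" and U: "solves y b G U"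
  shows "solves y b G V"
proof -
  have "tempered V"
  proof -
    have "tempered U" using U by (simp add: solves_def)
    then show ?thesis
      using assms(1) unfolding tempered_def by (auto intro: continuous_on_eq)
  qed
  moreover have "lp_map y (\<lambda>s. b s + G (V s)) t = lp_map y (\<lambda>s. b s + G (U s)) t" if "t \<le> 0" for t
    unfolding lp_map_def using that assms(1) by (intro arg_cong2[where f = "(+)"] arg_cong2[where f = "(-)"] conv_cong refl) auto
  ultimately show ?thesis using U assms(1) by (simp add: solves_def)
qed

lemma tempered_bounded_diff:
  assumes "tempered U" "tempered V"
  shows "\<exists>D\<ge>0. (\<forall>s\<le>0. p (U s - V s) \<le> exp (\<eta> * s) * D)"
proof -
  obtain C where C: "C \<ge> 0" "\<And>t. t \<le> 0 \<Longrightarrow> p (U t) \<le> exp (\<eta> * t) * C" using assms by (auto simp: tempered_def)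
  obtain C' where C': "C' \<ge> 0" "\<And>t. t \<le> 0 \<Longrightarrow> p (V t) \<le> exp (\<eta> * t) * C'" using assms by (auto simp: tempered_def)
  show ?thesis
    by (rule exI[of _ "C + C'"])
       (use C C' in \<open>auto simp: distrib_left intro!: order_trans[OF p_diff] add_mono\<close>)
qed

text \<open>The weighted distance \<open>D\<close> of two solutions satisfies \<open>D \<le> 2 mass k + \<kappa> D\<close>; it is finite because both
  solutions are tempered, so \<open>D\<close> can be absorbed.\<close>

lemma solutions_close:
  assumes b: "dominated b g 0" "weight g" and b': "dominated b' g' 0" "weight g'"
    and d: "weight k" "\<And>s. s \<le> 0 \<Longrightarrow> p (b s - b' s) \<le> exp (\<eta> * s) * k s"
    and G: "\<And>x y. p (G x - G y) \<le> L * p (x - y)" and L: "L \<ge> 0" "kappa L < 1"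
    and U: "solves y b G U" and V: "solves y b' G V" and s: "s \<le> 0"
  shows "p (U s - V s) \<le> exp (\<eta> * s) * (2 * mass k / (1 - kappa L))"
proof -
  have tU: "tempered U" and tV: "tempered V" using U V by (auto simp: solves_def)
  define A where "A = (\<lambda>s. exp (- \<eta> * s) * p (U s - V s)) ` {..0}"
  have Ale: "exp (- \<eta> * s) * p (U s - V s) \<le> D \<longleftrightarrow> p (U s - V s) \<le> exp (\<eta> * s) * D" for D s
    by (simp add: exp_minus field_simps)
  obtain D0 where "\<And>s. s \<le> 0 \<Longrightarrow> p (U s - V s) \<le> exp (\<eta> * s) * D0"
    using tempered_bounded_diff[OF tU tV] by blast
  then have "a \<le> D0" if "a \<in> A" for a
    using that unfolding A_def by (elim imageE) (simp only: Ale atMost_iff)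
  then have bdd: "bdd_above A" by (rule bdd_aboveI)
  define D where "D = Sup A"
  have D: "p (U s - V s) \<le> exp (\<eta> * s) * D" if "s \<le> 0" for s
    unfolding Ale[symmetric] D_def by (rule cSup_upper[OF _ bdd]) (use that in \<open>auto simp: A_def\<close>)
  have D0: "D \<ge> 0"
    using order_trans[OF p_nonneg D[of 0]] by simp
  have "D \<le> 2 * mass k + kappa L * D"
    unfolding D_def
  proof (rule cSup_least)
    fix a assume "a \<in> A"
    then obtain t where t: "t \<le> 0" "a = exp (- \<eta> * t) * p (U t - V t)" by (auto simp: A_def)
    have "p (U t - V t) \<le> exp (\<eta> * t) * (2 * mass k + kappa L * D)"
      using lp_map_contraction(2)[OF b b' d G L(1) tU tV D0 D t(1), of y] U V t(1) by (simp add: solves_def)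
    then show "a \<le> 2 * mass k + kappa L * Sup A" unfolding t(2) Ale D_def .
  qed (simp add: A_def)
  then have "D \<le> 2 * mass k / (1 - kappa L)" using L by (simp add: field_simps)
  then show ?thesis by (intro order_trans[OF D[OF s]] mult_left_mono) auto
qed

lemma weight_0: "weight (\<lambda>_. 0)" and mass_0: "mass (\<lambda>_. 0) = 0"
  by (simp_all add: weight_def mass_def integrable_0)

lemma solution_unique:
  assumes b: "dominated b g 0" "weight g" and G: "\<And>x y. p (G x - G y) \<le> L * p (x - y)" and L: "L \<ge> 0" "kappa L < 1"
    and U: "solves y b G U" and V: "solves y b G V" and s: "s \<le> 0"
  shows "U s = V s"
proof -
  have "p (U s - V s) \<le> 0"
    using solutions_close[OF b b weight_0 _ G L U V s] by (simp add: mass_0)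
  then have "p (U s - V s) = 0" using p_nonneg[of "U s - V s"] by linarith
  then show ?thesis using p_eq_0 by fastforce
qed

lemma tempered_lp_map:
  assumes y: "tempered y" and b: "dominated b g 0" "weight g"
    and G: "\<And>x y. p (G x - G y) \<le> L * p (x - y)" and L: "L \<ge> 0" and U: "tempered U"
  shows "tempered (lp_map y (\<lambda>s. b s + G (U s)))"
proof -
  obtain M where M: "M \<ge> 0" "dominated (\<lambda>s. b s + G (U s)) g M" using tempered_dominated[OF b(1) G L U] by blast
  obtain C where C: "C \<ge> 0" "\<And>t. t \<le> 0 \<Longrightarrow> p (y t) \<le> exp (\<eta> * t) * C" using y by (auto simp: tempered_def)
  have c: "continuous_on {..0} (\<lambda>s. b s + G (U s))" using M by (simp add: dominated_def)
  have "continuous_on {..0} (lp_map y (\<lambda>s. b s + G (U s)))"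
    unfolding lp_map_def[abs_def] using y
    by (intro continuous_intros continuous_on_conv1[OF c] continuous_on_conv2[OF M(2) b(2) M(1)]) (auto simp: tempered_def)
  moreover have "p (lp_map y (\<lambda>s. b s + G (U s)) t) \<le> exp (\<eta> * t) * (C + (mass g + M / (\<alpha> - \<eta>)) + (mass g + M / (\<eta> - \<beta>)))" if t: "t \<le> 0" for t
    unfolding lp_map_def distrib_left
    by (intro order_trans[OF p_add] add_mono order_trans[OF p_diff] C t p_conv1_le[OF M(2) b(2) M(1) t, unfolded distrib_left] p_conv2_le[OF M(2) b(2) M(1) t, unfolded distrib_left])
  moreover have "0 \<le> C + (mass g + M / (\<alpha> - \<eta>)) + (mass g + M / (\<eta> - \<beta>))"
    using C M rates mass_nonneg[OF b(2)] by simp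
  ultimately show ?thesis unfolding tempered_def by blast
qed

text \<open>Picard iteration from \<open>0\<close>. The increments decrease geometrically in the weighted norm, so the iterates
  converge uniformly after multiplication by \<open>e\<^bsup>-\<eta>t\<^esup>\<close>.\<close>

lemma solution_exists:
  assumes y: "tempered y" and b: "dominated b g 0" "weight g"
    and G: "\<And>x y. p (G x - G y) \<le> L * p (x - y)" and L: "L \<ge> 0" "kappa L < 1"
  shows "\<exists>U. solves y b G U"
proof -
  define \<kappa> where "\<kappa> = kappa L"
  have \<kappa>: "0 \<le> \<kappa>" "\<kappa> < 1" using L kappa_nonneg by (auto simp: \<kappa>_def)
  define T where "T U = lp_map y (\<lambda>s. b s + G (U s))" for U
  define u where "u n = (T ^^ n) (\<lambda>_. 0)" for n
  have uS: "u (Suc n) = T (u n)" for n by (simp add: u_def)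
  have t0: "tempered (\<lambda>_. 0)" by (auto simp: tempered_def)
  have tu: "tempered (u n)" for n
    by (induction n) (simp add: u_def t0, simp add: uS T_def tempered_lp_map[OF y b G L(1)])
  have contr: "p (T U t - T V t) \<le> exp (\<eta> * t) * (\<kappa> * D)"
    if "tempered U" "tempered V" "D \<ge> 0" "\<And>s. s \<le> 0 \<Longrightarrow> p (U s - V s) \<le> exp (\<eta> * s) * D" "t \<le> 0" for U V D t
    using lp_map_contraction(2)[OF b b weight_0 _ G L(1) that] unfolding T_def \<kappa>_def by (simp add: mass_0)
  obtain C where C: "C \<ge> 0" "\<And>s. s \<le> 0 \<Longrightarrow> p (u 1 s - u 0 s) \<le> exp (\<eta> * s) * C"
    using tempered_bounded_diff[OF tu[of 1] tu[of 0]] by blast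
  have step: "p (u (Suc n) s - u n s) \<le> exp (\<eta> * s) * (\<kappa> ^ n * C)" if "s \<le> 0" for n s
    using that
  proof (induction n arbitrary: s)
    case 0 then show ?case using C(2)[of s] by simp
  next
    case (Suc n)
    show ?case
      using contr[OF tu tu _ Suc.IH Suc.prems] C(1) \<kappa> by (simp add: uS mult_ac)
  qed
  \<comment> \<open>A bound for the distance of the \<open>n\<close>-th iterate from the limit: the tail of the geometric series.\<close>
  define E where "E n = \<kappa> ^ n * (C / (1 - \<kappa>))" for n
  have E0: "E n \<ge> 0" for n using C \<kappa> by (simp add: E_def)
  have far: "p (u (n + k) s - u n s) \<le> exp (\<eta> * s) * (E n - E (n + k))" if "s \<le> 0" for n k s
  proof (induction k)
    case (Suc k)
    have "p (u (n + Suc k) s - u n s) \<le> p (u (Suc (n + k)) s - u (n + k) s) + p (u (n + k) s - u n s)"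
      using p_triangle[of "u (Suc (n + k)) s" "u n s" "u (n + k) s"] by simp
    also have "\<dots> \<le> exp (\<eta> * s) * (\<kappa> ^ (n + k) * C) + exp (\<eta> * s) * (E n - E (n + k))"
      by (intro add_mono step Suc.IH that)
    also have "\<dots> = exp (\<eta> * s) * (\<kappa> ^ (n + k) * C + E n - E (n + k))" by (simp add: algebra_simps)
    also have "\<kappa> ^ (n + k) * C + E n - E (n + k) = E n - E (n + Suc k)"
      using \<kappa> by (simp add: E_def field_simps)
    finally show ?case .
  qed simp
  have far': "p (u m s - u n s) \<le> exp (\<eta> * s) * E n" if "s \<le> 0" "n \<le> m" for m n s
  proof -
    have "p (u m s - u n s) \<le> exp (\<eta> * s) * (E n - E m)" using far[OF that(1), of n "m - n"] that(2) by simp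
    also have "\<dots> \<le> exp (\<eta> * s) * E n" using E0[of m] by (intro mult_left_mono) auto
    finally show ?thesis .
  qed
  have Elim: "E \<longlonglongrightarrow> 0"
    unfolding E_def using \<kappa> by (intro tendsto_mult_left_zero LIMSEQ_power_zero) auto
  have conv: "convergent (\<lambda>n. u n s)" if s: "s \<le> 0" for s
  proof -
    have "Cauchy (\<lambda>n. u n s)"
    proof (rule metric_CauchyI)
      fix e :: real assume e: "e > 0"
      have "(\<lambda>n. exp (\<eta> * s) * E n / sqrt c0) \<longlonglongrightarrow> exp (\<eta> * s) * 0 / sqrt c0"
        using c0 by (intro tendsto_intros Elim) auto
      then have "\<forall>\<^sub>F n in sequentially. exp (\<eta> * s) * E n / sqrt c0 < e / 2"
        using e by (intro order_tendstoD) auto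
      then obtain n where n: "exp (\<eta> * s) * E n / sqrt c0 < e / 2" by (auto simp: eventually_sequentially)
      have "dist (u m s) (u n s) < e / 2" if "m \<ge> n" for m
        unfolding dist_norm
        by (rule le_less_trans[OF order_trans[OF norm_le_p divide_right_mono[OF far'[OF s that]]] n]) (use c0 in simp)
      then show "\<exists>M. \<forall>m\<ge>M. \<forall>k\<ge>M. dist (u m s) (u k s) < e"
        by (meson dist_triangle_half_l dist_commute dist_triangle_half_r)
    qed
    then show ?thesis by (rule Cauchy_convergent)
  qed
  define U where "U s = lim (\<lambda>n. u n s)" for s
  have lim: "(\<lambda>n. u n s) \<longlonglongrightarrow> U s" if "s \<le> 0" for s
    using conv[OF that] by (simp add: U_def convergent_LIMSEQ_iff)
  have Uu: "p (U s - u n s) \<le> exp (\<eta> * s) * E n" if s: "s \<le> 0" for s n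
  proof (rule LIMSEQ_le_const2)
    show "(\<lambda>m. p (u m s - u n s)) \<longlonglongrightarrow> p (U s - u n s)" by (intro tendsto_p tendsto_intros lim s)
  qed (use far' s in blast)
  have unif: "uniform_limit {..0} (\<lambda>n s. exp (- \<eta> * s) *\<^sub>R u n s) (\<lambda>s. exp (- \<eta> * s) *\<^sub>R U s) sequentially"
  proof (rule uniform_limitI)
    fix e :: real assume e: "e > 0"
    have "(\<lambda>n. E n / sqrt c0) \<longlonglongrightarrow> 0 / sqrt c0" using c0 by (intro tendsto_intros Elim) auto
    then have "\<forall>\<^sub>F n in sequentially. E n / sqrt c0 < e" using e by (auto dest: order_tendstoD)
    then show "\<forall>\<^sub>F n in sequentially. \<forall>s\<in>{..0}. dist (exp (- \<eta> * s) *\<^sub>R u n s) (exp (- \<eta> * s) *\<^sub>R U s) < e"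
    proof eventually_elim
      case (elim n)
      show ?case
      proof
        fix s :: real assume "s \<in> {..0}"
        then have s: "s \<le> 0" by simp
        have "dist (exp (- \<eta> * s) *\<^sub>R u n s) (exp (- \<eta> * s) *\<^sub>R U s) = exp (- \<eta> * s) * norm (U s - u n s)"
          by (simp add: dist_norm norm_minus_commute flip: scaleR_diff_right)
        also have "\<dots> \<le> exp (- \<eta> * s) * (exp (\<eta> * s) * E n / sqrt c0)"
          using c0 by (intro mult_left_mono order_trans[OF norm_le_p] divide_right_mono Uu s) auto
        also have "\<dots> = E n / sqrt c0" by (simp add: exp_minus)
        finally show "dist (exp (- \<eta> * s) *\<^sub>R u n s) (exp (- \<eta> * s) *\<^sub>R U s) < e" using elim by simp
      qed
    qed
  qed
  have "continuous_on {..0} (\<lambda>s. exp (- \<eta> * s) *\<^sub>R U s)"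
    by (rule uniform_limit_theorem[OF _ unif]) (use tu in \<open>auto intro!: always_eventually continuous_intros simp: tempered_def\<close>)
  then have "continuous_on {..0} (\<lambda>t. exp (\<eta> * t) *\<^sub>R (exp (- \<eta> * t) *\<^sub>R U t))"
    by (rule continuous_on_scaleR[rotated]) (intro continuous_intros)
  then have cU: "continuous_on {..0} U"
    by (rule continuous_on_eq) (simp only: scaleR_scaleR exp_add[symmetric], simp)
  have tU: "tempered U"
    unfolding tempered_def using cU Uu[of _ 0] E0[of 0] by (auto simp: u_def intro!: exI[of _ "E 0"])
  have "U t = T U t" if t: "t \<le> 0" for t
  proof -
    have est: "p (U t - T U t) \<le> exp (\<eta> * t) * (E (Suc n) + \<kappa> * E n)" for n
    proof -
      have "p (U t - T U t) \<le> p (U t - u (Suc n) t) + p (T (u n) t - T U t)"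
        using p_triangle[of "U t" "T U t" "u (Suc n) t"] by (simp add: uS)
      also have "\<dots> \<le> exp (\<eta> * t) * E (Suc n) + exp (\<eta> * t) * (\<kappa> * E n)"
        using Uu by (intro add_mono Uu t contr tu tU E0) (auto simp: p_minus_commute[of "u n _"])
      finally show ?thesis by (simp add: algebra_simps)
    qed
    have l: "(\<lambda>n. exp (\<eta> * t) * (E (Suc n) + \<kappa> * E n)) \<longlonglongrightarrow> exp (\<eta> * t) * (0 + \<kappa> * 0)"
      by (intro tendsto_intros Elim LIMSEQ_Suc)
    have "p (U t - T U t) \<le> exp (\<eta> * t) * (0 + \<kappa> * 0)"
      by (rule LIMSEQ_le_const[OF l]) (use est in blast)
    then have "p (U t - T U t) = 0" using p_nonneg[of "U t - T U t"] by (simp add: order_antisym)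
    then show ?thesis using p_eq_0 by fastforce
  qed
  then show ?thesis using tU by (auto simp: solves_def T_def)
qed

lemma stable_part_close:
  assumes b: "dominated b g 0" "weight g" and b': "dominated b' g' 0" "weight g'"
    and d: "weight k" "\<And>s. s \<le> 0 \<Longrightarrow> p (b s - b' s) \<le> exp (\<eta> * s) * k s"
    and G: "\<And>x y. p (G x - G y) \<le> L * p (x - y)" and L: "L \<ge> 0" "kappa L < 1"
    and U: "solves y b G U" and V: "solves y b' G V"
  shows "p (conv2 (\<lambda>s. b s + G (U s)) 0 - conv2 (\<lambda>s. b' s + G (V s)) 0) \<le> (1 + 2 * L / ((1 - kappa L) * (\<eta> - \<beta>))) * mass k"
proof -
  have tU: "tempered U" and tV: "tempered V" using U V by (auto simp: solves_def)
  obtain M1 where M1: "M1 \<ge> 0" "dominated (\<lambda>s. b s + G (U s)) g M1" using tempered_dominated[OF b(1) G L(1) tU] by blast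
  obtain M2 where M2: "M2 \<ge> 0" "dominated (\<lambda>s. b' s + G (V s)) g' M2" using tempered_dominated[OF b'(1) G L(1) tV] by blast
  define D where "D = 2 * mass k / (1 - kappa L)"
  have D0: "D \<ge> 0" using L mass_nonneg[OF d(1)] by (simp add: D_def)
  have dom: "dominated (\<lambda>s. (b s + G (U s)) - (b' s + G (V s))) k (L * D)"
    by (rule lp_map_contraction(1)[OF b b' d G L(1) tU tV D0])
       (use solutions_close[OF b b' d G L U V] in \<open>auto simp: D_def\<close>)
  have "conv2 (\<lambda>s. b s + G (U s)) 0 - conv2 (\<lambda>s. b' s + G (V s)) 0 = conv2 (\<lambda>s. (b s + G (U s)) - (b' s + G (V s))) 0"
    by (rule conv_diff(2)[OF M1(2) b(2) M1(1) M2(2) b'(2) M2(1)]) simp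
  also have "p \<dots> \<le> exp (\<eta> * 0) * (mass k + L * D / (\<eta> - \<beta>))"
    by (rule p_conv2_le[OF dom d(1)]) (use L D0 in auto)
  also have "\<dots> = (1 + 2 * L / ((1 - kappa L) * (\<eta> - \<beta>))) * mass k"
    using L rates by (simp add: D_def field_simps)
  finally show ?thesis .
qed

end


section \<open>The noise\<close>

lemma measurable_path_eval:
  assumes "wiener_measure W"
  shows "(\<lambda>\<omega>. \<omega> t) \<in> borel_measurable W"
proof -
  have "sets W = sets (restrict_space (Pi\<^sub>M UNIV (\<lambda>_. borel)) path_space)"
    using assms by (simp add: wiener_measure_def)
  moreover have "(\<lambda>\<omega>. \<omega> t) \<in> borel_measurable (restrict_space (Pi\<^sub>M UNIV (\<lambda>_. borel)) (path_space :: (real \<Rightarrow> real) set))"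
    by (intro measurable_restrict_space1 measurable_component_singleton) simp
  ultimately show ?thesis using measurable_cong_sets by blast
qed

text \<open>By continuity of paths the evaluation is the pointwise limit of evaluations at the grid points
  \<open>\<lfloor>(n+1) t\<rfloor>/(n+1)\<close>, and for each \<open>n\<close> these are countably many.\<close>

lemma measurable_path_eval_pair:
  assumes "wiener_measure W"
  shows "(\<lambda>(\<omega>, t). \<omega> t) \<in> borel_measurable (W \<Otimes>\<^sub>M lborel)"
proof (rule borel_measurable_LIMSEQ_real)
  have [measurable]: "(\<lambda>\<omega>. \<omega> t) \<in> borel_measurable W" for t by (rule measurable_path_eval[OF assms])
  show "(\<lambda>z. fst z (real_of_int \<lfloor>real (Suc n) * snd z\<rfloor> / real (Suc n))) \<in> borel_measurable (W \<Otimes>\<^sub>M lborel)" for n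
    by (rule measurable_compose_countable[where f = "\<lambda>i z. fst z (real_of_int i / real (Suc n))"]) measurable
  fix z :: "(real \<Rightarrow> real) \<times> real" assume "z \<in> space (W \<Otimes>\<^sub>M lborel)"
  then obtain \<omega> t where z: "z = (\<omega>, t)" "continuous_on UNIV \<omega>"
    using assms by (auto simp: space_pair_measure wiener_measure_def path_space_def)
  have "(\<lambda>n. real_of_int \<lfloor>real (Suc n) * t\<rfloor> / real (Suc n) - t) \<longlonglongrightarrow> 0"
  proof (rule Lim_null_comparison[OF always_eventually LIMSEQ_inverse_real_of_nat], rule allI)
    fix n
    have "real_of_int \<lfloor>real (Suc n) * t\<rfloor> / real (Suc n) - t = (real_of_int \<lfloor>real (Suc n) * t\<rfloor> - real (Suc n) * t) / real (Suc n)"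
      by (simp add: diff_divide_distrib del: of_nat_Suc)
    moreover have "\<bar>real_of_int \<lfloor>real (Suc n) * t\<rfloor> - real (Suc n) * t\<bar> \<le> 1"
      by linarith
    ultimately show "norm (real_of_int \<lfloor>real (Suc n) * t\<rfloor> / real (Suc n) - t) \<le> inverse (real (Suc n))"
      by (simp add: abs_divide inverse_eq_divide divide_right_mono del: of_nat_Suc)
  qed
  then have "(\<lambda>n. real_of_int \<lfloor>real (Suc n) * t\<rfloor> / real (Suc n)) \<longlonglongrightarrow> t" by (rule LIM_zero_cancel)
  moreover have "isCont \<omega> t" using z by (simp add: continuous_on_eq_continuous_at)
  ultimately have "(\<lambda>n. \<omega> (real_of_int \<lfloor>real (Suc n) * t\<rfloor> / real (Suc n))) \<longlonglongrightarrow> \<omega> t"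
    using isCont_tendsto_compose by blast
  then show "(\<lambda>n. fst z (real_of_int \<lfloor>real (Suc n) * snd z\<rfloor> / real (Suc n))) \<longlonglongrightarrow> (case z of (\<omega>, t) \<Rightarrow> \<omega> t)"
    by (simp add: z)
qed

lemma normal_second_moment:
  assumes "\<sigma> > 0"
  shows "(\<integral>\<^sup>+x. ennreal (normal_density 0 \<sigma> x) * ennreal (1 + x\<^sup>2) \<partial>lborel) = ennreal (1 + \<sigma>\<^sup>2)"
proof -
  have "has_bochner_integral lborel (\<lambda>x. normal_density 0 \<sigma> x * (x - 0) ^ (2 * 0) + normal_density 0 \<sigma> x * (x - 0) ^ (2 * 1))
     (fact (2 * 0) / ((2 / \<sigma>\<^sup>2)^0 * fact 0) + fact (2 * 1) / ((2 / \<sigma>\<^sup>2)^1 * fact 1))"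
    by (intro has_bochner_integral_add normal_moment_even assms)
  then have "has_bochner_integral lborel (\<lambda>x. normal_density 0 \<sigma> x * (1 + x\<^sup>2)) (1 + \<sigma>\<^sup>2)"
    using assms by (simp add: fact_numeral distrib_left power2_eq_square)
  then have "(\<integral>\<^sup>+x. ennreal (normal_density 0 \<sigma> x * (1 + x\<^sup>2)) \<partial>lborel) = ennreal (1 + \<sigma>\<^sup>2)"
    by (subst nn_integral_eq_integral) (auto simp: has_bochner_integral_iff)
  then show ?thesis by (simp add: ennreal_mult')
qed

text \<open>From \<open>\<bar>x\<bar> \<le> 1 + x\<^sup>2\<close> and the variance \<open>-t\<close> of the increment between \<open>t\<close> and \<open>0\<close>.\<close>

lemma wiener_first_moment:
  assumes W: "wiener_measure W" and t: "t \<le> 0"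
  shows "(\<integral>\<^sup>+\<omega>. ennreal \<bar>\<omega> t\<bar> \<partial>W) \<le> ennreal (1 - t)"
proof (cases "t = 0")
  case True
  have "(\<integral>\<^sup>+\<omega>. ennreal \<bar>\<omega> t\<bar> \<partial>W) = (\<integral>\<^sup>+\<omega>. 0 \<partial>W)"
    by (rule nn_integral_cong) (use W True in \<open>auto simp: wiener_measure_def path_space_def\<close>)
  then show ?thesis using t by simp
next
  case False
  then have t: "t < 0" using t by simp
  have d: "distributed W lborel (\<lambda>\<omega>. \<omega> 0 - \<omega> t) (\<lambda>x. ennreal (normal_density 0 (sqrt (0 - t)) x))"
    using W t unfolding wiener_measure_def by blast
  have "(\<integral>\<^sup>+\<omega>. ennreal \<bar>\<omega> t\<bar> \<partial>W) \<le> (\<integral>\<^sup>+\<omega>. ennreal (1 + (\<omega> 0 - \<omega> t)\<^sup>2) \<partial>W)"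
  proof (rule nn_integral_mono)
    fix \<omega> assume "\<omega> \<in> space W"
    then have "\<omega> 0 = 0" using W by (auto simp: wiener_measure_def path_space_def)
    moreover have "\<bar>x\<bar> \<le> 1 + x\<^sup>2" for x :: real
      using zero_le_power2[of "\<bar>x\<bar> - 1/2"] by (simp add: power2_eq_square algebra_simps)
    ultimately show "ennreal \<bar>\<omega> t\<bar> \<le> ennreal (1 + (\<omega> 0 - \<omega> t)\<^sup>2)" by (intro ennreal_leI) simp
  qed
  also have "\<dots> = (\<integral>\<^sup>+x. ennreal (normal_density 0 (sqrt (0 - t)) x) * ennreal (1 + x\<^sup>2) \<partial>lborel)"
    by (rule distributed_nn_integral[OF d, symmetric]) simp
  also have "\<dots> = ennreal (1 - t)"
    using t by (subst normal_second_moment) auto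
  finally show ?thesis .
qed

text \<open>By Tonelli's theorem the expected value of \<open>\<integral> e\<^bsup>cs\<^esup> \<bar>\<omega>(s)\<bar> ds\<close> is at most \<open>\<integral> (1 - s) e\<^bsup>cs\<^esup> ds\<close>. The constant
  \<open>1 + 2/c\<close> absorbs the factor \<open>1 - s\<close> into \<open>e\<^bsup>-cs/2\<^esup>\<close>.\<close>

lemma wiener_exp_integrable:
  assumes W: "wiener_measure W" and c: "c > 0"
  shows "AE \<omega> in W. set_integrable lborel {..0} (\<lambda>s. exp (c * s) * \<omega> s)"
proof -
  interpret W: prob_space W using W by (simp add: wiener_measure_def)
  interpret pair_sigma_finite W lborel ..
  note [measurable] = measurable_path_eval_pair[OF W] measurable_path_eval[OF W]
  define h where "h = (\<lambda>(\<omega>, s). ennreal (\<bar>\<omega> s\<bar>) * ennreal (exp (c * s) * indicator {..0} s))"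
  have mh: "h \<in> borel_measurable (W \<Otimes>\<^sub>M lborel)"
  proof -
    have "(\<lambda>z. ennreal \<bar>(\<lambda>(\<omega>, s). \<omega> s) z\<bar> * ennreal (exp (c * snd z) * indicator {..0} (snd z))) \<in> borel_measurable (W \<Otimes>\<^sub>M lborel)"
      by measurable
    then show ?thesis by (simp add: h_def case_prod_beta)
  qed
  have "(\<integral>\<^sup>+\<omega>. \<integral>\<^sup>+s. h (\<omega>, s) \<partial>lborel \<partial>W) = (\<integral>\<^sup>+s. \<integral>\<^sup>+\<omega>. h (\<omega>, s) \<partial>W \<partial>lborel)"
    using Fubini[OF mh] by simp
  also have "\<dots> \<le> (\<integral>\<^sup>+s. ennreal ((1 + 2 / c) * exp (c / 2 * (s - 0))) * indicator {..0} s \<partial>lborel)"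
  proof (rule nn_integral_mono)
    fix s :: real
    show "(\<integral>\<^sup>+\<omega>. h (\<omega>, s) \<partial>W) \<le> ennreal ((1 + 2 / c) * exp (c / 2 * (s - 0))) * indicator {..0} s"
    proof (cases "s \<le> 0")
      case True
      have "(\<integral>\<^sup>+\<omega>. h (\<omega>, s) \<partial>W) = (\<integral>\<^sup>+\<omega>. ennreal \<bar>\<omega> s\<bar> \<partial>W) * ennreal (exp (c * s))"
        using True by (simp add: h_def nn_integral_multc)
      also have "\<dots> \<le> ennreal (1 - s) * ennreal (exp (c * s))"
        by (intro mult_right_mono wiener_first_moment W True) simp
      also have "\<dots> = ennreal ((1 - s) * exp (c * s))" using True by (simp add: ennreal_mult)
      also have "\<dots> \<le> ennreal ((1 + 2 / c) * exp (c / 2 * (s - 0)))"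
      proof (rule ennreal_leI)
        have "1 - s \<le> (1 + 2 / c) * (1 - c / 2 * s)"
          using c True mult_nonneg_nonpos[of c "c * s"] mult_nonneg_nonpos[of c s] by (simp add: field_simps)
        also have "\<dots> \<le> (1 + 2 / c) * exp (- (c / 2 * s))"
          using c exp_ge_add_one_self[of "- (c / 2 * s)"] by (intro mult_left_mono) auto
        finally have "(1 - s) * exp (c * s) \<le> (1 + 2 / c) * exp (- (c / 2 * s)) * exp (c * s)"
          by (intro mult_right_mono) auto
        also have "\<dots> = (1 + 2 / c) * exp (c / 2 * (s - 0))"
          by (simp add: mult.assoc exp_add[symmetric])
        finally show "(1 - s) * exp (c * s) \<le> (1 + 2 / c) * exp (c / 2 * (s - 0))" .
      qed
      finally show ?thesis using True by simp
    qed (simp add: h_def)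
  qed
  also have "\<dots> = ennreal ((1 + 2 / c) * (1 / (c / 2)))"
  proof (rule nn_integral_has_integral_lebesgue')
    show "((\<lambda>s. (1 + 2 / c) * exp (c / 2 * (s - 0))) has_integral (1 + 2 / c) * (1 / (c / 2))) {..0}"
      using c by (intro has_integral_mult_right has_integral_exp_atMost) simp
  qed (use c in simp)
  finally have "(\<integral>\<^sup>+\<omega>. \<integral>\<^sup>+s. h (\<omega>, s) \<partial>lborel \<partial>W) \<noteq> \<infinity>" by (auto simp: top_unique)
  then have "AE \<omega> in W. (\<integral>\<^sup>+s. h (\<omega>, s) \<partial>lborel) \<noteq> \<infinity>"
    by (rule nn_integral_PInf_AE[rotated]) (use mh in \<open>intro lborel.borel_measurable_nn_integral_fst, simp\<close>)
  then show ?thesis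
  proof (rule AE_mp, intro AE_I2 impI)
    fix \<omega> assume w: "\<omega> \<in> space W" "(\<integral>\<^sup>+s. h (\<omega>, s) \<partial>lborel) \<noteq> \<infinity>"
    then have cw: "continuous_on UNIV \<omega>" using W by (auto simp: wiener_measure_def path_space_def)
    then have [measurable]: "\<omega> \<in> borel_measurable borel" by (rule borel_measurable_continuous_onI)
    show "set_integrable lborel {..0} (\<lambda>s. exp (c * s) * \<omega> s)"
      unfolding set_integrable_def
    proof (rule integrableI_bounded)
      have "(\<lambda>s. exp (c * s) * \<omega> s) \<in> borel_measurable lborel"
        unfolding measurable_lborel2 by (intro borel_measurable_continuous_onI continuous_intros cw)
      then show "(\<lambda>s. indicat_real {..0} s *\<^sub>R (exp (c * s) * \<omega> s)) \<in> borel_measurable lborel"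
        by (intro borel_measurable_scaleR borel_measurable_indicator) simp_all
      have "(\<integral>\<^sup>+ s. ennreal (norm (indicat_real {..0} s *\<^sub>R (exp (c * s) * \<omega> s))) \<partial>lborel) = (\<integral>\<^sup>+s. h (\<omega>, s) \<partial>lborel)"
        by (rule nn_integral_cong) (auto simp: h_def abs_mult ennreal_mult'[symmetric] mult_ac indicator_def)
      then show "(\<integral>\<^sup>+ s. ennreal (norm (indicat_real {..0} s *\<^sub>R (exp (c * s) * \<omega> s))) \<partial>lborel) < \<infinity>"
        using w by (simp add: top.not_eq_extremum)
    qed
  qed
qed

lemma continuous_on_integral_lower:
  fixes h :: "real \<Rightarrow> real"
  assumes "continuous_on {..0} h"
  shows "continuous_on {..0} (\<lambda>t. integral {t..0} h)"
  unfolding continuous_on_eq_continuous_within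
proof
  fix t :: real assume t: "t \<in> {..0}"
  have "continuous_on {t - 1..0} (\<lambda>t. integral {t..0} h)"
    by (intro indefinite_integral_continuous_1' integrable_continuous_interval continuous_on_subset[OF assms]) auto
  then have "continuous (at t within {t - 1..0}) (\<lambda>t. integral {t..0} h)"
    using t by (simp add: continuous_on_eq_continuous_within)
  moreover have "at t within {t - 1..0} = at t within {..0}"
    by (rule at_within_nhd[of _ "{t - 1<..}"]) auto
  ultimately show "continuous (at t within {..0}) (\<lambda>t. integral {t..0} h)" by simp
qed

text \<open>With \<open>a = 1/\<epsilon>\<^sup>2\<close> and \<open>G(t)\<close> the integral of \<open>e\<^bsup>as\<^esup> \<omega>(s)\<close> over \<open>s \<le> t\<close>, a shift of the variable gives
  \<open>z(\<theta>\<^sub>t\<omega>) = - \<epsilon>\<^bsup>-4\<^esup> (e\<^bsup>-at\<^esup> G(t) - \<omega>(t)/a)\<close>. For \<open>t \<le> 0\<close> the comparison of \<open>e\<^bsup>as\<^esup>\<close> with \<open>e\<^bsup>(a-c)t\<^esup> e\<^bsup>cs\<^esup>\<close> bounds the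
  first term by a multiple of \<open>e\<^bsup>-ct\<^esup>\<close>, which the weight \<open>e\<^bsup>2ct\<^esup>\<close> makes integrable; the second
  term is integrable against \<open>e\<^bsup>ct\<^esup>\<close> by assumption.\<close>

lemma ou_regularity:
  assumes w: "\<omega> \<in> path_space" and int: "set_integrable lborel {..0} (\<lambda>s. exp (c * s) * \<omega> s)"
    and c: "0 < c" "c < 1 / \<epsilon>\<^sup>2" and eps: "\<epsilon> > 0"
  shows "continuous_on {..0} (\<lambda>t. z_ou \<epsilon> (shift_path t \<omega>))"
    and "(\<lambda>t. exp (2 * c * t) * \<bar>z_ou \<epsilon> (shift_path t \<omega>)\<bar>) integrable_on {..0}"
proof -
  define a where "a = 1 / \<epsilon>\<^sup>2"
  have a: "0 < c" "c < a" "a > 0" using c by (auto simp: a_def)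
  have cw: "continuous_on UNIV \<omega>" using w by (simp add: path_space_def)
  then have [measurable]: "\<omega> \<in> borel_measurable borel" by (rule borel_measurable_continuous_onI)
  have cwt: "continuous_on A \<omega>" for A by (rule continuous_on_subset[OF cw]) simp
  define h where "h s = exp (a * s) * \<omega> s" for s
  have cis: "set_integrable lborel {..t} (\<lambda>s. exp (c * s) * \<bar>\<omega> s\<bar>)" if "t \<le> 0" for t
  proof -
    have "set_integrable lborel {..0} (\<lambda>s. \<bar>exp (c * s) * \<omega> s\<bar>)" using int by (rule set_integrable_abs)
    then have "set_integrable lborel {..0} (\<lambda>s. exp (c * s) * \<bar>\<omega> s\<bar>)" by (simp add: abs_mult)
    then show ?thesis by (rule set_integrable_subset) (use that in auto)
  qed
  have ele: "exp (a * s) \<le> exp ((a - c) * t) * exp (c * s)" if "s \<le> t" for s t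
  proof -
    have "(a - c) * s \<le> (a - c) * t" using a that by (intro mult_left_mono) auto
    then have "a * s \<le> (a - c) * t + c * s" by (simp add: algebra_simps)
    then show ?thesis by (simp add: exp_add[symmetric])
  qed
  have hi: "set_integrable lborel {..t} h" if "t \<le> 0" for t
    unfolding set_integrable_def
  proof (rule Bochner_Integration.integrable_bound)
    show "integrable lborel (\<lambda>s. exp ((a - c) * t) * (indicator {..t} s *\<^sub>R (exp (c * s) * \<bar>\<omega> s\<bar>)))"
      using cis[OF that] by (simp add: set_integrable_def)
    show "AE s in lborel. norm (indicat_real {..t} s *\<^sub>R h s) \<le> norm (exp ((a - c) * t) * (indicator {..t} s *\<^sub>R (exp (c * s) * \<bar>\<omega> s\<bar>)))"
    proof (rule AE_I2)
      fix s show "norm (indicat_real {..t} s *\<^sub>R h s) \<le> norm (exp ((a - c) * t) * (indicator {..t} s *\<^sub>R (exp (c * s) * \<bar>\<omega> s\<bar>)))"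
        using mult_right_mono[OF ele[of s t], of "\<bar>\<omega> s\<bar>"] by (auto simp: indicator_def h_def abs_mult mult.assoc)
    qed
  qed (simp add: h_def)
  define G where "G t = (LBINT s:{..t}. h s)" for t
  define K where "K = integral {..0} (\<lambda>s. exp (c * s) * \<bar>\<omega> s\<bar>)"
  have G_HK: "(h has_integral G t) {..t}" if "t \<le> 0" for t
    using set_borel_integral_eq_integral[OF hi[OF that]] by (simp add: G_def has_integral_iff)
  have e0: "((\<lambda>\<tau>. exp (a * (\<tau> - 0))) has_integral 1 / a) {..0}" by (rule has_integral_exp_atMost[OF a(3)])
  have e0i: "set_integrable lborel {..0} (\<lambda>\<tau>. exp (a * \<tau>))"
    unfolding set_integrable_def
  proof (rule integrableI_bounded)
    have "(\<integral>\<^sup>+ s. ennreal (norm (indicat_real {..0} s *\<^sub>R exp (a * s))) \<partial>lborel) = (\<integral>\<^sup>+ s. ennreal (exp (a * (s - 0))) * indicator {..0} s \<partial>lborel)"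
      by (rule nn_integral_cong) (auto simp: indicator_def)
    also have "\<dots> = ennreal (1 / a)" by (rule nn_integral_has_integral_lebesgue'[OF _ e0]) simp
    finally show "(\<integral>\<^sup>+ s. ennreal (norm (indicat_real {..0} s *\<^sub>R exp (a * s))) \<partial>lborel) < \<infinity>" by simp
  qed simp
  have e0v: "(LBINT \<tau>:{..0}. exp (a * \<tau>)) = 1 / a"
    using set_borel_integral_eq_integral(2)[OF e0i] e0 by (simp add: integral_unique)
  have z: "z_ou \<epsilon> (shift_path t \<omega>) = - (1 / \<epsilon> ^ 4) * (exp (- a * t) * G t - \<omega> t / a)" if t: "t \<le> 0" for t
  proof -
    define f where "f s = indicator {..t} s *\<^sub>R (exp (- a * t) * h s)" for s
    have fi: "integrable lborel f"
      unfolding f_def set_integrable_def[symmetric] using hi[OF t] by (rule set_integrable_mult_right)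
    have f': "f (t + 1 * x) = indicator {..0} x *\<^sub>R (exp (a * x) * \<omega> (t + x))" for x
      by (auto simp: f_def h_def indicator_def exp_add[symmetric] algebra_simps)
    have i1: "integrable lborel (\<lambda>x. indicator {..0} x *\<^sub>R (exp (a * x) * \<omega> (t + x)))"
      using lborel_integrable_real_affine[OF fi, of 1 t] unfolding f' by simp
    have v1: "(LBINT x:{..0}. exp (a * x) * \<omega> (t + x)) = exp (- a * t) * G t"
    proof -
      have "integral\<^sup>L lborel f = \<bar>1\<bar> *\<^sub>R integral\<^sup>L lborel (\<lambda>x. f (t + 1 * x))"
        by (rule lborel_integral_real_affine) simp
      then have "(LBINT x:{..0}. exp (a * x) * \<omega> (t + x)) = integral\<^sup>L lborel f"
        unfolding f' by (simp add: set_lebesgue_integral_def)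
      also have "\<dots> = exp (- a * t) * G t"
        unfolding f_def G_def set_lebesgue_integral_def[symmetric] by simp
      finally show ?thesis .
    qed
    have "(LBINT \<tau>:{..0}. exp (\<tau> / \<epsilon>\<^sup>2) * shift_path t \<omega> \<tau>) = (LBINT \<tau>:{..0}. exp (a * \<tau>) * \<omega> (t + \<tau>) - \<omega> t * exp (a * \<tau>))"
      by (simp add: shift_path_def a_def algebra_simps)
    also have "\<dots> = exp (- a * t) * G t - \<omega> t * (1 / a)"
      unfolding v1[symmetric] e0v[symmetric]
      using i1 e0i by (subst set_integral_diff(2)) (auto simp: set_integrable_def mult.left_commute[of _ "\<omega> t"])
    finally show ?thesis by (simp add: z_ou_def)
  qed
  have ch: "continuous_on A h" for A unfolding h_def by (intro continuous_intros cwt)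
  have cG: "continuous_on {..0} G"
  proof -
    have e: "G 0 - integral {t..0} h = G t" if "t \<in> {..0}" for t
    proof -
      have "(h has_integral (G t + integral {t..0} h)) ({..t} \<union> {t..0})"
      proof (rule has_integral_Un)
        show "(h has_integral G t) {..t}" using that by (intro G_HK) simp
        show "(h has_integral integral {t..0} h) {t..0}"
          by (intro integrable_integral integrable_continuous_interval ch)
        have "{..t} \<inter> {t..0} \<subseteq> {t}" by auto
        then show "negligible ({..t} \<inter> {t..0})" by (rule negligible_subset[rotated]) simp
      qed
      moreover have "{..t} \<union> {t..0} = {..0}" using that by auto
      ultimately have "(h has_integral (G t + integral {t..0} h)) {..0}" by simp
      then have "G t + integral {t..0} h = G 0"
        by (rule has_integral_unique) (rule G_HK, simp)
      then show ?thesis by simp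
    qed
    have "continuous_on {..0} (\<lambda>t. G 0 - integral {t..0} h)"
      by (intro continuous_intros continuous_on_integral_lower ch)
    then show ?thesis by (rule continuous_on_eq) (rule e)
  qed
  show cz: "continuous_on {..0} (\<lambda>t. z_ou \<epsilon> (shift_path t \<omega>))"
  proof (rule continuous_on_eq)
    show "continuous_on {..0} (\<lambda>t. - (1 / \<epsilon> ^ 4) * (exp (- a * t) * G t - \<omega> t / a))"
      using a by (intro continuous_intros cG cwt) auto
  qed (use z in auto)
  have KI: "((\<lambda>s. exp (c * s) * \<bar>\<omega> s\<bar>) has_integral K) {..0}"
    using set_borel_integral_eq_integral(1)[OF cis[of 0]] by (simp add: K_def integrable_integral)
  have Gb: "\<bar>G t\<bar> \<le> exp ((a - c) * t) * K" if t: "t \<le> 0" for t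
  proof -
    have i: "(\<lambda>s. exp (c * s) * \<bar>\<omega> s\<bar>) integrable_on {..t}" by (rule set_borel_integral_eq_integral(1)[OF cis[OF t]])
    have "\<bar>G t\<bar> = norm (integral {..t} h)" using G_HK[OF t] by (simp add: integral_unique)
    also have "\<dots> \<le> integral {..t} (\<lambda>s. exp ((a - c) * t) * (exp (c * s) * \<bar>\<omega> s\<bar>))"
    proof (rule integral_norm_bound_integral)
      show "h integrable_on {..t}" using G_HK[OF t] by blast
      show "(\<lambda>s. exp ((a - c) * t) * (exp (c * s) * \<bar>\<omega> s\<bar>)) integrable_on {..t}" using i by simp
      show "norm (h s) \<le> exp ((a - c) * t) * (exp (c * s) * \<bar>\<omega> s\<bar>)" if "s \<in> {..t}" for s
        using mult_right_mono[OF ele[of s t], of "\<bar>\<omega> s\<bar>"] that by (simp add: h_def abs_mult mult.assoc)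
    qed
    also have "\<dots> = exp ((a - c) * t) * integral {..t} (\<lambda>s. exp (c * s) * \<bar>\<omega> s\<bar>)" by simp
    also have "\<dots> \<le> exp ((a - c) * t) * K"
      unfolding K_def using i KI t by (intro mult_left_mono integral_subset_le) auto
    finally show ?thesis .
  qed
  show "(\<lambda>t. exp (2 * c * t) * \<bar>z_ou \<epsilon> (shift_path t \<omega>)\<bar>) integrable_on {..0}"
  proof (rule integrable_on_all_intervals_integrable_bound)
    fix u v :: real
    have "(\<lambda>t. exp (2 * c * t) * \<bar>z_ou \<epsilon> (shift_path t \<omega>)\<bar>) integrable_on {u..min v 0}"
      by (intro integrable_continuous_interval continuous_intros continuous_on_subset[OF cz]) auto
    then have "(\<lambda>t. if t \<in> {u..min v 0} then exp (2 * c * t) * \<bar>z_ou \<epsilon> (shift_path t \<omega>)\<bar> else 0) integrable_on cbox u v"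
      by (subst integrable_restrict_Int) (simp add: Int_absorb1 subset_iff)
    then show "(\<lambda>t. if t \<in> {..0} then exp (2 * c * t) * \<bar>z_ou \<epsilon> (shift_path t \<omega>)\<bar> else 0) integrable_on cbox u v"
      by (rule integrable_eq) auto
  next
    show "(\<lambda>t. (1 / \<epsilon> ^ 4) * (K * exp (c * (t - 0)) + (1 / a) * (exp (c * t) * \<bar>\<omega> t\<bar>))) integrable_on {..0}"
      using KI has_integral_exp_atMost[OF a(1), of 0]
      by (intro integrable_on_mult_right integrable_add) (auto simp: integrable_on_def)
  next
    fix t :: real assume "t \<in> {..0}"
    then have t: "t \<le> 0" by simp
    have e1: "exp (2 * c * t) \<le> exp (c * t)" using a t by (simp add: mult_le_cancel_right1)
    have "\<bar>z_ou \<epsilon> (shift_path t \<omega>)\<bar> \<le> (1 / \<epsilon> ^ 4) * (exp (- a * t) * \<bar>G t\<bar> + \<bar>\<omega> t\<bar> / a)"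
      unfolding z[OF t] abs_mult
      using a eps by (intro mult_mono order_trans[OF abs_triangle_ineq4]) (auto simp: abs_mult)
    also have "\<dots> \<le> (1 / \<epsilon> ^ 4) * (exp (- a * t) * (exp ((a - c) * t) * K) + \<bar>\<omega> t\<bar> / a)"
      using eps by (intro mult_left_mono add_right_mono Gb t) auto
    finally have "exp (2 * c * t) * \<bar>z_ou \<epsilon> (shift_path t \<omega>)\<bar> \<le> exp (2 * c * t) * ((1 / \<epsilon> ^ 4) * (exp (- a * t) * (exp ((a - c) * t) * K) + \<bar>\<omega> t\<bar> / a))"
      by (rule mult_left_mono) simp
    also have "\<dots> = (1 / \<epsilon> ^ 4) * (exp (2 * c * t) * exp (- a * t) * exp ((a - c) * t) * K + (1 / a) * (exp (2 * c * t) * \<bar>\<omega> t\<bar>))"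
      by (simp add: algebra_simps)
    also have "exp (2 * c * t) * exp (- a * t) * exp ((a - c) * t) = exp (c * t)"
      unfolding exp_add[symmetric] by (simp add: algebra_simps)
    also have "(1 / \<epsilon> ^ 4) * (exp (c * t) * K + (1 / a) * (exp (2 * c * t) * \<bar>\<omega> t\<bar>)) \<le> (1 / \<epsilon> ^ 4) * (K * exp (c * (t - 0)) + (1 / a) * (exp (c * t) * \<bar>\<omega> t\<bar>))"
      using eps a by (intro mult_left_mono add_mono mult_right_mono e1) (auto simp: mult.commute)
    finally show "norm (exp (2 * c * t) * \<bar>z_ou \<epsilon> (shift_path t \<omega>)\<bar>) \<le> (1 / \<epsilon> ^ 4) * (K * exp (c * (t - 0)) + (1 / a) * (exp (c * t) * \<bar>\<omega> t\<bar>))"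
      by simp
  qed
qed


section \<open>Dependence of the manifolds on the noise intensity\<close>

context wave_semigroup
begin

lemma gap_order: "lam_plus \<epsilon> (N + 1) < eta \<epsilon> N" "eta \<epsilon> N < lam_plus \<epsilon> N" "eta \<epsilon> N < 0" "- eta \<epsilon> N < 1 / \<epsilon>\<^sup>2"
proof -
  have l: "lam_plus \<epsilon> N = lp (N - 1)" "lam_plus \<epsilon> (N + 1) = lp N" using N1 by (simp_all add: lp_def)
  have "lp N < lp (N - 1)" using N1 by (intro lp_strict) auto
  then show "lam_plus \<epsilon> (N + 1) < eta \<epsilon> N" "eta \<epsilon> N < lam_plus \<epsilon> N" unfolding eta_def l by simp_all
  have "lp N < 0" "lp (N - 1) < 0" by (auto intro: lp_neg)
  then show "eta \<epsilon> N < 0" unfolding eta_def l by simp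
  have "- lp n < 1 / \<epsilon>\<^sup>2" if "n \<le> N" for n
  proof -
    have "- lp n = (1 - rt n) / (2 * \<epsilon>\<^sup>2)" by (simp add: lp_eq minus_divide_left)
    also have "\<dots> < 2 / (2 * \<epsilon>\<^sup>2)" using eps rt(1)[OF that] by (intro divide_strict_right_mono) auto
    finally show ?thesis by simp
  qed
  moreover have avg: "- ((x + y) / 2) < B" if "- x < B" "- y < B" for x y B :: real
    using add_strict_mono[OF that] by (simp add: field_simps)
  ultimately show "- eta \<epsilon> N < 1 / \<epsilon>\<^sup>2"
    unfolding eta_def l by (intro avg) auto
qed

lemma lyapunov_perron_wave:
  "\<exists>c. lyapunov_perron (inner_E \<epsilon> N) flow1 (\<lambda>t U. S t (U - proj1 U)) (lam_plus \<epsilon> N) (lam_plus \<epsilon> (N + 1)) (eta \<epsilon> N) c"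
proof -
  obtain c where c: "c > 0" "\<And>U. c * norm U \<le> norm_E \<epsilon> N U" using norm_E_coercive by blast
  have sq: "inner_E \<epsilon> N U U \<le> r\<^sup>2 * inner_E \<epsilon> N V V" if "norm_E \<epsilon> N U \<le> r * norm_E \<epsilon> N V" for U V r
    using power_mono[OF that norm_E_nonneg, of 2] by (simp add: power_mult_distrib norm_E_sq)
  show ?thesis
  proof (rule exI[of _ "c\<^sup>2"], rule lyapunov_perron.intro)
    show "bounded_bilinear (inner_E \<epsilon> N)" by (rule bounded_bilinear_inner_E)
    show "inner_E \<epsilon> N x y = inner_E \<epsilon> N y x" for x y by (rule inner_E_commute)
    show "0 < c\<^sup>2" using c by simp
    show "c\<^sup>2 * (norm x)\<^sup>2 \<le> inner_E \<epsilon> N x x" for x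
      using power_mono[OF c(2)[of x], of 2] c(1) by (simp add: power_mult_distrib norm_E_sq)
    show "lam_plus \<epsilon> (N + 1) < eta \<epsilon> N" "eta \<epsilon> N < lam_plus \<epsilon> N" "eta \<epsilon> N \<le> 0"
      using gap_order by auto
    show "bounded_linear (flow1 t)" for t by (rule bounded_linear_flow1)
    show "inner_E \<epsilon> N (flow1 t x) (flow1 t x) \<le> (exp (lam_plus \<epsilon> N * t))\<^sup>2 * inner_E \<epsilon> N x x" if "t \<le> 0" for t x
      by (rule sq[OF norm_E_flow1_le[OF that]])
    show "continuous_on {..0} (\<lambda>t. flow1 t x)" for x by (rule continuous_on_flow1)
    show "bounded_linear (\<lambda>U. S t (U - proj1 U))" if "0 \<le> t" for t
      by (rule bounded_linear_compose[OF semigroup_linear[OF semigroup that] bounded_linear_sub[OF bounded_linear_ident bounded_linear_proj1]])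
    show "inner_E \<epsilon> N (S t (x - proj1 x)) (S t (x - proj1 x)) \<le> (exp (lam_plus \<epsilon> (N + 1) * t))\<^sup>2 * inner_E \<epsilon> N x x" if "0 \<le> t" for t x
      by (rule sq[OF norm_E_S_le[OF that]])
    show "continuous_on {0..} (\<lambda>t. S t (x - proj1 x))" for x by (rule continuous_on_semigroup[OF semigroup])
  qed
qed

text \<open>The properties of a path on which the construction of \<open>h\<^sub>\<delta>\<close> and the comparison with \<open>h\<^sub>0\<close> rest. The
  zero path has them, which covers the deterministic manifold.\<close>

definition regular_path :: "(real \<Rightarrow> real) \<Rightarrow> bool" where
  "regular_path \<omega> \<longleftrightarrow> continuous_on {..0} (\<lambda>t. z_ou \<epsilon> (shift_path t \<omega>)) \<and>
     (\<lambda>t. exp (- eta \<epsilon> N * t) * \<bar>z_ou \<epsilon> (shift_path t \<omega>)\<bar>) integrable_on {..0}"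

lemma z_ou_zero_path: "z_ou \<epsilon> (shift_path t (\<lambda>_. 0)) = 0"
  by (simp add: z_ou_def shift_path_def)

lemma regular_zero_path: "regular_path (\<lambda>_. 0)"
  by (simp add: regular_path_def z_ou_zero_path integrable_0)

lemma AE_regular_path:
  assumes "wiener_measure W"
  shows "AE \<omega> in W. regular_path \<omega>"
proof -
  define c where "c = - eta \<epsilon> N / 2"
  have c: "0 < c" "c < 1 / \<epsilon>\<^sup>2" using gap_order(3,4) by (auto simp: c_def)
  have "- eta \<epsilon> N = 2 * c" by (simp add: c_def)
  then show ?thesis
    using wiener_exp_integrable[OF assms c(1)]
  proof (elim AE_mp, intro AE_I2 impI)
    fix \<omega> assume "\<omega> \<in> space W" and i: "set_integrable lborel {..0} (\<lambda>s. exp (c * s) * \<omega> s)"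
    then have "\<omega> \<in> path_space" using assms by (simp add: wiener_measure_def)
    from ou_regularity[OF this i c eps] show "regular_path \<omega>"
      unfolding regular_path_def \<open>- eta \<epsilon> N = 2 * c\<close> by blast
  qed
qed

text \<open>The definitions of \<open>lp_solution\<close>, \<open>lp_orbit\<close> and \<open>h_lp\<close> are translated into the abstract Lyapunov-Perron
  equation with initial term \<open>e\<^bsup>At\<^esup>\<xi>\<close>, forcing \<open>b(s) = (\<delta> z(\<theta>\<^sub>s\<omega>) \<phi>, 0)\<close> and nonlinearity
  \<open>G(u, v) = (0, \<epsilon>\<^bsup>-2\<^esup> f(u))\<close>; the weight that dominates the forcing is linear in \<open>\<delta>\<close>.\<close>

lemma manifold_noise_estimate:
  fixes f :: "l2 \<Rightarrow> l2" and \<phi> :: h01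
  assumes L: "L \<ge> 0" "L * (1 / (lam_plus \<epsilon> N - eta \<epsilon> N) + 1 / (eta \<epsilon> N - lam_plus \<epsilon> (N + 1))) < 1"
    and lip: "\<And>U V. norm_E \<epsilon> N (F_wave \<epsilon> f \<phi> 0 (\<lambda>_. 0) U - F_wave \<epsilon> f \<phi> 0 (\<lambda>_. 0) V) \<le> L * norm_E \<epsilon> N (U - V)"
    and \<omega>: "regular_path \<omega>"
  shows "\<exists>C\<ge>0. \<forall>\<delta>\<ge>0. \<forall>\<xi>\<in>E1 \<epsilon> N.
    norm_E \<epsilon> N (h_lp \<epsilon> N f \<phi> S \<delta> \<xi> \<omega> - h_lp \<epsilon> N f \<phi> S 0 \<xi> (\<lambda>_. 0) + (0, (\<delta> * z_ou \<epsilon> \<omega>) *\<^sub>R emb \<phi>)) \<le> C * \<delta>"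
proof -
  obtain c where "lyapunov_perron (inner_E \<epsilon> N) flow1 (\<lambda>t U. S t (U - proj1 U)) (lam_plus \<epsilon> N) (lam_plus \<epsilon> (N + 1)) (eta \<epsilon> N) c"
    using lyapunov_perron_wave by blast
  then interpret LP: lyapunov_perron "inner_E \<epsilon> N" flow1 "\<lambda>t U. S t (U - proj1 U)" "lam_plus \<epsilon> N" "lam_plus \<epsilon> (N + 1)" "eta \<epsilon> N" c .
  have pE: "norm_E \<epsilon> N = LP.p" by (auto simp: norm_E_def LP.p_def)
  define G :: "E \<Rightarrow> E" where "G U = (0, (1 / \<epsilon>\<^sup>2) *\<^sub>R f (emb (fst U)))" for U
  define b :: "real \<Rightarrow> (real \<Rightarrow> real) \<Rightarrow> real \<Rightarrow> E" where "b \<delta> w s = ((\<delta> * z_ou \<epsilon> (shift_path s w)) *\<^sub>R \<phi>, 0)" for \<delta> w s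
  have F: "F_wave \<epsilon> f \<phi> \<delta> (shift_path s w) U = b \<delta> w s + G U" for \<delta> s w U
    by (simp add: F_wave_def b_def G_def case_prod_beta)
  have G: "LP.p (G U - G V) \<le> L * LP.p (U - V)" for U V
    using lip[of U V] by (simp add: F_wave_def G_def case_prod_beta pE)
  have kap: "LP.kappa L < 1" using L(2) unfolding LP.kappa_def .
  define g where "g \<delta> w s = \<delta> * LP.p (\<phi>, 0) * (exp (- eta \<epsilon> N * s) * \<bar>z_ou \<epsilon> (shift_path s w)\<bar>)" for \<delta> w s
  have pb: "LP.p (b \<delta> w s) = exp (eta \<epsilon> N * s) * g \<delta> w s" if "\<delta> \<ge> 0" for \<delta> w s
  proof -
    have "b \<delta> w s = (\<delta> * z_ou \<epsilon> (shift_path s w)) *\<^sub>R (\<phi>, 0)" by (simp add: b_def)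
    then have "LP.p (b \<delta> w s) = \<delta> * \<bar>z_ou \<epsilon> (shift_path s w)\<bar> * LP.p (\<phi>, 0)"
      using that by (simp only: LP.p_scaleR abs_mult abs_of_nonneg)
    also have "\<dots> = (exp (eta \<epsilon> N * s) * exp (- eta \<epsilon> N * s)) * (\<delta> * \<bar>z_ou \<epsilon> (shift_path s w)\<bar> * LP.p (\<phi>, 0))"
      by (simp add: exp_add[symmetric])
    finally show ?thesis by (simp add: g_def mult_ac)
  qed
  have bdom: "LP.dominated (b \<delta> w) (g \<delta> w) 0" if "\<delta> \<ge> 0" "regular_path w" for \<delta> w
    unfolding LP.dominated_def
  proof (intro conjI allI impI)
    show "continuous_on {..0} (b \<delta> w)"
      unfolding b_def[abs_def] using that(2) by (intro continuous_intros) (auto simp: regular_path_def)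
  qed (use pb that in auto)
  have gw: "LP.weight (g \<delta> w)" if "\<delta> \<ge> 0" "regular_path w" for \<delta> w
    using that unfolding LP.weight_def g_def regular_path_def
    by (auto intro!: integrable_on_mult_right)
  have y: "LP.tempered (\<lambda>t. flow1 t \<xi>)" for \<xi>
    unfolding LP.tempered_def
  proof (intro conjI exI[of _ "LP.p \<xi>"] allI impI continuous_on_flow1)
    fix t :: real assume t: "t \<le> 0"
    have "LP.p (flow1 t \<xi>) \<le> exp (lam_plus \<epsilon> N * t) * LP.p \<xi>" by (rule LP.p_K1[OF t])
    also have "\<dots> \<le> exp (eta \<epsilon> N * t) * LP.p \<xi>"
      using gap_order(2) t by (intro mult_right_mono) (auto simp: mult_right_mono_neg)
    finally show "LP.p (flow1 t \<xi>) \<le> exp (eta \<epsilon> N * t) * LP.p \<xi>" .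
  qed simp
  have Kint: "((\<lambda>s. backward \<epsilon> N S (t - s) (proj_P \<epsilon> N (F_wave \<epsilon> f \<phi> \<delta> (shift_path s w) (U s)))) has_integral I) {t..0} \<longleftrightarrow>
      ((\<lambda>s. flow1 (t - s) (b \<delta> w s + G (U s))) has_integral I) {t..0}" for t \<delta> w U I
    by (rule has_integral_cong) (simp add: F proj_P_eq backward_eq mem_E1_iff flow1_proj1 del: proj1_add)
  have iff: "lp_solution \<epsilon> N f \<phi> S \<delta> \<xi> w U \<longleftrightarrow> LP.solves (\<lambda>t. flow1 t \<xi>) (b \<delta> w) G U"
    if \<delta>: "\<delta> \<ge> 0" and w: "regular_path w" and \<xi>: "\<xi> \<in> E1 \<epsilon> N" for \<delta> w \<xi> U
  proof
    assume lp: "lp_solution \<epsilon> N f \<phi> S \<delta> \<xi> w U"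
    then have "bdd_above ((\<lambda>t. exp (- eta \<epsilon> N * t) * norm_E \<epsilon> N (U t)) ` {..0})" by (simp add: lp_solution_def)
    then obtain C where C: "\<And>t. t \<le> 0 \<Longrightarrow> exp (- eta \<epsilon> N * t) * norm_E \<epsilon> N (U t) \<le> C" by (auto simp: bdd_above_def)
    have "norm_E \<epsilon> N (U t) \<le> exp (eta \<epsilon> N * t) * max 0 C" if "t \<le> 0" for t
    proof -
      have "exp (eta \<epsilon> N * t) * (exp (- eta \<epsilon> N * t) * norm_E \<epsilon> N (U t)) \<le> exp (eta \<epsilon> N * t) * max 0 C"
        using C[OF that] by (intro mult_left_mono) auto
      then show ?thesis by (simp add: mult.assoc[symmetric] exp_add[symmetric])
    qed
    then have "LP.tempered U" using lp by (auto simp: LP.tempered_def lp_solution_def pE intro!: exI[of _ "max 0 C"])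
    moreover have "U t = LP.lp_map (\<lambda>t. flow1 t \<xi>) (\<lambda>s. b \<delta> w s + G (U s)) t" if t: "t \<le> 0" for t
    proof -
      obtain I J where I: "((\<lambda>s. backward \<epsilon> N S (t - s) (proj_P \<epsilon> N (F_wave \<epsilon> f \<phi> \<delta> (shift_path s w) (U s)))) has_integral I) {t..0}"
        and J: "((\<lambda>s. S (t - s) (proj_Q \<epsilon> N (F_wave \<epsilon> f \<phi> \<delta> (shift_path s w) (U s)))) has_integral J) {..t}"
        and U: "U t = backward \<epsilon> N S t \<xi> - I + J"
        using lp t unfolding lp_solution_def by blast
      have "LP.conv1 (\<lambda>s. b \<delta> w s + G (U s)) t = I"
        using I unfolding Kint LP.conv1_def by (rule integral_unique)
      moreover have "LP.conv2 (\<lambda>s. b \<delta> w s + G (U s)) t = J"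
        using J unfolding F proj_Q_eq LP.conv2_def by (rule integral_unique)
      ultimately show ?thesis unfolding LP.lp_map_def using U backward_eq[OF t \<xi>] by simp
    qed
    ultimately show "LP.solves (\<lambda>t. flow1 t \<xi>) (b \<delta> w) G U" by (simp add: LP.solves_def)
  next
    assume so: "LP.solves (\<lambda>t. flow1 t \<xi>) (b \<delta> w) G U"
    then have tU: "LP.tempered U" by (simp add: LP.solves_def)
    then obtain C where C: "\<And>t. t \<le> 0 \<Longrightarrow> LP.p (U t) \<le> exp (eta \<epsilon> N * t) * C" by (auto simp: LP.tempered_def)
    obtain M where M: "M \<ge> 0" "LP.dominated (\<lambda>s. b \<delta> w s + G (U s)) (g \<delta> w) M"
      using LP.tempered_dominated[OF bdom[OF \<delta> w] G L(1) tU] by blast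
    have cF: "continuous_on {..0} (\<lambda>s. b \<delta> w s + G (U s))" using M by (simp add: LP.dominated_def)
    show "lp_solution \<epsilon> N f \<phi> S \<delta> \<xi> w U"
      unfolding lp_solution_def
    proof (intro conjI allI impI)
      show "continuous_on {..0} U" using tU by (simp add: LP.tempered_def)
      show "bdd_above ((\<lambda>t. exp (- eta \<epsilon> N * t) * norm_E \<epsilon> N (U t)) ` {..0})"
      proof (rule bdd_aboveI2)
        fix t :: real assume "t \<in> {..0}"
        then have "exp (- eta \<epsilon> N * t) * norm_E \<epsilon> N (U t) \<le> exp (- eta \<epsilon> N * t) * (exp (eta \<epsilon> N * t) * C)"
          unfolding pE by (intro mult_left_mono C) auto
        then show "exp (- eta \<epsilon> N * t) * norm_E \<epsilon> N (U t) \<le> C"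
          by (simp add: mult.assoc[symmetric] exp_add[symmetric])
      qed
      fix t :: real assume t: "t \<le> 0"
      have "U t = backward \<epsilon> N S t \<xi> - LP.conv1 (\<lambda>s. b \<delta> w s + G (U s)) t + LP.conv2 (\<lambda>s. b \<delta> w s + G (U s)) t"
        using so t unfolding LP.solves_def LP.lp_map_def backward_eq[OF t \<xi>] by blast
      moreover have "((\<lambda>s. backward \<epsilon> N S (t - s) (proj_P \<epsilon> N (F_wave \<epsilon> f \<phi> \<delta> (shift_path s w) (U s)))) has_integral LP.conv1 (\<lambda>s. b \<delta> w s + G (U s)) t) {t..0}"
        unfolding Kint by (rule LP.conv1_has_integral[OF cF t])
      moreover have "((\<lambda>s. S (t - s) (proj_Q \<epsilon> N (F_wave \<epsilon> f \<phi> \<delta> (shift_path s w) (U s)))) has_integral LP.conv2 (\<lambda>s. b \<delta> w s + G (U s)) t) {..t}"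
        unfolding F proj_Q_eq by (rule LP.conv2_has_integral[OF M(2) gw[OF \<delta> w] M(1) t])
      ultimately show "\<exists>I J.
        ((\<lambda>s. backward \<epsilon> N S (t - s) (proj_P \<epsilon> N (F_wave \<epsilon> f \<phi> \<delta> (shift_path s w) (U s)))) has_integral I) {t..0} \<and>
        ((\<lambda>s. S (t - s) (proj_Q \<epsilon> N (F_wave \<epsilon> f \<phi> \<delta> (shift_path s w) (U s)))) has_integral J) {..t} \<and>
        U t = backward \<epsilon> N S t \<xi> - I + J" by blast
    qed
  qed
  have h: "\<exists>U. LP.solves (\<lambda>t. flow1 t \<xi>) (b \<delta> w) G U \<and> h_lp \<epsilon> N f \<phi> S \<delta> \<xi> w = LP.conv2 (\<lambda>s. b \<delta> w s + G (U s)) 0"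
    if \<delta>: "\<delta> \<ge> 0" and w: "regular_path w" and \<xi>: "\<xi> \<in> E1 \<epsilon> N" for \<delta> w \<xi>
  proof -
    obtain U0 where U0: "LP.solves (\<lambda>t. flow1 t \<xi>) (b \<delta> w) G U0"
      using LP.solution_exists[OF y bdom[OF \<delta> w] gw[OF \<delta> w] G L(1) kap] by blast
    \<comment> \<open>The orbit is chosen among functions that vanish at positive times.\<close>
    define U where "U t = (if t \<le> 0 then U0 t else 0)" for t
    have U: "LP.solves (\<lambda>t. flow1 t \<xi>) (b \<delta> w) G U"
      by (rule LP.solves_cong[OF _ U0]) (simp add: U_def)
    have "lp_orbit \<epsilon> N f \<phi> S \<delta> \<xi> w = U"
      unfolding lp_orbit_def iff[OF \<delta> w \<xi>]
    proof (rule the_equality)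
      show "LP.solves (\<lambda>t. flow1 t \<xi>) (b \<delta> w) G U \<and> (\<forall>t>0. U t = 0)" using U by (simp add: U_def)
      fix V assume V: "LP.solves (\<lambda>t. flow1 t \<xi>) (b \<delta> w) G V \<and> (\<forall>t>0. V t = 0)"
      show "V = U"
      proof
        fix t show "V t = U t"
          using LP.solution_unique[OF bdom[OF \<delta> w] gw[OF \<delta> w] G L(1) kap _ U, of V t] V
          by (cases "t \<le> 0") (auto simp: U_def)
      qed
    qed
    then have "h_lp \<epsilon> N f \<phi> S \<delta> \<xi> w = LP.conv2 (\<lambda>s. b \<delta> w s + G (U s)) 0"
      unfolding h_lp_def LP.conv2_def F proj_Q_eq by simp
    with U show ?thesis by blast
  qed
  define C1 where "C1 = (1 + 2 * L / ((1 - LP.kappa L) * (eta \<epsilon> N - lam_plus \<epsilon> (N + 1)))) * LP.mass (g 1 \<omega>)"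
  define C where "C = C1 + \<bar>z_ou \<epsilon> \<omega>\<bar> * LP.p (0, emb \<phi>)"
  have C1: "C1 \<ge> 0"
    unfolding C1_def using L(1) kap gap_order(1) LP.mass_nonneg[OF gw[OF _ \<omega>, of 1]] by simp
  show ?thesis
  proof (intro exI[of _ C] conjI allI impI ballI)
    show "C \<ge> 0" using C1 by (simp add: C_def)
    fix \<delta> :: real and \<xi> assume \<delta>: "\<delta> \<ge> 0" and \<xi>: "\<xi> \<in> E1 \<epsilon> N"
    obtain U where U: "LP.solves (\<lambda>t. flow1 t \<xi>) (b \<delta> \<omega>) G U"
      and hU: "h_lp \<epsilon> N f \<phi> S \<delta> \<xi> \<omega> = LP.conv2 (\<lambda>s. b \<delta> \<omega> s + G (U s)) 0"
      using h[OF \<delta> \<omega> \<xi>] by blast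
    obtain V where V: "LP.solves (\<lambda>t. flow1 t \<xi>) (b 0 (\<lambda>_. 0)) G V"
      and hV: "h_lp \<epsilon> N f \<phi> S 0 \<xi> (\<lambda>_. 0) = LP.conv2 (\<lambda>s. b 0 (\<lambda>_. 0) s + G (V s)) 0"
      using h[OF _ regular_zero_path \<xi>, of 0] by auto
    have b0: "b 0 (\<lambda>_. 0) s = 0" for s by (simp add: b_def zero_prod_def)
    have "LP.p (LP.conv2 (\<lambda>s. b \<delta> \<omega> s + G (U s)) 0 - LP.conv2 (\<lambda>s. b 0 (\<lambda>_. 0) s + G (V s)) 0)
      \<le> (1 + 2 * L / ((1 - LP.kappa L) * (eta \<epsilon> N - lam_plus \<epsilon> (N + 1)))) * LP.mass (g \<delta> \<omega>)"
      by (rule LP.stable_part_close[OF bdom[OF \<delta> \<omega>] gw[OF \<delta> \<omega>] bdom[OF _ regular_zero_path] gw[OF _ regular_zero_path] gw[OF \<delta> \<omega>] _ G L(1) kap U V])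
         (simp_all add: b0 pb \<delta>)
    also have "LP.mass (g \<delta> \<omega>) = \<delta> * LP.mass (g 1 \<omega>)"
      by (simp add: LP.mass_def g_def[abs_def] mult.assoc)
    finally have 1: "LP.p (h_lp \<epsilon> N f \<phi> S \<delta> \<xi> \<omega> - h_lp \<epsilon> N f \<phi> S 0 \<xi> (\<lambda>_. 0)) \<le> C1 * \<delta>"
      unfolding hU hV C1_def by (simp add: mult_ac)
    have "(0, (\<delta> * z_ou \<epsilon> \<omega>) *\<^sub>R emb \<phi>) = (\<delta> * z_ou \<epsilon> \<omega>) *\<^sub>R ((0, emb \<phi>) :: E)" by simp
    then have 2: "LP.p (0, (\<delta> * z_ou \<epsilon> \<omega>) *\<^sub>R emb \<phi>) = \<bar>z_ou \<epsilon> \<omega>\<bar> * LP.p (0, emb \<phi>) * \<delta>"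
      using \<delta> by (simp only: LP.p_scaleR abs_mult) simp
    show "norm_E \<epsilon> N (h_lp \<epsilon> N f \<phi> S \<delta> \<xi> \<omega> - h_lp \<epsilon> N f \<phi> S 0 \<xi> (\<lambda>_. 0) + (0, (\<delta> * z_ou \<epsilon> \<omega>) *\<^sub>R emb \<phi>)) \<le> C * \<delta>"
      unfolding pE by (rule order_trans[OF LP.p_add]) (use 1 2 in \<open>simp add: C_def distrib_right\<close>)
  qed
qed

text \<open>The infimum \<open>Lip_F\<close> lies strictly below the reciprocal of the sum of the two kernel masses, so some
  Lipschitz constant does. The differences of \<open>F\<close> do not see the noise; therefore the zero path, which
  belongs to \<open>Omega_z\<close>, represents all of them.\<close>

lemma spectral_gap_lipschitz:
  assumes "spectral_gap \<epsilon> N f \<phi> S 0"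
  obtains L where "L \<ge> 0" "L * (1 / (lam_plus \<epsilon> N - eta \<epsilon> N) + 1 / (eta \<epsilon> N - lam_plus \<epsilon> (N + 1))) < 1"
    "\<And>U V. norm_E \<epsilon> N (F_wave \<epsilon> f \<phi> 0 (\<lambda>_. 0) U - F_wave \<epsilon> f \<phi> 0 (\<lambda>_. 0) V) \<le> L * norm_E \<epsilon> N (U - V)"
proof -
  define r where "r = 1 / (lam_plus \<epsilon> N - eta \<epsilon> N) + 1 / (eta \<epsilon> N - lam_plus \<epsilon> (N + 1))"
  have r: "r > 0" using gap_order(1,2) by (simp add: r_def add_pos_pos)
  define A where "A = {ennreal L | L. 0 \<le> L \<and>
     (\<forall>\<delta>\<ge>0. \<forall>\<omega>\<in>Omega_z \<epsilon>. \<forall>U V.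
        norm_E \<epsilon> N (F_wave \<epsilon> f \<phi> \<delta> \<omega> U - F_wave \<epsilon> f \<phi> \<delta> \<omega> V) \<le> L * norm_E \<epsilon> N (U - V))}"
  have "Lip_F \<epsilon> N f \<phi> * ennreal r < 1"
    using assms unfolding spectral_gap_def Let_def r_def
    by (rule le_less_trans[rotated]) simp
  then have lt: "Inf A * ennreal r < 1" by (simp add: Lip_F_def A_def)
  have "\<exists>x\<in>A. x < ennreal (1 / r)"
  proof (rule ccontr)
    assume "\<not> ?thesis"
    then have "ennreal (1 / r) \<le> Inf A" by (intro Inf_greatest) (auto simp: not_less)
    then have "ennreal (1 / r) * ennreal r \<le> Inf A * ennreal r" by (rule mult_right_mono) simp
    moreover have "ennreal (1 / r) * ennreal r = 1"
      using r by (simp add: ennreal_mult[symmetric])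
    ultimately show False using lt by simp
  qed
  then obtain L where L: "0 \<le> L" "ennreal L < ennreal (1 / r)"
    "\<And>\<delta> \<omega> U V. \<delta> \<ge> 0 \<Longrightarrow> \<omega> \<in> Omega_z \<epsilon> \<Longrightarrow>
        norm_E \<epsilon> N (F_wave \<epsilon> f \<phi> \<delta> \<omega> U - F_wave \<epsilon> f \<phi> \<delta> \<omega> V) \<le> L * norm_E \<epsilon> N (U - V)"
    unfolding A_def by blast
  have "(\<lambda>_. 0) \<in> Omega_z \<epsilon>"
    by (simp add: Omega_z_def path_space_def shift_path_def z_ou_def set_integrable_def)
  moreover have "L * r < 1" using L r by (simp add: ennreal_less_iff field_simps)
  ultimately show ?thesis using L that[of L] unfolding r_def by simp
qed

text \<open>The points of both manifolds over the shifted base point \<open>\<zeta>\<close> are compared.\<close>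

theorem manifold_semicontinuity:
  assumes "spectral_gap \<epsilon> N f \<phi> S 0" and \<omega>: "regular_path \<omega>"
  shows "((\<lambda>\<delta>. SUP U\<in>manifold_part \<epsilon> N f \<phi> S R \<delta> \<omega>.
            INF V\<in>manifold_0 \<epsilon> N f \<phi> S. ennreal (norm_E \<epsilon> N (U - V))) \<longlongrightarrow> 0) (at_right 0)"
proof -
  obtain L where L: "L \<ge> 0" "L * (1 / (lam_plus \<epsilon> N - eta \<epsilon> N) + 1 / (eta \<epsilon> N - lam_plus \<epsilon> (N + 1))) < 1"
    "\<And>U V. norm_E \<epsilon> N (F_wave \<epsilon> f \<phi> 0 (\<lambda>_. 0) U - F_wave \<epsilon> f \<phi> 0 (\<lambda>_. 0) V) \<le> L * norm_E \<epsilon> N (U - V)"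
    using spectral_gap_lipschitz[OF assms(1)] by blast
  obtain C where C: "C \<ge> 0" "\<And>\<delta> \<xi>. \<delta> \<ge> 0 \<Longrightarrow> \<xi> \<in> E1 \<epsilon> N \<Longrightarrow>
    norm_E \<epsilon> N (h_lp \<epsilon> N f \<phi> S \<delta> \<xi> \<omega> - h_lp \<epsilon> N f \<phi> S 0 \<xi> (\<lambda>_. 0) + (0, (\<delta> * z_ou \<epsilon> \<omega>) *\<^sub>R emb \<phi>)) \<le> C * \<delta>"
    using manifold_noise_estimate[OF L \<omega>] by blast
  have bound: "(SUP U\<in>manifold_part \<epsilon> N f \<phi> S R \<delta> \<omega>. INF V\<in>manifold_0 \<epsilon> N f \<phi> S. ennreal (norm_E \<epsilon> N (U - V))) \<le> ennreal (C * \<delta>)"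
    if \<delta>: "\<delta> \<ge> 0" for \<delta>
  proof (rule SUP_least)
    fix U assume "U \<in> manifold_part \<epsilon> N f \<phi> S R \<delta> \<omega>"
    then obtain \<xi> where \<xi>: "\<xi> \<in> E1 \<epsilon> N" "U = \<xi> + h_tilde \<epsilon> N f \<phi> S \<delta> \<xi> \<omega>" by (auto simp: manifold_part_def)
    define q :: E where "q = (0, (\<delta> * z_ou \<epsilon> \<omega>) *\<^sub>R emb \<phi>)"
    define \<zeta> where "\<zeta> = \<xi> - proj1 q"
    have \<zeta>: "\<zeta> \<in> E1 \<epsilon> N" using \<xi>(1) by (simp add: \<zeta>_def mem_E1_iff)
    have U: "U = \<zeta> + h_lp \<epsilon> N f \<phi> S \<delta> \<zeta> \<omega> + q"
      using \<xi>(2) by (simp add: h_tilde_def q_def[symmetric] proj_P_eq proj_Q_eq \<zeta>_def)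
    define V where "V = \<zeta> + h_lp \<epsilon> N f \<phi> S 0 \<zeta> (\<lambda>_. 0)"
    have "V + (0, (0 * z_ou \<epsilon> (\<lambda>_. 0)) *\<^sub>R emb \<phi>) \<in> manifold_0 \<epsilon> N f \<phi> S"
      unfolding manifold_0_def inertial_manifold_def V_def using \<zeta> by blast
    then have "V \<in> manifold_0 \<epsilon> N f \<phi> S" by (simp add: zero_prod_def[symmetric])
    then have "(INF V\<in>manifold_0 \<epsilon> N f \<phi> S. ennreal (norm_E \<epsilon> N (U - V))) \<le> ennreal (norm_E \<epsilon> N (U - V))"
      by (rule INF_lower)
    also have "U - V = h_lp \<epsilon> N f \<phi> S \<delta> \<zeta> \<omega> - h_lp \<epsilon> N f \<phi> S 0 \<zeta> (\<lambda>_. 0) + q" by (simp add: U V_def)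
    also have "ennreal (norm_E \<epsilon> N \<dots>) \<le> ennreal (C * \<delta>)"
      unfolding q_def by (intro ennreal_leI C \<delta> \<zeta>)
    finally show "(INF V\<in>manifold_0 \<epsilon> N f \<phi> S. ennreal (norm_E \<epsilon> N (U - V))) \<le> ennreal (C * \<delta>)" .
  qed
  show ?thesis
  proof (rule tendsto_sandwich[OF _ _ tendsto_const])
    show "\<forall>\<^sub>F \<delta> in at_right 0. 0 \<le> (SUP U\<in>manifold_part \<epsilon> N f \<phi> S R \<delta> \<omega>.
            INF V\<in>manifold_0 \<epsilon> N f \<phi> S. ennreal (norm_E \<epsilon> N (U - V)))" by simp
    show "\<forall>\<^sub>F \<delta> in at_right 0. (SUP U\<in>manifold_part \<epsilon> N f \<phi> S R \<delta> \<omega>.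
            INF V\<in>manifold_0 \<epsilon> N f \<phi> S. ennreal (norm_E \<epsilon> N (U - V))) \<le> ennreal (C * \<delta>)"
      by (rule eventually_at_rightI[of 0 1]) (auto intro: bound)
    have "((\<lambda>\<delta>. ennreal (C * \<delta>)) \<longlongrightarrow> ennreal (C * 0)) (at_right 0)"
      by (intro tendsto_ennrealI tendsto_intros)
    then show "((\<lambda>\<delta>. ennreal (C * \<delta>)) \<longlongrightarrow> 0) (at_right 0)" by simp
  qed
qed

end

theorem theorem3p2:
  fixes \<epsilon> :: real and N :: nat and f :: "l2 \<Rightarrow> l2" and \<phi> :: h01
    and S :: "real \<Rightarrow> E \<Rightarrow> E" and W :: "(real \<Rightarrow> real) measure"
  assumes "N \<ge> 1" and "\<epsilon> > 0" and "1 / (2 * \<epsilon>) > real N + 1"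
    and "\<exists>L. L-lipschitz_on UNIV f"
    and "C0_semigroup S" and "generator S = wave_op \<epsilon>"
    and "wiener_measure W"
    and "\<forall>\<delta>\<ge>0. spectral_gap \<epsilon> N f \<phi> S \<delta>"
  shows "\<forall>R>0. AE \<omega> in W.
    ((\<lambda>\<delta>. SUP U\<in>manifold_part \<epsilon> N f \<phi> S R \<delta> \<omega>.
            INF V\<in>manifold_0 \<epsilon> N f \<phi> S. ennreal (norm_E \<epsilon> N (U - V))) \<longlongrightarrow> 0) (at_right 0)"
proof (intro allI impI)
  fix R :: real
  interpret wave_semigroup \<epsilon> N S
    using assms by unfold_locales auto
  have gap: "spectral_gap \<epsilon> N f \<phi> S 0" using assms(8) by simp
  show "AE \<omega> in W.
    ((\<lambda>\<delta>. SUP U\<in>manifold_part \<epsilon> N f \<phi> S R \<delta> \<omega>.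
            INF V\<in>manifold_0 \<epsilon> N f \<phi> S. ennreal (norm_E \<epsilon> N (U - V))) \<longlongrightarrow> 0) (at_right 0)"
    using AE_regular_path[OF assms(7)] by (rule eventually_mono) (rule manifold_semicontinuity[OF gap])
qed

end
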